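(* Let $k$ be a non-ANOVA kernel, and assume $1<\mathrm d^{\mathrm{low}}_{\boldsymbol\gamma}\le\mathrm d^{\mathrm{up}}_{\boldsymbol\gamma}<\infty$ and $\mathrm d^{\mathrm{low}}_{\boldsymbol\lambda}>1$. Let the cost function satisfy $\$(k)\gtrsim k^s$ for all $k\in\mathbb N$ and some $s>0$. Then the polynomial convergence rate $r_\infty=r_\infty(H_{\boldsymbol\gamma})$ of $n$-th minimal errors of $L^2$-approximation on the non-ANOVA space $H_{\boldsymbol\gamma}$ in the nested subspace sampling cost model satisfies $$r_\infty\ \le\ \min\left\{\frac{\mathrm d^{\mathrm{low}}_{\boldsymbol\lambda}}{2},\ \frac{\mathrm d^{\mathrm{up}}_{\boldsymbol\gamma}-1}{2s}\right\}.$$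
   Context: **Kernel and weights.** Let $(D,\Sigma,\rho)$ be a probability space, $D\ne\emptyset$. For a reproducing kernel $K$, $H(K)$ denotes its reproducing kernel Hilbert space (RKHS); $H(1)$ is the space of constant functions. Let $k:D\times D\to\mathbb R$ be a reproducing kernel with $H(1)\cap H(k)=\{0\}$, with measurable functions in $H(k)$, and $\int_D k(x,x)\,d\rho(x)<\infty$. Then $S:H(1+k)\to L^2(D,\rho)$, $f\mapsto f$, is compact; $\|S\|$ is its operator norm. The kernel $k$, assumed to satisfy $k(\cdot,x)\in L^2(D,\rho)$ for all $x$, is an *ANOVA kernel* if $\int_D k(y,x)\,d\rho(y)=0$ for all $x\in D$, and a *non-ANOVA kernel* otherwise. Let $1\ge\gamma_1\ge\gamma_2\ge\dots>0$ be a null sequence, $\mathcal U$ the set of finite subsets of $\mathbb N$, and $\gamma_{\boldsymbol u}=\prod_{j\in\boldsymbol u}\gamma_j$ (product weights; $\gamma_\emptyset=1$), $\boldsymbol u\in\mathcal U$. Assume $\gamma_{\boldsymbol u_j}\|S\|^{2|\boldsymbol u_j|}\to0$ for an enumeration $(\boldsymbol u_j)_j$ of $\mathcal U$. **Spaces.** $k_{\boldsymbol u}(\boldsymbol x,\boldsymbol y)=\prod_{j\in\boldsymbol u}k(x_j,y_j)$, $H_{\boldsymbol u}=H(k_{\boldsymbol u})$ (its elements depend only on $x_j$, $j\in\boldsymbol u$); $\mathfrak X=\{\boldsymbol x\in D^{\mathbb N}:\sum_{\boldsymbol u\in\mathcal U}\gamma_{\boldsymbol u}k_{\boldsymbol u}(\boldsymbol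 x,\boldsymbol x)<\infty\}$; $K_{\boldsymbol\gamma}=\sum_{\boldsymbol u\in\mathcal U}\gamma_{\boldsymbol u}k_{\boldsymbol u}$ on $\mathfrak X\times\mathfrak X$; $H_{\boldsymbol\gamma}=H(K_{\boldsymbol\gamma})$. Each $f\in H_{\boldsymbol\gamma}$ has a unique decomposition $f=\sum_{\boldsymbol u}f_{\boldsymbol u}$, $f_{\boldsymbol u}\in H_{\boldsymbol u}$, and $\|f\|_{H_{\boldsymbol\gamma}}^2=\sum_{\boldsymbol u}\gamma_{\boldsymbol u}^{-1}\|f_{\boldsymbol u}\|_{H_{\boldsymbol u}}^2$. The solution operator is $\mathcal S:H_{\boldsymbol\gamma}\to L^2(\mathfrak X,\rho^{\mathbb N})$, $f\mapsto f$, where $\rho^{\mathbb N}$ is the product measure. $H_{\boldsymbol\gamma}$ is called an ANOVA space if $k$ is an ANOVA kernel and a non-ANOVA space otherwise. **Eigenvalues.** $W=S^*S$ on $H(1+k)$ is assumed to have infinitely many positive eigenvalues $\boldsymbol\lambda=(\lambda_j)_{j\in\mathbb N}$, $\lambda_1\ge\lambda_2\ge\dots>0$ (a null sequence), with eigenfunctions forming a complete orthonormal system of $H(1+k)$. **Decay rates.** For a null sequence $\boldsymbol x=(x_j)$ of positive reals, $\mathrm d^{\mathrm{low}}_{\boldsymbol x}=\operatorname{decay}(\boldsymbol x)=\sup\{\alpha>0:\sum_j x_j^{1/\alpha}<\infty\}$ ($\sup\emptyset=0$) and $\mathrm d^{\mathrm{up}}_{\boldsymbol x}=\inf\{\alpha\ge0:\inf_n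 x_nn^\alpha>0\}$ ($\inf\emptyset=\infty$). $\mathrm d_{\boldsymbol\gamma}$ refers to $(\gamma_j)_{j}$ and $\mathrm d_{\boldsymbol\lambda}$ to $(\lambda_j)_j$. **Algorithms, cost, errors.** Admissible algorithms are $\mathcal A(f)=\sum_{j=1}^nL_{\boldsymbol u_j}(f)\,g_j$ with $g_j\in L^2(\mathfrak X,\rho^{\mathbb N})$, $\boldsymbol u_j\in\mathcal U$, $L_{\boldsymbol u_j}\in H_{\boldsymbol\gamma}^*$ represented (Riesz) by an element of $\bigoplus_{\boldsymbol v\subseteq\boldsymbol u_j}H_{\boldsymbol v}$ (the zero algorithm, with cost $0$, is also allowed). Fix a non-decreasing cost function $\$:\mathbb N_0\to[1,\infty)$. In the nested subspace sampling model, a functional $L$ has cost $\$(\max\boldsymbol u)$, where $\boldsymbol u$ is the minimal finite set such that the representer of $L$ lies in $\bigoplus_{\boldsymbol v\subseteq\boldsymbol u}H_{\boldsymbol v}$ ($\max\emptyset=0$), and $\operatorname{cost}(\mathcal A)$ is the sum of the costs of its functionals. The worst-case error is $e(\mathcal A,H_{\boldsymbol\gamma})=\sup_{\|f\|_{H_{\boldsymbol\gamma}}\le1}\|\mathcal S(f)-\mathcal A(f)\|_{L^2(\mathfrak X,\rho^{\mathbb N})}$; $e(n,H_{\boldsymbol\gamma})=\inf\{e(\mathcal A,H_{\boldsymbol\gamma}):\mathcal A\text{ admissible},\ \operatorname{cost}(\mathcal A)\le n\}$; and $r_\infty(H_{\boldsymbol\gamma})=\operatorname{decay}((e(n,H_{\boldsymbol\gamma}))_{n\in\mathbb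 N})$. $\gtrsim$ means $\ge$ up to a positive constant independent of $k$. *)

theory Defs
  imports "HOL-Probability.Probability"
begin

section \<open>Reproducing kernel Hilbert spaces\<close>

text \<open>
  A real function on a set X is represented by the total function that agrees with it on X and
  vanishes off X, so that equality of functions on X is equality in HOL and pointwise sums and
  multiples need no restriction. The inner product ip is only meaningful on the carrier H.
\<close>

definition zero_off :: "'a set \<Rightarrow> ('a \<Rightarrow> real) \<Rightarrow> 'a \<Rightarrow> real" where
  "zero_off X f = (\<lambda>x. if x \<in> X then f x else 0)"

definition hilbert_function_space ::
  "'a set \<Rightarrow> ('a \<Rightarrow> real) set \<Rightarrow> (('a \<Rightarrow> real) \<Rightarrow> ('a \<Rightarrow> real) \<Rightarrow> real) \<Rightarrow> bool" where
  "hilbert_function_space X H ip \<longleftrightarrow>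
     (\<forall>f\<in>H. \<forall>x. x \<notin> X \<longrightarrow> f x = 0) \<and>
     (\<lambda>_. 0) \<in> H \<and>
     (\<forall>f\<in>H. \<forall>g\<in>H. (\<lambda>x. f x + g x) \<in> H) \<and>
     (\<forall>c. \<forall>f\<in>H. (\<lambda>x. c * f x) \<in> H) \<and>
     (\<forall>f\<in>H. \<forall>g\<in>H. ip f g = ip g f) \<and>
     (\<forall>f\<in>H. \<forall>g\<in>H. \<forall>h\<in>H. ip (\<lambda>x. f x + g x) h = ip f h + ip g h) \<and>
     (\<forall>c. \<forall>f\<in>H. \<forall>g\<in>H. ip (\<lambda>x. c * f x) g = c * ip f g) \<and>
     (\<forall>f\<in>H. 0 \<le> ip f f) \<and>
     (\<forall>f\<in>H. ip f f = 0 \<longrightarrow> f = (\<lambda>_. 0)) \<and>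
     (\<forall>F :: nat \<Rightarrow> 'a \<Rightarrow> real.
        (\<forall>n. F n \<in> H) \<and>
        (\<forall>e>0. \<exists>N. \<forall>m\<ge>N. \<forall>n\<ge>N.
            sqrt (ip (\<lambda>x. F m x - F n x) (\<lambda>x. F m x - F n x)) < e) \<longrightarrow>
        (\<exists>f\<in>H. (\<lambda>n. sqrt (ip (\<lambda>x. F n x - f x) (\<lambda>x. F n x - f x))) \<longlonglongrightarrow> 0))"

definition is_RKHS ::
  "'a set \<Rightarrow> ('a \<Rightarrow> 'a \<Rightarrow> real) \<Rightarrow> ('a \<Rightarrow> real) set \<Rightarrow> (('a \<Rightarrow> real) \<Rightarrow> ('a \<Rightarrow> real) \<Rightarrow> real) \<Rightarrow> bool" where
  "is_RKHS X K H ip \<longleftrightarrow>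
     hilbert_function_space X H ip \<and>
     (\<forall>x\<in>X. zero_off X (\<lambda>y. K y x) \<in> H) \<and>
     (\<forall>x\<in>X. \<forall>f\<in>H. ip f (zero_off X (\<lambda>y. K y x)) = f x)"

definition reproducing_kernel :: "'a set \<Rightarrow> ('a \<Rightarrow> 'a \<Rightarrow> real) \<Rightarrow> bool" where
  "reproducing_kernel X K \<longleftrightarrow> (\<exists>H ip. is_RKHS X K H ip)"

text \<open>
  By the Moore-Aronszajn theorem a reproducing kernel determines the carrier of its RKHS and the
  inner product on this carrier; the choice below is arbitrary only in the irrelevant values of
  the inner product outside of the carrier.
\<close>

definition RKHS ::
  "'a set \<Rightarrow> ('a \<Rightarrow> 'a \<Rightarrow> real) \<Rightarrow> ('a \<Rightarrow> real) set \<times> (('a \<Rightarrow> real) \<Rightarrow> ('a \<Rightarrow> real) \<Rightarrow> real)" where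
  "RKHS X K = (SOME (H, ip). is_RKHS X K H ip)"

definition rkhs :: "'a set \<Rightarrow> ('a \<Rightarrow> 'a \<Rightarrow> real) \<Rightarrow> ('a \<Rightarrow> real) set" where
  "rkhs X K = fst (RKHS X K)"

definition rkhs_inner ::
  "'a set \<Rightarrow> ('a \<Rightarrow> 'a \<Rightarrow> real) \<Rightarrow> ('a \<Rightarrow> real) \<Rightarrow> ('a \<Rightarrow> real) \<Rightarrow> real" where
  "rkhs_inner X K = snd (RKHS X K)"

definition rkhs_norm :: "'a set \<Rightarrow> ('a \<Rightarrow> 'a \<Rightarrow> real) \<Rightarrow> ('a \<Rightarrow> real) \<Rightarrow> real" where
  "rkhs_norm X K f = sqrt (rkhs_inner X K f f)"

definition rkhs_ball :: "'a set \<Rightarrow> ('a \<Rightarrow> 'a \<Rightarrow> real) \<Rightarrow> ('a \<Rightarrow> real) set" where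
  "rkhs_ball X K = {f \<in> rkhs X K. rkhs_norm X K f \<le> 1}"


section \<open>Square-integrable functions\<close>

text \<open>Elements of the space L2 are represented by functions, not by equivalence classes.\<close>

definition square_integrable :: "'a measure \<Rightarrow> ('a \<Rightarrow> real) \<Rightarrow> bool" where
  "square_integrable M f \<longleftrightarrow> f \<in> borel_measurable M \<and> integrable M (\<lambda>x. (f x)\<^sup>2)"

definition L2_inner :: "'a measure \<Rightarrow> ('a \<Rightarrow> real) \<Rightarrow> ('a \<Rightarrow> real) \<Rightarrow> real" where
  "L2_inner M f g = (\<integral>x. f x * g x \<partial>M)"

definition L2_norm :: "'a measure \<Rightarrow> ('a \<Rightarrow> real) \<Rightarrow> real" where
  "L2_norm M f = sqrt (L2_inner M f f)"


section \<open>The univariate kernel and the embedding of H(1+k) into L2\<close>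

definition anova_kernel :: "'a measure \<Rightarrow> ('a \<Rightarrow> 'a \<Rightarrow> real) \<Rightarrow> bool" where
  "anova_kernel M k \<longleftrightarrow> (\<forall>x\<in>space M. (\<integral>y. k y x \<partial>M) = 0)"

definition one_plus :: "('a \<Rightarrow> 'a \<Rightarrow> real) \<Rightarrow> 'a \<Rightarrow> 'a \<Rightarrow> real" where
  "one_plus k = (\<lambda>x y. 1 + k x y)"

text \<open>
  The embedding S maps f in H(1+k) to f, so it does not appear as a separate function:
  the first definition is its operator norm, the second its adjoint.
\<close>

definition embedding_norm :: "'a measure \<Rightarrow> ('a \<Rightarrow> 'a \<Rightarrow> real) \<Rightarrow> real" where
  "embedding_norm M k = (SUP f\<in>rkhs_ball (space M) (one_plus k). L2_norm M f)"

definition embedding_adjoint :: "'a measure \<Rightarrow> ('a \<Rightarrow> 'a \<Rightarrow> real) \<Rightarrow> ('a \<Rightarrow> real) \<Rightarrow> 'a \<Rightarrow> real" where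
  "embedding_adjoint M k g =
     (THE w. w \<in> rkhs (space M) (one_plus k) \<and>
        (\<forall>f\<in>rkhs (space M) (one_plus k). rkhs_inner (space M) (one_plus k) f w = L2_inner M f g))"

definition W_op :: "'a measure \<Rightarrow> ('a \<Rightarrow> 'a \<Rightarrow> real) \<Rightarrow> ('a \<Rightarrow> real) \<Rightarrow> 'a \<Rightarrow> real" where
  "W_op M k f = embedding_adjoint M k f"

definition complete_orthonormal_system ::
  "'a set \<Rightarrow> ('a \<Rightarrow> 'a \<Rightarrow> real) \<Rightarrow> (nat \<Rightarrow> 'a \<Rightarrow> real) \<Rightarrow> bool" where
  "complete_orthonormal_system X K e \<longleftrightarrow>
     (\<forall>j\<ge>1. e j \<in> rkhs X K) \<and>
     (\<forall>i\<ge>1. \<forall>j\<ge>1. rkhs_inner X K (e i) (e j) = (if i = j then 1 else 0)) \<and>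
     (\<forall>f\<in>rkhs X K. (\<forall>j\<ge>1. rkhs_inner X K f (e j) = 0) \<longrightarrow> f = (\<lambda>_. 0))"


section \<open>Decay rates\<close>

text \<open>
  Sequences are indexed by the positive integers; their value at 0 is never used.
  Inserting 0 implements the convention that the supremum of the empty set is 0; in ereal the
  infimum of the empty set is infinity.
\<close>

definition decay_low :: "(nat \<Rightarrow> real) \<Rightarrow> ereal" where
  "decay_low x = Sup (insert 0 {ereal a | a. a > 0 \<and> summable (\<lambda>j. x (Suc j) powr (1 / a))})"

definition decay_up :: "(nat \<Rightarrow> real) \<Rightarrow> ereal" where
  "decay_up x = Inf {ereal a | a. a \<ge> 0 \<and> (INF n\<in>{1..}. x n * real n powr a) > 0}"


section \<open>Function spaces of infinitely many variables\<close>

definition findex :: "nat set set" where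
  "findex = {u. finite u \<and> u \<subseteq> {1..}}"

definition prod_weight :: "(nat \<Rightarrow> real) \<Rightarrow> nat set \<Rightarrow> real" where
  "prod_weight \<gamma> u = (\<Prod>j\<in>u. \<gamma> j)"

definition tensor_kernel ::
  "('a \<Rightarrow> 'a \<Rightarrow> real) \<Rightarrow> nat set \<Rightarrow> (nat \<Rightarrow> 'a) \<Rightarrow> (nat \<Rightarrow> 'a) \<Rightarrow> real" where
  "tensor_kernel k u x y = (\<Prod>j\<in>u. k (x j) (y j))"

definition domX :: "'a measure \<Rightarrow> ('a \<Rightarrow> 'a \<Rightarrow> real) \<Rightarrow> (nat \<Rightarrow> real) \<Rightarrow> (nat \<Rightarrow> 'a) set" where
  "domX M k \<gamma> =
     {x \<in> {1..} \<rightarrow>\<^sub>E space M. (\<lambda>u. prod_weight \<gamma> u * tensor_kernel k u x x) summable_on findex}"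

definition K_gamma ::
  "('a \<Rightarrow> 'a \<Rightarrow> real) \<Rightarrow> (nat \<Rightarrow> real) \<Rightarrow> (nat \<Rightarrow> 'a) \<Rightarrow> (nat \<Rightarrow> 'a) \<Rightarrow> real" where
  "K_gamma k \<gamma> x y = (\<Sum>\<^sub>\<infinity>u\<in>findex. prod_weight \<gamma> u * tensor_kernel k u x y)"

definition H_u ::
  "'a measure \<Rightarrow> ('a \<Rightarrow> 'a \<Rightarrow> real) \<Rightarrow> (nat \<Rightarrow> real) \<Rightarrow> nat set \<Rightarrow> ((nat \<Rightarrow> 'a) \<Rightarrow> real) set" where
  "H_u M k \<gamma> u = rkhs (domX M k \<gamma>) (tensor_kernel k u)"

definition H_gamma ::
  "'a measure \<Rightarrow> ('a \<Rightarrow> 'a \<Rightarrow> real) \<Rightarrow> (nat \<Rightarrow> real) \<Rightarrow> ((nat \<Rightarrow> 'a) \<Rightarrow> real) set" where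
  "H_gamma M k \<gamma> = rkhs (domX M k \<gamma>) (K_gamma k \<gamma>)"

definition seq_measure ::
  "'a measure \<Rightarrow> ('a \<Rightarrow> 'a \<Rightarrow> real) \<Rightarrow> (nat \<Rightarrow> real) \<Rightarrow> (nat \<Rightarrow> 'a) measure" where
  "seq_measure M k \<gamma> = restrict_space (Pi\<^sub>M {1..} (\<lambda>_. M)) (domX M k \<gamma>)"

definition subset_sum ::
  "'a measure \<Rightarrow> ('a \<Rightarrow> 'a \<Rightarrow> real) \<Rightarrow> (nat \<Rightarrow> real) \<Rightarrow> nat set \<Rightarrow> ((nat \<Rightarrow> 'a) \<Rightarrow> real) set" where
  "subset_sum M k \<gamma> u =
     {\<lambda>x. \<Sum>v\<in>Pow u. h v x | h. \<forall>v\<in>Pow u. h v \<in> H_u M k \<gamma> v}"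


section \<open>Algorithms, cost and minimal errors\<close>

type_synonym 'a functional = "((nat \<Rightarrow> 'a) \<Rightarrow> real) \<Rightarrow> real"

text \<open>
  An algorithm is the list of its pairs (L, g), since its cost depends on the functionals used;
  the empty list is the zero algorithm.
\<close>

type_synonym 'a algorithm = "('a functional \<times> ((nat \<Rightarrow> 'a) \<Rightarrow> real)) list"

definition represented_in ::
  "'a measure \<Rightarrow> ('a \<Rightarrow> 'a \<Rightarrow> real) \<Rightarrow> (nat \<Rightarrow> real) \<Rightarrow> 'a functional \<Rightarrow> nat set \<Rightarrow> bool" where
  "represented_in M k \<gamma> L u \<longleftrightarrow>
     (\<exists>l \<in> H_gamma M k \<gamma> \<inter> subset_sum M k \<gamma> u.
        \<forall>f\<in>H_gamma M k \<gamma>. L f = rkhs_inner (domX M k \<gamma>) (K_gamma k \<gamma>) f l)"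

definition admissible ::
  "'a measure \<Rightarrow> ('a \<Rightarrow> 'a \<Rightarrow> real) \<Rightarrow> (nat \<Rightarrow> real) \<Rightarrow> 'a algorithm \<Rightarrow> bool" where
  "admissible M k \<gamma> A \<longleftrightarrow>
     (\<forall>(L, g) \<in> set A. (\<exists>u\<in>findex. represented_in M k \<gamma> L u) \<and>
        square_integrable (seq_measure M k \<gamma>) g)"

definition apply_alg :: "'a algorithm \<Rightarrow> ((nat \<Rightarrow> 'a) \<Rightarrow> real) \<Rightarrow> (nat \<Rightarrow> 'a) \<Rightarrow> real" where
  "apply_alg A f x = (\<Sum>(L, g)\<leftarrow>A. L f * g x)"

text \<open>
  The minimal set is unique: the representer has a unique decomposition into components from the
  spaces H_v, and the minimal set is the union of all v with a non-zero component.
\<close>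

definition active_set ::
  "'a measure \<Rightarrow> ('a \<Rightarrow> 'a \<Rightarrow> real) \<Rightarrow> (nat \<Rightarrow> real) \<Rightarrow> 'a functional \<Rightarrow> nat set" where
  "active_set M k \<gamma> L =
     (SOME u. u \<in> findex \<and> represented_in M k \<gamma> L u \<and>
        (\<forall>v\<in>findex. represented_in M k \<gamma> L v \<and> v \<subseteq> u \<longrightarrow> v = u))"

definition max_index :: "nat set \<Rightarrow> nat" where
  "max_index u = (if u = {} then 0 else Max u)"

definition nested_cost ::
  "(nat \<Rightarrow> real) \<Rightarrow> 'a measure \<Rightarrow> ('a \<Rightarrow> 'a \<Rightarrow> real) \<Rightarrow> (nat \<Rightarrow> real) \<Rightarrow> 'a algorithm \<Rightarrow> real" where
  "nested_cost c M k \<gamma> A = (\<Sum>(L, g)\<leftarrow>A. c (max_index (active_set M k \<gamma> L)))"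

definition wc_error ::
  "'a measure \<Rightarrow> ('a \<Rightarrow> 'a \<Rightarrow> real) \<Rightarrow> (nat \<Rightarrow> real) \<Rightarrow> 'a algorithm \<Rightarrow> ereal" where
  "wc_error M k \<gamma> A =
     (SUP f\<in>rkhs_ball (domX M k \<gamma>) (K_gamma k \<gamma>).
        ereal (L2_norm (seq_measure M k \<gamma>) (\<lambda>x. f x - apply_alg A f x)))"

text \<open>
  The conversion to a real number is harmless: the zero algorithm always competes, and its
  worst-case error, the norm of the embedding of H_gamma into L2, is finite.
\<close>

definition min_error ::
  "(nat \<Rightarrow> real) \<Rightarrow> 'a measure \<Rightarrow> ('a \<Rightarrow> 'a \<Rightarrow> real) \<Rightarrow> (nat \<Rightarrow> real) \<Rightarrow> nat \<Rightarrow> real" where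
  "min_error c M k \<gamma> n =
     real_of_ereal (INF A\<in>{A. admissible M k \<gamma> A \<and> nested_cost c M k \<gamma> A \<le> real n}. wc_error M k \<gamma> A)"

definition conv_rate ::
  "(nat \<Rightarrow> real) \<Rightarrow> 'a measure \<Rightarrow> ('a \<Rightarrow> 'a \<Rightarrow> real) \<Rightarrow> (nat \<Rightarrow> real) \<Rightarrow> ereal" where
  "conv_rate c M k \<gamma> = decay_low (min_error c M k \<gamma>)"

end

theory Submission
  imports Defs
begin

text \<open>
Both bounds come from fooling functions: if every functional of an algorithm vanishes at h, then
the worst-case error of the algorithm is at least the L2 norm of h divided by its norm in
\<open>H\<^sub>\<gamma>\<close> (\<open>wc_error_ge\<close>).

For the bound by the eigenvalues, every functional costs at least 1, so an algorithm of cost at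
most n uses at most n functionals. Some non-zero g in the span of the first n + 1 eigenfunctions,
read as a function of the first coordinate, is annihilated by all of them. Functions of the first
coordinate from H(1 + k) lie in \<open>H\<^sub>\<gamma>\<close>, with a norm larger by at most the factor
\<open>1 / sqrt (\<gamma> 1)\<close>, so the n-th minimal error is at least \<open>sqrt (\<gamma> 1 * lam (n + 1))\<close>
(\<open>min_error_ge_eigenvalue\<close>).

For the bound by the weights, the growth of the cost confines all representers of an algorithm of
cost at most n to the first m coordinates, where m is of order \<open>n powr (1/s)\<close>. As k is not an
ANOVA kernel, there is a point z at which the section of k has a non-zero mean I. The
function h that sends x to the sum of \<open>\<gamma> j * k (x j) z\<close> over j from m + 1 to 2m is orthogonal to all
representers. With G the sum of these weights \<open>\<gamma> j\<close>, its squared norm is at most k(z,z) G, whereas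
its L2 norm is at least the absolute value of its mean, which is |I| G: the means of the
summands add up instead of the squares of their norms. Hence the squared error is at least
a constant times G (\<open>min_error_ge_tail\<close>), which is of order \<open>m powr (1 - \<alpha>)\<close> at least
if \<open>\<gamma> j\<close> is of order \<open>j powr (- \<alpha>)\<close> at least.

The orthogonality is the delicate point: a representer that does not depend on the coordinate j
must be orthogonal to all components that involve j (\<open>orthogonal_to_coordinate\<close>). It rests on
\<open>H(1) \<inter> H(k) = {0}\<close> and on an intrinsic description of reproducing kernel Hilbert spaces: f belongs
to H(K) with norm at most \<open>sqrt C\<close> if and only if the square of the sum of \<open>c x * f x\<close> is at most C
times the quadratic form of K at c, for all finitely supported c (\<open>rkhs_criterion\<close>). By this
description, the hypothesis yields signed measures of finite support and mass 1 at which the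
quadratic form of k is arbitrarily small. Averaging the j-th coordinate of y over such a measure
turns the section at y of the kernel of \<open>H\<^sub>\<gamma>\<close>, up to a small error, into its part without j, and
leaves the values of the representer unchanged. So the part with j contributes nothing.

The spaces are given by their kernels only. That they exist is the Moore-Aronszajn theorem
(\<open>Moore_Aronszajn\<close>), and the positive semidefiniteness of the kernels involved is the Schur product
theorem (\<open>Schur_product\<close>).
\<close>

section \<open>Semi-inner products and Riesz representation\<close>

lemma quadratic_bound:
  fixes a b c :: real
  assumes "\<And>t. 0 \<le> a * t\<^sup>2 + 2 * b * t + c" "0 \<le> a"
  shows "b\<^sup>2 \<le> a * c"
proof (cases "a = 0")
  case True
  have "b = 0"
  proof (rule ccontr)
    assume "b \<noteq> 0"
    have "0 \<le> 2 * b * (- (c + 1) / (2 * b)) + c" using assms(1)[of "- (c + 1) / (2 * b)"] True by simp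
    then show False using \<open>b \<noteq> 0\<close> by (simp add: field_simps)
  qed
  then show ?thesis using True by simp
next
  case False
  then have "a > 0" using assms(2) by simp
  have "0 \<le> a * (- b / a)\<^sup>2 + 2 * b * (- b / a) + c" by (rule assms(1))
  also have "\<dots> = c - b\<^sup>2 / a" using \<open>a > 0\<close> by (simp add: field_simps power2_eq_square)
  finally show ?thesis using \<open>a > 0\<close> by (simp add: field_simps)
qed

text \<open>
Three kinds of function spaces share this structure: reproducing kernel Hilbert spaces,
square-integrable functions, and finitely supported coefficient functions with the quadratic form
of a kernel. On the last two the form is in general only semidefinite.
\<close>

locale semi_inner_product =
  fixes V :: "('b \<Rightarrow> real) set" and ip :: "('b \<Rightarrow> real) \<Rightarrow> ('b \<Rightarrow> real) \<Rightarrow> real"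
  assumes zero_mem: "(\<lambda>_. 0) \<in> V"
    and add_mem: "f \<in> V \<Longrightarrow> g \<in> V \<Longrightarrow> (\<lambda>x. f x + g x) \<in> V"
    and scale_mem: "f \<in> V \<Longrightarrow> (\<lambda>x. c * f x) \<in> V"
    and ip_sym: "f \<in> V \<Longrightarrow> g \<in> V \<Longrightarrow> ip f g = ip g f"
    and ip_add: "f \<in> V \<Longrightarrow> g \<in> V \<Longrightarrow> h \<in> V \<Longrightarrow> ip (\<lambda>x. f x + g x) h = ip f h + ip g h"
    and ip_scale: "f \<in> V \<Longrightarrow> g \<in> V \<Longrightarrow> ip (\<lambda>x. c * f x) g = c * ip f g"
    and ip_nonneg: "f \<in> V \<Longrightarrow> 0 \<le> ip f f"
begin

definition ip_norm :: "('b \<Rightarrow> real) \<Rightarrow> real" where "ip_norm f = sqrt (ip f f)"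

definition ip_Cauchy :: "(nat \<Rightarrow> 'b \<Rightarrow> real) \<Rightarrow> bool" where
  "ip_Cauchy S \<longleftrightarrow> (\<forall>e>0. \<exists>N. \<forall>m\<ge>N. \<forall>n\<ge>N. ip_norm (\<lambda>x. S m x - S n x) < e)"

lemma diff_mem: "f \<in> V \<Longrightarrow> g \<in> V \<Longrightarrow> (\<lambda>x. f x - g x) \<in> V"
  using add_mem[of f "\<lambda>x. (-1) * g x"] scale_mem[of g "-1"] by simp

lemma ip_add_right: "f \<in> V \<Longrightarrow> g \<in> V \<Longrightarrow> h \<in> V \<Longrightarrow> ip h (\<lambda>x. f x + g x) = ip h f + ip h g"
  using ip_sym[of h "\<lambda>x. f x + g x"] add_mem[of f g] by (simp add: ip_add ip_sym)

lemma ip_scale_right: "f \<in> V \<Longrightarrow> g \<in> V \<Longrightarrow> ip f (\<lambda>x. c * g x) = c * ip f g"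
  using ip_sym[of f "\<lambda>x. c * g x"] scale_mem[of g c] by (simp add: ip_scale ip_sym)

lemma ip_diff: "f \<in> V \<Longrightarrow> g \<in> V \<Longrightarrow> h \<in> V \<Longrightarrow> ip (\<lambda>x. f x - g x) h = ip f h - ip g h"
  using ip_add[of f "\<lambda>x. (-1) * g x" h] scale_mem[of g "-1"] ip_scale[of g h "-1"] by simp

lemma ip_diff_right: "f \<in> V \<Longrightarrow> g \<in> V \<Longrightarrow> h \<in> V \<Longrightarrow> ip h (\<lambda>x. f x - g x) = ip h f - ip h g"
  using ip_sym[of h "\<lambda>x. f x - g x"] diff_mem[of f g] by (simp add: ip_diff ip_sym)

lemma ip_zero: "f \<in> V \<Longrightarrow> ip (\<lambda>_. 0) f = 0"
  using ip_scale[OF zero_mem, of f 0] by simp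

lemma sum_mem: "(\<And>i. i \<in> I \<Longrightarrow> f i \<in> V) \<Longrightarrow> (\<lambda>x. \<Sum>i\<in>I. f i x) \<in> V"
  by (induction I rule: infinite_finite_induct) (auto intro: zero_mem add_mem)

lemma ip_sum: "(\<And>i. i \<in> I \<Longrightarrow> f i \<in> V) \<Longrightarrow> g \<in> V \<Longrightarrow> ip (\<lambda>x. \<Sum>i\<in>I. f i x) g = (\<Sum>i\<in>I. ip (f i) g)"
proof (induction I rule: infinite_finite_induct)
  case (insert i I)
  then show ?case using ip_add[of "f i" "\<lambda>x. \<Sum>i\<in>I. f i x" g] sum_mem[of I f] by simp
qed (auto intro: ip_zero)

lemma ip_sum_right: "(\<And>i. i \<in> I \<Longrightarrow> f i \<in> V) \<Longrightarrow> g \<in> V \<Longrightarrow> ip g (\<lambda>x. \<Sum>i\<in>I. f i x) = (\<Sum>i\<in>I. ip g (f i))"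
  using ip_sum[of I f g] ip_sym sum_mem[of I f] by simp

lemma ip_sum_sum:
  assumes "\<And>i. i \<in> I \<Longrightarrow> f i \<in> V"
  shows "ip (\<lambda>x. \<Sum>i\<in>I. f i x) (\<lambda>x. \<Sum>i\<in>I. f i x) = (\<Sum>i\<in>I. \<Sum>j\<in>I. ip (f i) (f j))"
proof -
  have "(\<lambda>x. \<Sum>i\<in>I. f i x) \<in> V" by (rule sum_mem[OF assms])
  then show ?thesis using assms by (simp add: ip_sum ip_sum_right)
qed

lemma ip_square_add:
  assumes "f \<in> V" "g \<in> V"
  shows "ip (\<lambda>x. f x + g x) (\<lambda>x. f x + g x) = ip f f + 2 * ip f g + ip g g"
  using assms by (simp add: ip_add ip_add_right add_mem ip_sym[of g f])

lemma ip_square_diff: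
  assumes "f \<in> V" "g \<in> V"
  shows "ip (\<lambda>x. f x - g x) (\<lambda>x. f x - g x) = ip f f - 2 * ip f g + ip g g"
  using assms by (simp add: ip_diff ip_diff_right diff_mem ip_sym[of g f])

lemma Cauchy_Schwarz:
  assumes "f \<in> V" "g \<in> V"
  shows "(ip f g)\<^sup>2 \<le> ip f f * ip g g"
proof -
  have "0 \<le> ip g g * t\<^sup>2 + 2 * ip f g * t + ip f f" for t
    using ip_nonneg[OF add_mem[OF assms(1) scale_mem[OF assms(2), of t]]] assms
    by (simp add: ip_square_add scale_mem ip_scale ip_scale_right power2_eq_square algebra_simps)
  from quadratic_bound[OF this ip_nonneg[OF assms(2)]] show ?thesis by (simp add: mult.commute)
qed

lemma ip_norm_nonneg: "f \<in> V \<Longrightarrow> 0 \<le> ip_norm f"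
  by (simp add: ip_norm_def ip_nonneg)

lemma ip_norm_square: "f \<in> V \<Longrightarrow> (ip_norm f)\<^sup>2 = ip f f"
  by (simp add: ip_norm_def ip_nonneg)

lemma abs_ip_le: "f \<in> V \<Longrightarrow> g \<in> V \<Longrightarrow> \<bar>ip f g\<bar> \<le> ip_norm f * ip_norm g"
  using real_sqrt_le_mono[OF Cauchy_Schwarz[of f g]] by (simp add: ip_norm_def real_sqrt_mult)

lemma ip_norm_triangle:
  assumes "f \<in> V" "g \<in> V"
  shows "ip_norm (\<lambda>x. f x + g x) \<le> ip_norm f + ip_norm g"
proof (rule power2_le_imp_le)
  show "(ip_norm (\<lambda>x. f x + g x))\<^sup>2 \<le> (ip_norm f + ip_norm g)\<^sup>2"
    using assms abs_ip_le[of f g] by (simp add: ip_norm_square add_mem ip_square_add power2_sum)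
qed (use assms ip_norm_nonneg in auto)

lemma ip_norm_diff_commute: "f \<in> V \<Longrightarrow> g \<in> V \<Longrightarrow> ip_norm (\<lambda>x. f x - g x) = ip_norm (\<lambda>x. g x - f x)"
  by (simp add: ip_norm_def ip_square_diff ip_sym[of f g])

lemma ip_norm_triangle_diff:
  assumes "f \<in> V" "g \<in> V" "h \<in> V"
  shows "ip_norm (\<lambda>x. f x - h x) \<le> ip_norm (\<lambda>x. f x - g x) + ip_norm (\<lambda>x. g x - h x)"
  using ip_norm_triangle[OF diff_mem[OF assms(1,2)] diff_mem[OF assms(2,3)]] by simp

lemma ip_norm_le_diff: "f \<in> V \<Longrightarrow> g \<in> V \<Longrightarrow> ip_norm f \<le> ip_norm (\<lambda>x. f x - g x) + ip_norm g"
  using ip_norm_triangle[OF diff_mem[of f g], of g] by simp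

lemma ip_Cauchy_bounded:
  assumes "ip_Cauchy S" "\<And>n. S n \<in> V"
  shows "\<exists>C>0. \<forall>n. ip_norm (S n) \<le> C"
proof -
  obtain N where N: "\<And>m n. m \<ge> N \<Longrightarrow> n \<ge> N \<Longrightarrow> ip_norm (\<lambda>x. S m x - S n x) < 1"
    using assms(1) unfolding ip_Cauchy_def by (metis zero_less_one)
  define C where "C = (\<Sum>n\<le>N. ip_norm (S n)) + 1"
  have le: "ip_norm (S n) \<le> (\<Sum>n\<le>N. ip_norm (S n))" if "n \<le> N" for n
    by (rule member_le_sum) (use that assms ip_norm_nonneg in auto)
  have "ip_norm (S n) \<le> C" for n
  proof (cases "n \<le> N")
    case True
    then show ?thesis using le[of n] unfolding C_def by linarith
  next
    case False
    then show ?thesis using le[of N] N[of n N] ip_norm_le_diff[OF assms(2) assms(2), of n N]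
      unfolding C_def by simp
  qed
  moreover have "C > 0" unfolding C_def using assms by (auto intro!: add_nonneg_pos sum_nonneg ip_norm_nonneg)
  ultimately show ?thesis by blast
qed

lemma ip_Cauchy_diff:
  assumes "ip_Cauchy S" "ip_Cauchy T" "\<And>n. S n \<in> V" "\<And>n. T n \<in> V"
  shows "ip_Cauchy (\<lambda>n x. S n x - T n x)"
  unfolding ip_Cauchy_def
proof (intro allI impI)
  fix e :: real assume e: "e > 0"
  obtain N1 where N1: "\<And>m n. m \<ge> N1 \<Longrightarrow> n \<ge> N1 \<Longrightarrow> ip_norm (\<lambda>x. S m x - S n x) < e/2"
    using assms(1) e unfolding ip_Cauchy_def by (metis half_gt_zero)
  obtain N2 where N2: "\<And>m n. m \<ge> N2 \<Longrightarrow> n \<ge> N2 \<Longrightarrow> ip_norm (\<lambda>x. T m x - T n x) < e/2"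
    using assms(2) e unfolding ip_Cauchy_def by (metis half_gt_zero)
  have "ip_norm (\<lambda>x. (S m x - T m x) - (S n x - T n x)) < e" if "m \<ge> max N1 N2" "n \<ge> max N1 N2" for m n
  proof -
    have "(\<lambda>x. (S m x - T m x) - (S n x - T n x)) = (\<lambda>x. (S m x - S n x) + (T n x - T m x))" by auto
    then show ?thesis
      using ip_norm_triangle[OF diff_mem[OF assms(3) assms(3)] diff_mem[OF assms(4) assms(4)], of m n n m]
        N1[of m n] N2[of n m] that by simp
  qed
  then show "\<exists>N. \<forall>m\<ge>N. \<forall>n\<ge>N. ip_norm (\<lambda>x. (S m x - T m x) - (S n x - T n x)) < e" by blast
qed

lemma ip_Cauchy_add:
  assumes "ip_Cauchy S" "ip_Cauchy T" "\<And>n. S n \<in> V" "\<And>n. T n \<in> V"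
  shows "ip_Cauchy (\<lambda>n x. S n x + T n x)"
proof -
  have T: "ip_Cauchy (\<lambda>n x. 0 - T n x)"
    using ip_Cauchy_diff[of "\<lambda>_ _. 0" T] assms zero_mem by (simp add: ip_Cauchy_def ip_zero ip_norm_def)
  show ?thesis using ip_Cauchy_diff[OF assms(1) T assms(3) diff_mem[OF zero_mem assms(4)]] by simp
qed

lemma ip_Cauchy_scale:
  assumes "ip_Cauchy S" "\<And>n. S n \<in> V"
  shows "ip_Cauchy (\<lambda>n x. c * S n x)"
  unfolding ip_Cauchy_def
proof (intro allI impI)
  fix e :: real assume e: "e > 0"
  obtain N where N: "\<And>m n. m \<ge> N \<Longrightarrow> n \<ge> N \<Longrightarrow> ip_norm (\<lambda>x. S m x - S n x) < e / (\<bar>c\<bar> + 1)"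
    using assms(1) e unfolding ip_Cauchy_def
    by (metis abs_ge_zero add_nonneg_pos divide_pos_pos zero_less_one)
  have "ip_norm (\<lambda>x. c * S m x - c * S n x) < e" if "m \<ge> N" "n \<ge> N" for m n
  proof -
    have "ip_norm (\<lambda>x. c * S m x - c * S n x) = ip_norm (\<lambda>x. c * (S m x - S n x))" by (simp add: algebra_simps)
    also have "\<dots> = \<bar>c\<bar> * ip_norm (\<lambda>x. S m x - S n x)"
      by (simp add: ip_norm_def ip_scale ip_scale_right scale_mem diff_mem assms real_sqrt_mult flip: mult.assoc)
    also have "\<dots> \<le> \<bar>c\<bar> * (e / (\<bar>c\<bar> + 1))" using N[OF that] by (intro mult_left_mono) auto
    also have "\<dots> < e" using e by (simp add: field_simps)
    finally show ?thesis .
  qed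
  then show "\<exists>N. \<forall>m\<ge>N. \<forall>n\<ge>N. ip_norm (\<lambda>x. c * S m x - c * S n x) < e" by blast
qed

lemma ip_Cauchy_convergent:
  assumes "ip_Cauchy S" "ip_Cauchy T" "\<And>n. S n \<in> V" "\<And>n. T n \<in> V"
  shows "convergent (\<lambda>n. ip (S n) (T n))"
proof -
  obtain C where C: "C > 0" "\<And>n. ip_norm (S n) \<le> C" using ip_Cauchy_bounded[OF assms(1,3)] by auto
  obtain C' where C': "C' > 0" "\<And>n. ip_norm (T n) \<le> C'" using ip_Cauchy_bounded[OF assms(2,4)] by auto
  have "Cauchy (\<lambda>n. ip (S n) (T n))"
  proof (rule metric_CauchyI)
    fix e :: real assume e: "e > 0"
    have "e / (2 * C') > 0" "e / (2 * C) > 0" using e C C' by auto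
    then obtain N1 N2 where N1: "\<forall>m\<ge>N1. \<forall>n\<ge>N1. ip_norm (\<lambda>x. S m x - S n x) < e / (2 * C')"
       and N2: "\<forall>m\<ge>N2. \<forall>n\<ge>N2. ip_norm (\<lambda>x. T m x - T n x) < e / (2 * C)"
      using assms(1,2) unfolding ip_Cauchy_def by blast
    have "dist (ip (S m) (T m)) (ip (S n) (T n)) < e" if "m \<ge> max N1 N2" "n \<ge> max N1 N2" for m n
    proof -
      have "ip (S m) (T m) - ip (S n) (T n)
        = ip (\<lambda>x. S m x - S n x) (T m) + ip (S n) (\<lambda>x. T m x - T n x)"
        using assms by (simp add: ip_diff ip_diff_right)
      moreover have "\<bar>ip (\<lambda>x. S m x - S n x) (T m)\<bar> \<le> ip_norm (\<lambda>x. S m x - S n x) * ip_norm (T m)"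
        using assms by (intro abs_ip_le diff_mem) auto
      moreover have "ip_norm (\<lambda>x. S m x - S n x) * ip_norm (T m) \<le> ip_norm (\<lambda>x. S m x - S n x) * C'"
        using C' assms by (intro mult_left_mono ip_norm_nonneg diff_mem) auto
      moreover have "ip_norm (\<lambda>x. S m x - S n x) * C' < e / 2" using N1 that C' by (simp add: field_simps)
      moreover have "\<bar>ip (S n) (\<lambda>x. T m x - T n x)\<bar> \<le> ip_norm (S n) * ip_norm (\<lambda>x. T m x - T n x)"
        using assms by (intro abs_ip_le diff_mem) auto
      moreover have "ip_norm (S n) * ip_norm (\<lambda>x. T m x - T n x) \<le> C * ip_norm (\<lambda>x. T m x - T n x)"
        using C assms by (intro mult_right_mono ip_norm_nonneg diff_mem) auto
      moreover have "C * ip_norm (\<lambda>x. T m x - T n x) < e / 2" using N2 that C by (simp add: field_simps)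
      ultimately show ?thesis unfolding dist_real_def by linarith
    qed
    then show "\<exists>N. \<forall>m\<ge>N. \<forall>n\<ge>N. dist (ip (S m) (T m)) (ip (S n) (T n)) < e" by blast
  qed
  then show ?thesis by (rule Cauchy_convergent)
qed

text \<open>
Write \<open>ip (S n) (S n)\<close> as \<open>ip (S n) (S n - S N) + ip (S n) (S N)\<close>. The first term is small for large
N and n, since S is bounded and Cauchy; the second one tends to 0 for fixed N.
\<close>

lemma ip_Cauchy_weakly_null:
  assumes "ip_Cauchy S" "\<And>n. S n \<in> V" "\<And>v. v \<in> V \<Longrightarrow> (\<lambda>n. ip (S n) v) \<longlonglongrightarrow> 0"
  shows "(\<lambda>n. ip_norm (S n)) \<longlonglongrightarrow> 0"
proof -
  obtain C where C: "C > 0" "\<And>n. ip_norm (S n) \<le> C" using ip_Cauchy_bounded[OF assms(1,2)] by auto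
  have "(\<lambda>n. ip (S n) (S n)) \<longlonglongrightarrow> 0"
  proof (rule LIMSEQ_I)
    fix e :: real assume e: "e > 0"
    have "e / (2 * C) > 0" using e C by auto
    then obtain N where N: "\<And>m n. m \<ge> N \<Longrightarrow> n \<ge> N \<Longrightarrow> ip_norm (\<lambda>x. S m x - S n x) < e / (2 * C)"
      using assms(1) unfolding ip_Cauchy_def by metis
    obtain N' where N': "\<And>n. n \<ge> N' \<Longrightarrow> \<bar>ip (S n) (S N)\<bar> < e / 2"
      using LIMSEQ_D[OF assms(3)[OF assms(2)[of N]], of "e/2"] e by auto
    have "norm (ip (S n) (S n) - 0) < e" if "n \<ge> max N N'" for n
    proof -
      have "ip (S n) (S n) = ip (S n) (\<lambda>x. S n x - S N x) + ip (S n) (S N)"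
        using assms by (simp add: ip_diff_right)
      moreover have "\<bar>ip (S n) (\<lambda>x. S n x - S N x)\<bar> \<le> ip_norm (S n) * ip_norm (\<lambda>x. S n x - S N x)"
        using assms by (intro abs_ip_le diff_mem) auto
      moreover have "ip_norm (S n) * ip_norm (\<lambda>x. S n x - S N x) \<le> C * ip_norm (\<lambda>x. S n x - S N x)"
        using C assms by (intro mult_right_mono ip_norm_nonneg diff_mem) auto
      moreover have "C * ip_norm (\<lambda>x. S n x - S N x) < e / 2" using N[of n N] that C by (simp add: field_simps)
      moreover have "\<bar>ip (S n) (S N)\<bar> < e / 2" using N' that by simp
      ultimately show ?thesis by simp
    qed
    then show "\<exists>no. \<forall>n\<ge>no. norm (ip (S n) (S n) - 0) < e" by blast
  qed
  from tendsto_real_sqrt[OF this] show ?thesis by (simp add: ip_norm_def)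
qed

text \<open>
The space may be incomplete, so the representer of \<open>\<phi>\<close> appears only as a Cauchy sequence. It is a
minimising sequence of \<open>J f = ip f f - 2 * \<phi> f\<close>: the parallelogram law makes it Cauchy, and the
comparison of J at \<open>S n\<close> and at \<open>S n + t v\<close> for all t shows that \<open>ip (S n) v\<close> is close to \<open>\<phi> v\<close>.
\<close>

lemma Riesz_approximation:
  fixes \<phi> :: "('b \<Rightarrow> real) \<Rightarrow> real"
  assumes add: "\<And>f g. f \<in> V \<Longrightarrow> g \<in> V \<Longrightarrow> \<phi> (\<lambda>x. f x + g x) = \<phi> f + \<phi> g"
    and scale: "\<And>c f. f \<in> V \<Longrightarrow> \<phi> (\<lambda>x. c * f x) = c * \<phi> f"
    and bound: "\<And>f. f \<in> V \<Longrightarrow> (\<phi> f)\<^sup>2 \<le> C * ip f f" and "0 \<le> C"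
  shows "\<exists>S. (\<forall>n. S n \<in> V) \<and> ip_Cauchy S \<and> (\<forall>v\<in>V. (\<lambda>n. ip (S n) v) \<longlonglongrightarrow> \<phi> v)
           \<and> (\<forall>n. ip_norm (S n) \<le> sqrt C + 1 / sqrt (real (Suc n)))"
proof -
  define J where "J f = ip f f - 2 * \<phi> f" for f
  have phi_le: "\<bar>\<phi> f\<bar> \<le> sqrt C * ip_norm f" if "f \<in> V" for f
    using real_sqrt_le_mono[OF bound[OF that]] by (simp add: ip_norm_def real_sqrt_mult)
  have J_ge: "J f \<ge> - C" if "f \<in> V" for f
  proof -
    have "0 \<le> (ip_norm f - sqrt C)\<^sup>2" by simp
    then have "2 * (sqrt C * ip_norm f) \<le> ip f f + C"
      using \<open>0 \<le> C\<close> ip_norm_square[OF that] by (simp add: power2_diff algebra_simps)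
    moreover have "\<phi> f \<le> sqrt C * ip_norm f" using phi_le[OF that] by linarith
    ultimately show ?thesis unfolding J_def by linarith
  qed
  define m where "m = (INF f\<in>V. J f)"
  have bdd: "bdd_below (J ` V)" using J_ge by (auto intro!: bdd_belowI2)
  have m_le: "m \<le> J f" if "f \<in> V" for f unfolding m_def by (rule cINF_lower[OF bdd that])
  have "\<exists>f\<in>V. J f < m + 1 / real (Suc n)" for n
  proof -
    have "m < m + 1 / real (Suc n)" by simp
    then show ?thesis unfolding m_def using cINF_less_iff[OF _ bdd] zero_mem by blast
  qed
  then obtain S where S: "\<And>n. S n \<in> V" "\<And>n. J (S n) < m + 1 / real (Suc n)" by metis
  \<comment> \<open>J is almost minimal at \<open>S n\<close>, so the quadratic polynomial t \<open>\<mapsto>\<close> J(S n + t v) - J(S n) is at least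
    -1/(n+1) for all t; its discriminant gives the bound.\<close>
  have near: "(ip (S n) v - \<phi> v)\<^sup>2 \<le> ip v v * (1 / real (Suc n))" if v: "v \<in> V" for n v
  proof (rule quadratic_bound)
    fix t
    have "m \<le> J (\<lambda>x. S n x + t * v x)" using S v by (intro m_le add_mem scale_mem)
    also have "\<dots> = J (S n) + 2 * t * (ip (S n) v - \<phi> v) + t\<^sup>2 * ip v v"
      using S v unfolding J_def
      by (simp add: ip_square_add scale_mem ip_scale ip_scale_right add scale power2_eq_square algebra_simps)
    finally show "0 \<le> ip v v * t\<^sup>2 + 2 * (ip (S n) v - \<phi> v) * t + 1 / real (Suc n)"
      using S(2)[of n] by (simp add: algebra_simps)
  qed (use v ip_nonneg in auto)
  have close: "ip (\<lambda>x. S i x - S j x) (\<lambda>x. S i x - S j x) \<le> 2 / real (Suc i) + 2 / real (Suc j)" for i j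
  proof -
    \<comment> \<open>The parallelogram law, with the midpoint h as competitor.\<close>
    define h where "h = (\<lambda>x. (1/2) * (S i x + S j x))"
    have "h \<in> V" unfolding h_def using S by (intro scale_mem add_mem)
    have "J h = (1/4) * (ip (S i) (S i) + 2 * ip (S i) (S j) + ip (S j) (S j)) - (\<phi> (S i) + \<phi> (S j))"
      unfolding J_def h_def using S
      by (simp only: ip_scale ip_scale_right scale add add_mem scale_mem ip_square_add) (simp add: field_simps)
    then have "ip (\<lambda>x. S i x - S j x) (\<lambda>x. S i x - S j x) = 2 * J (S i) + 2 * J (S j) - 4 * J h"
      using S by (simp add: ip_square_diff J_def field_simps)
    also have "\<dots> \<le> 2 / real (Suc i) + 2 / real (Suc j)"
      using S(2)[of i] S(2)[of j] m_le[OF \<open>h \<in> V\<close>] by simp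
    finally show ?thesis .
  qed
  have "ip_Cauchy S" unfolding ip_Cauchy_def
  proof (intro allI impI)
    fix e :: real assume e: "e > 0"
    then have "0 < e\<^sup>2 / 4" by simp
    then obtain N where N: "inverse (real (Suc N)) < e\<^sup>2 / 4" using reals_Archimedean by blast
    have "ip_norm (\<lambda>x. S i x - S j x) < e" if "i \<ge> N" "j \<ge> N" for i j
    proof -
      have "2 / real (Suc i) \<le> 2 * inverse (real (Suc N))" "2 / real (Suc j) \<le> 2 * inverse (real (Suc N))"
        using that by (auto simp: divide_inverse)
      then have "ip (\<lambda>x. S i x - S j x) (\<lambda>x. S i x - S j x) < e\<^sup>2"
        using close[of i j] N by linarith
      from real_sqrt_less_mono[OF this] show ?thesis unfolding ip_norm_def using e by simp
    qed
    then show "\<exists>N. \<forall>m\<ge>N. \<forall>n\<ge>N. ip_norm (\<lambda>x. S m x - S n x) < e" by blast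
  qed
  moreover have "(\<lambda>n. ip (S n) v) \<longlonglongrightarrow> \<phi> v" if v: "v \<in> V" for v
  proof -
    have lim: "(\<lambda>n. ip v v * (1 / real (Suc n))) \<longlonglongrightarrow> ip v v * 0"
      by (intro tendsto_intros) (use LIMSEQ_inverse_real_of_nat in \<open>simp add: divide_inverse\<close>)
    have "(\<lambda>n. (ip (S n) v - \<phi> v)\<^sup>2) \<longlonglongrightarrow> 0"
      by (rule tendsto_sandwich[OF _ _ tendsto_const]) (use near[OF v] lim in auto)
    from tendsto_real_sqrt[OF this] have "(\<lambda>n. \<bar>ip (S n) v - \<phi> v\<bar>) \<longlonglongrightarrow> 0" by simp
    then show ?thesis using LIM_zero_iff tendsto_rabs_zero_iff by blast
  qed
  moreover have "ip_norm (S n) \<le> sqrt C + 1 / sqrt (real (Suc n))" for n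
  proof (cases "ip_norm (S n) = 0")
    case False
    then have pos: "ip_norm (S n) > 0" using ip_norm_nonneg[OF S(1)[of n]] by simp
    have "\<bar>ip (S n) (S n) - \<phi> (S n)\<bar> \<le> ip_norm (S n) * (1 / sqrt (real (Suc n)))"
      using real_sqrt_le_mono[OF near[OF S(1), of n n]] by (simp add: real_sqrt_mult ip_norm_def real_sqrt_divide)
    then have "(ip_norm (S n))\<^sup>2 \<le> ip_norm (S n) * (sqrt C + 1 / sqrt (real (Suc n)))"
      using phi_le[OF S(1), of n] ip_norm_square[OF S(1)[of n]] by (simp add: algebra_simps)
    then show ?thesis using pos by (simp add: power2_eq_square)
  qed (simp add: \<open>0 \<le> C\<close>)
  ultimately show ?thesis using S(1) by blast
qed

end

section \<open>Finite combinations of kernel sections\<close>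

definition psd :: "'a set \<Rightarrow> ('a \<Rightarrow> 'a \<Rightarrow> real) \<Rightarrow> bool" where
  "psd X K \<longleftrightarrow> (\<forall>x\<in>X. \<forall>y\<in>X. K x y = K y x) \<and>
     (\<forall>A c. finite A \<longrightarrow> A \<subseteq> X \<longrightarrow> 0 \<le> (\<Sum>x\<in>A. \<Sum>y\<in>A. c x * c y * K x y))"

text \<open>
Linear combinations of kernel sections are handled through their coefficients. This avoids the
question whether an inner product of combinations is well defined, since different coefficients
may give the same function.
\<close>

definition coefs :: "'a set \<Rightarrow> ('a \<Rightarrow> real) set" where
  "coefs X = {c. finite {x. c x \<noteq> 0} \<and> {x. c x \<noteq> 0} \<subseteq> X}"

definition comb :: "('a \<Rightarrow> real) \<Rightarrow> ('a \<Rightarrow> real) \<Rightarrow> real" where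
  "comb c f = (\<Sum>x | c x \<noteq> 0. c x * f x)"

text \<open>
The inner product in H(K) of the combinations of kernel sections with coefficients c and d.
\<close>

definition kernel_form :: "('a \<Rightarrow> 'a \<Rightarrow> real) \<Rightarrow> ('a \<Rightarrow> real) \<Rightarrow> ('a \<Rightarrow> real) \<Rightarrow> real" where
  "kernel_form K c d = comb c (\<lambda>x. comb d (\<lambda>y. K x y))"

lemma comb_superset:
  assumes "finite A" "{x. c x \<noteq> 0} \<subseteq> A"
  shows "comb c f = (\<Sum>x\<in>A. c x * f x)"
  unfolding comb_def using assms by (intro sum.mono_neutral_left) auto

lemma kernel_form_superset:
  assumes "finite A" "{x. c x \<noteq> 0} \<subseteq> A" "finite B" "{x. d x \<noteq> 0} \<subseteq> B"
  shows "kernel_form K c d = (\<Sum>x\<in>A. \<Sum>y\<in>B. c x * d y * K x y)"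
  unfolding kernel_form_def using assms by (simp add: comb_superset sum_distrib_left mult.assoc)

lemma comb_cong: "c \<in> coefs X \<Longrightarrow> (\<And>x. x \<in> X \<Longrightarrow> f x = g x) \<Longrightarrow> comb c f = comb c g"
  unfolding comb_def coefs_def by (intro sum.cong) auto

lemma coefs_add_mem: "c \<in> coefs X \<Longrightarrow> d \<in> coefs X \<Longrightarrow> (\<lambda>x. c x + d x) \<in> coefs X"
  unfolding coefs_def
  by (intro CollectI conjI finite_subset[of "{x. c x + d x \<noteq> 0}" "{x. c x \<noteq> 0} \<union> {x. d x \<noteq> 0}"])
    force+

lemma coefs_scale_mem: "d \<in> coefs X \<Longrightarrow> (\<lambda>x. a * d x) \<in> coefs X"
  unfolding coefs_def by (auto elim: rev_finite_subset)

lemma comb_add: "c \<in> coefs X \<Longrightarrow> d \<in> coefs X \<Longrightarrow> comb (\<lambda>x. c x + d x) f = comb c f + comb d f"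
proof -
  assume "c \<in> coefs X" "d \<in> coefs X"
  then have A: "finite ({x. c x \<noteq> 0} \<union> {x. d x \<noteq> 0})" (is "finite ?A") by (auto simp: coefs_def)
  show ?thesis
    by (subst (1 2 3) comb_superset[OF A]) (auto simp: sum.distrib algebra_simps)
qed

lemma comb_scale: "comb (\<lambda>x. a * c x) f = a * comb c f"
  by (cases "a = 0") (auto simp: comb_def sum_distrib_left mult.assoc)

lemma comb_add_fun: "comb c (\<lambda>x. f x + g x) = comb c f + comb c g"
  by (simp add: comb_def sum.distrib algebra_simps)

lemma comb_scale_fun: "comb c (\<lambda>x. a * f x) = a * comb c f"
  by (simp add: comb_def sum_distrib_left algebra_simps)

definition unit_coef :: "'a \<Rightarrow> 'a \<Rightarrow> real" where
  "unit_coef x = (\<lambda>y. if y = x then 1 else 0)"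

lemma unit_coef_mem: "x \<in> X \<Longrightarrow> unit_coef x \<in> coefs X"
  by (auto simp: unit_coef_def coefs_def)

lemma comb_unit: "comb (unit_coef x) f = f x"
  by (simp add: comb_def unit_coef_def)

lemma kernel_form_cong:
  assumes "c \<in> coefs X" "d \<in> coefs X" "\<And>x y. x \<in> X \<Longrightarrow> y \<in> X \<Longrightarrow> K x y = L x y"
  shows "kernel_form K c d = kernel_form L c d"
  unfolding kernel_form_def by (rule comb_cong[OF assms(1)], rule comb_cong[OF assms(2)]) (rule assms(3))

lemma kernel_form_sum:
  "kernel_form (\<lambda>x y. K x y + L x y) c d = kernel_form K c d + kernel_form L c d"
  unfolding kernel_form_def by (simp add: comb_add_fun)

lemma psd_finite_form:
  assumes "psd X K" "finite A" "A \<subseteq> X"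
  shows "0 \<le> (\<Sum>x\<in>A. \<Sum>y\<in>A. c x * c y * K x y)"
  using assms unfolding psd_def by blast

lemma kernel_form_semi_inner_product:
  assumes "psd X K"
  shows "semi_inner_product (coefs X) (kernel_form K)"
proof
  show "(\<lambda>_. 0) \<in> coefs X" by (simp add: coefs_def)
next
  fix c d assume cd: "c \<in> coefs X" "d \<in> coefs X"
  let ?C = "{x. c x \<noteq> 0}" and ?D = "{x. d x \<noteq> 0}"
  have "kernel_form K c d = (\<Sum>x\<in>?C. \<Sum>y\<in>?D. c x * d y * K x y)"
    using cd by (intro kernel_form_superset) (auto simp: coefs_def)
  also have "\<dots> = (\<Sum>x\<in>?C. \<Sum>y\<in>?D. d y * c x * K y x)"
    using cd assms by (intro sum.cong refl) (auto simp: coefs_def psd_def)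
  also have "\<dots> = (\<Sum>y\<in>?D. \<Sum>x\<in>?C. d y * c x * K y x)" by (rule sum.swap)
  also have "\<dots> = kernel_form K d c"
    using cd by (intro kernel_form_superset[symmetric]) (auto simp: coefs_def)
  finally show "kernel_form K c d = kernel_form K d c" .
next
  fix c assume "c \<in> coefs X"
  then have A: "finite {x. c x \<noteq> 0}" "{x. c x \<noteq> 0} \<subseteq> X" by (auto simp: coefs_def)
  show "0 \<le> kernel_form K c c"
    by (subst kernel_form_superset[OF A(1) order_refl A(1) order_refl]) (rule psd_finite_form[OF assms A])
qed (auto intro: coefs_add_mem coefs_scale_mem simp: kernel_form_def comb_add comb_scale)

lemma kernel_form_unit: "kernel_form K c (unit_coef x) = comb c (\<lambda>y. K y x)"
  by (simp add: kernel_form_def comb_unit)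

lemma kernel_form_unit_unit: "kernel_form K (unit_coef x) (unit_coef y) = K x y"
  by (simp add: kernel_form_def comb_unit)

lemma psd_sym: "psd X K \<Longrightarrow> x \<in> X \<Longrightarrow> y \<in> X \<Longrightarrow> K x y = K y x"
  by (simp add: psd_def)

lemma psd_diag_nonneg: "psd X K \<Longrightarrow> x \<in> X \<Longrightarrow> 0 \<le> K x x"
  using semi_inner_product.ip_nonneg[OF kernel_form_semi_inner_product unit_coef_mem]
  by (metis kernel_form_unit_unit)

lemma psd_Cauchy_Schwarz: "psd X K \<Longrightarrow> x \<in> X \<Longrightarrow> y \<in> X \<Longrightarrow> (K x y)\<^sup>2 \<le> K x x * K y y"
  using semi_inner_product.Cauchy_Schwarz[OF kernel_form_semi_inner_product unit_coef_mem unit_coef_mem]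
  by (metis kernel_form_unit_unit)

section \<open>The Moore-Aronszajn theorem\<close>

locale psd_kernel =
  fixes X :: "'a set" and K :: "'a \<Rightarrow> 'a \<Rightarrow> real"
  assumes psd: "psd X K"
begin

sublocale sip: semi_inner_product "coefs X" "kernel_form K"
  by (rule kernel_form_semi_inner_product[OF psd])

text \<open>
The completion consists of functions, not of classes of Cauchy sequences: the combinations of
sections that belong to a Cauchy sequence of coefficients converge at every point of X.
\<close>

definition represents :: "(nat \<Rightarrow> 'a \<Rightarrow> real) \<Rightarrow> ('a \<Rightarrow> real) \<Rightarrow> bool" where
  "represents S f \<longleftrightarrow> (\<forall>n. S n \<in> coefs X) \<and> sip.ip_Cauchy S \<and> (\<forall>x. x \<notin> X \<longrightarrow> f x = 0) \<and>
     (\<forall>x\<in>X. (\<lambda>n. comb (S n) (\<lambda>y. K y x)) \<longlonglongrightarrow> f x)"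

definition completion :: "('a \<Rightarrow> real) set" where
  "completion = {f. \<exists>S. represents S f}"

definition rep :: "('a \<Rightarrow> real) \<Rightarrow> nat \<Rightarrow> 'a \<Rightarrow> real" where
  "rep f = (SOME S. represents S f)"

definition completion_ip :: "('a \<Rightarrow> real) \<Rightarrow> ('a \<Rightarrow> real) \<Rightarrow> real" where
  "completion_ip f g = lim (\<lambda>n. kernel_form K (rep f n) (rep g n))"

lemma represents_rep: "f \<in> completion \<Longrightarrow> represents (rep f) f"
  unfolding rep_def completion_def mem_Collect_eq by (rule someI_ex[of "\<lambda>S. represents S f"])

lemma representsD:
  assumes "represents S f"
  shows "S n \<in> coefs X" "sip.ip_Cauchy S" "x \<notin> X \<Longrightarrow> f x = 0"
    "x \<in> X \<Longrightarrow> (\<lambda>n. comb (S n) (\<lambda>y. K y x)) \<longlonglongrightarrow> f x"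
  using assms by (auto simp: represents_def)

lemma represents_add:
  assumes "represents S f" "represents T g"
  shows "represents (\<lambda>n x. S n x + T n x) (\<lambda>x. f x + g x)"
  using representsD[OF assms(1)] representsD[OF assms(2)] unfolding represents_def
  by (auto intro!: sip.add_mem sip.ip_Cauchy_add tendsto_add simp: comb_add[of _ X])

lemma represents_diff:
  assumes "represents S f" "represents T g"
  shows "represents (\<lambda>n x. S n x - T n x) (\<lambda>x. f x - g x)"
proof -
  have "comb (\<lambda>x. S n x - T n x) h = comb (S n) h - comb (T n) h" for n h
    using comb_add[of "S n" X "\<lambda>x. (-1) * T n x" h] representsD(1)[OF assms(1), of n]
      coefs_scale_mem[OF representsD(1)[OF assms(2), of n], of "-1"] comb_scale[of "-1" "T n" h] by simp
  then show ?thesis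
    using representsD[OF assms(1)] representsD[OF assms(2)] unfolding represents_def
    by (auto intro!: sip.diff_mem sip.ip_Cauchy_diff tendsto_diff)
qed

lemma represents_scale:
  assumes "represents S f"
  shows "represents (\<lambda>n x. a * S n x) (\<lambda>x. a * f x)"
  using representsD[OF assms] unfolding represents_def
  by (auto intro!: sip.scale_mem sip.ip_Cauchy_scale tendsto_mult_left simp: comb_scale)

lemma represents_const:
  assumes "c \<in> coefs X"
  shows "represents (\<lambda>_. c) (\<lambda>x. if x \<in> X then comb c (\<lambda>y. K y x) else 0)"
  using assms sip.ip_zero[OF sip.zero_mem] unfolding represents_def sip.ip_Cauchy_def sip.ip_norm_def by auto

text \<open>
The form of \<open>S n\<close> with a fixed d is a finite combination of values of the function with coefficients
\<open>S n\<close>, so pointwise convergence to 0 is weak convergence to 0. Hence a function determines its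
representing sequence up to a null sequence, and the inner product of the completion is well
defined.
\<close>

lemma represents_zero_null:
  assumes "represents S (\<lambda>_. 0)"
  shows "(\<lambda>n. sip.ip_norm (S n)) \<longlonglongrightarrow> 0"
proof (rule sip.ip_Cauchy_weakly_null)
  fix d assume d: "d \<in> coefs X"
  have "kernel_form K (S n) d = (\<Sum>x | d x \<noteq> 0. d x * comb (S n) (\<lambda>y. K y x))" for n
    using sip.ip_sym[OF representsD(1)[OF assms, of n] d] d
    unfolding kernel_form_def comb_def[of d]
    by (auto intro!: sum.cong arg_cong2[where f="(*)"] comb_cong[OF representsD(1)[OF assms, of n]]
        simp: coefs_def psd_sym[OF psd])
  moreover have "(\<lambda>n. \<Sum>x | d x \<noteq> 0. d x * comb (S n) (\<lambda>y. K y x)) \<longlonglongrightarrow> (\<Sum>x | d x \<noteq> 0. d x * 0)"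
    using d representsD(4)[OF assms] by (intro tendsto_intros) (auto simp: coefs_def)
  ultimately show "(\<lambda>n. kernel_form K (S n) d) \<longlonglongrightarrow> 0" by simp
qed (use representsD[OF assms] in auto)

lemma completion_ip_limit:
  assumes S: "represents S f" and T: "represents T g"
  shows "(\<lambda>n. kernel_form K (S n) (T n)) \<longlonglongrightarrow> completion_ip f g"
proof -
  have fg: "f \<in> completion" "g \<in> completion" using S T by (auto simp: completion_def)
  define S' where "S' = rep f"
  define T' where "T' = rep g"
  have S': "represents S' f" and T': "represents T' g"
    using represents_rep fg by (auto simp: S'_def T'_def)
  note m = representsD(1)[OF S] representsD(1)[OF T] representsD(1)[OF S'] representsD(1)[OF T']
  note cau = representsD(2)[OF S] representsD(2)[OF T] representsD(2)[OF S'] representsD(2)[OF T']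
  have lim': "(\<lambda>n. kernel_form K (S' n) (T' n)) \<longlonglongrightarrow> completion_ip f g"
    using sip.ip_Cauchy_convergent[OF cau(3,4) m(3,4)]
    unfolding completion_ip_def S'_def T'_def by (simp add: convergent_LIMSEQ_iff)
  have nS: "(\<lambda>n. sip.ip_norm (\<lambda>x. S n x - S' n x)) \<longlonglongrightarrow> 0"
    using represents_zero_null[of "\<lambda>n x. S n x - S' n x"] represents_diff[OF S S'] by simp
  have nT: "(\<lambda>n. sip.ip_norm (\<lambda>x. T n x - T' n x)) \<longlonglongrightarrow> 0"
    using represents_zero_null[of "\<lambda>n x. T n x - T' n x"] represents_diff[OF T T'] by simp
  obtain C where C: "C > 0" "\<And>n. sip.ip_norm (T n) \<le> C" using sip.ip_Cauchy_bounded[OF cau(2) m(2)] by auto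
  obtain C' where C': "C' > 0" "\<And>n. sip.ip_norm (S' n) \<le> C'" using sip.ip_Cauchy_bounded[OF cau(3) m(3)] by auto
  have "(\<lambda>n. kernel_form K (S n) (T n) - kernel_form K (S' n) (T' n)) \<longlonglongrightarrow> 0"
  proof (rule Lim_null_comparison)
    have "norm (kernel_form K (S n) (T n) - kernel_form K (S' n) (T' n))
      \<le> sip.ip_norm (\<lambda>x. S n x - S' n x) * C + C' * sip.ip_norm (\<lambda>x. T n x - T' n x)" for n
    proof -
      have "kernel_form K (S n) (T n) - kernel_form K (S' n) (T' n)
        = kernel_form K (\<lambda>x. S n x - S' n x) (T n) + kernel_form K (S' n) (\<lambda>x. T n x - T' n x)"
        using m by (simp add: sip.ip_diff sip.ip_diff_right)
      moreover have "\<bar>kernel_form K (\<lambda>x. S n x - S' n x) (T n)\<bar> \<le> sip.ip_norm (\<lambda>x. S n x - S' n x) * sip.ip_norm (T n)"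
        using m by (intro sip.abs_ip_le sip.diff_mem) auto
      moreover have "sip.ip_norm (\<lambda>x. S n x - S' n x) * sip.ip_norm (T n) \<le> sip.ip_norm (\<lambda>x. S n x - S' n x) * C"
        using m C by (intro mult_left_mono sip.ip_norm_nonneg sip.diff_mem) auto
      moreover have "\<bar>kernel_form K (S' n) (\<lambda>x. T n x - T' n x)\<bar> \<le> sip.ip_norm (S' n) * sip.ip_norm (\<lambda>x. T n x - T' n x)"
        using m by (intro sip.abs_ip_le sip.diff_mem) auto
      moreover have "sip.ip_norm (S' n) * sip.ip_norm (\<lambda>x. T n x - T' n x) \<le> C' * sip.ip_norm (\<lambda>x. T n x - T' n x)"
        using m C' by (intro mult_right_mono sip.ip_norm_nonneg sip.diff_mem) auto
      ultimately show ?thesis unfolding real_norm_def by linarith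
    qed
    then show "\<forall>\<^sub>F n in sequentially. norm (kernel_form K (S n) (T n) - kernel_form K (S' n) (T' n))
      \<le> sip.ip_norm (\<lambda>x. S n x - S' n x) * C + C' * sip.ip_norm (\<lambda>x. T n x - T' n x)" by simp
    show "(\<lambda>n. sip.ip_norm (\<lambda>x. S n x - S' n x) * C + C' * sip.ip_norm (\<lambda>x. T n x - T' n x)) \<longlonglongrightarrow> 0"
      using tendsto_add[OF tendsto_mult_right[OF nS, of C] tendsto_mult_left[OF nT, of C']] by simp
  qed
  from tendsto_add[OF this lim'] show ?thesis by simp
qed

lemma completion_eval:
  assumes "f \<in> completion" "x \<in> X"
  shows "completion_ip f (zero_off X (\<lambda>y. K y x)) = f x"
proof -
  have "represents (\<lambda>_. unit_coef x) (zero_off X (\<lambda>y. K y x))"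
    using represents_const[OF unit_coef_mem[OF assms(2)]] psd_sym[OF psd] assms(2)
    by (simp add: comb_unit zero_off_def cong: if_cong)
  from completion_ip_limit[OF represents_rep[OF assms(1)] this]
  have "(\<lambda>n. comb (rep f n) (\<lambda>y. K y x)) \<longlonglongrightarrow> completion_ip f (zero_off X (\<lambda>y. K y x))"
    by (simp add: kernel_form_unit)
  then show ?thesis using representsD(4)[OF represents_rep[OF assms(1)] assms(2)] LIMSEQ_unique by blast
qed

lemma completion_semi_inner_product: "semi_inner_product completion completion_ip"
proof
  have "represents (\<lambda>_ _. 0) (\<lambda>_. 0)"
    using represents_const[OF sip.zero_mem] by (simp add: comb_def cong: if_cong)
  then show "(\<lambda>_. 0) \<in> completion" unfolding completion_def by blast
next
  fix f g assume fg: "f \<in> completion" "g \<in> completion"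
  note F = represents_rep[OF fg(1)] and G = represents_rep[OF fg(2)]
  show "(\<lambda>x. f x + g x) \<in> completion" unfolding completion_def using represents_add[OF F G] by blast
  show "completion_ip f g = completion_ip g f"
    using completion_ip_limit[OF F G] completion_ip_limit[OF G F]
      sip.ip_sym[OF representsD(1)[OF F] representsD(1)[OF G]] by (simp add: LIMSEQ_unique)
  fix h assume h: "h \<in> completion"
  note H = represents_rep[OF h]
  note m = representsD(1)[OF F] representsD(1)[OF G] representsD(1)[OF H]
  have "(\<lambda>n. kernel_form K (rep f n) (rep h n) + kernel_form K (rep g n) (rep h n))
    \<longlonglongrightarrow> completion_ip (\<lambda>x. f x + g x) h"
    using completion_ip_limit[OF represents_add[OF F G] H] m by (simp add: sip.ip_add)
  then show "completion_ip (\<lambda>x. f x + g x) h = completion_ip f h + completion_ip g h"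
    using tendsto_add[OF completion_ip_limit[OF F H] completion_ip_limit[OF G H]] by (rule LIMSEQ_unique)
next
  fix f and a :: real assume f: "f \<in> completion"
  note F = represents_rep[OF f]
  show "(\<lambda>x. a * f x) \<in> completion" unfolding completion_def using represents_scale[OF F] by blast
  show "0 \<le> completion_ip f f"
    using completion_ip_limit[OF F F] sip.ip_nonneg[OF representsD(1)[OF F]]
    by (rule_tac LIMSEQ_le_const) auto
  fix g assume g: "g \<in> completion"
  note G = represents_rep[OF g]
  have "(\<lambda>n. a * kernel_form K (rep f n) (rep g n)) \<longlonglongrightarrow> completion_ip (\<lambda>x. a * f x) g"
    using completion_ip_limit[OF represents_scale[OF F] G] representsD(1)[OF F] representsD(1)[OF G]
    by (simp add: sip.ip_scale)
  then show "completion_ip (\<lambda>x. a * f x) g = a * completion_ip f g"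
    using tendsto_mult_left[OF completion_ip_limit[OF F G]] by (rule LIMSEQ_unique)
qed

sublocale comp: semi_inner_product completion completion_ip
  by (rule completion_semi_inner_product)

lemma completion_zero_off: "f \<in> completion \<Longrightarrow> x \<notin> X \<Longrightarrow> f x = 0"
  using representsD(3)[OF represents_rep] by blast

lemma section_mem: "x \<in> X \<Longrightarrow> zero_off X (\<lambda>y. K y x) \<in> completion"
  using represents_const[OF unit_coef_mem, of x] psd_sym[OF psd, of _ x]
  unfolding completion_def by (auto simp: comb_unit zero_off_def cong: if_cong)

lemma completion_definite:
  assumes "f \<in> completion" "completion_ip f f = 0"
  shows "f = (\<lambda>_. 0)"
proof
  fix x show "f x = 0"
  proof (cases "x \<in> X")
    case True
    have "(f x)\<^sup>2 \<le> completion_ip f f * completion_ip (zero_off X (\<lambda>y. K y x)) (zero_off X (\<lambda>y. K y x))"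
      using comp.Cauchy_Schwarz[OF assms(1) section_mem[OF True]] completion_eval[OF assms(1) True] by simp
    then show ?thesis using assms(2) by simp
  qed (rule completion_zero_off[OF assms(1)])
qed

definition embed :: "('a \<Rightarrow> real) \<Rightarrow> 'a \<Rightarrow> real" where
  "embed c = (\<lambda>x. if x \<in> X then comb c (\<lambda>y. K y x) else 0)"

lemma embed_mem: "c \<in> coefs X \<Longrightarrow> embed c \<in> completion"
  unfolding embed_def completion_def using represents_const by blast

lemma represents_tail_limit:
  assumes "represents S f"
  shows "(\<lambda>n. comp.ip_norm (\<lambda>x. embed (S n) x - f x)) \<longlonglongrightarrow> 0"
proof (rule LIMSEQ_I)
  fix e :: real assume e: "e > 0"
  then have "e/2 > 0" by simp
  then obtain N where N: "\<And>m n. m \<ge> N \<Longrightarrow> n \<ge> N \<Longrightarrow> sip.ip_norm (\<lambda>x. S m x - S n x) < e/2"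
    using representsD(2)[OF assms] unfolding sip.ip_Cauchy_def by metis
  have "norm (comp.ip_norm (\<lambda>x. embed (S n) x - f x) - 0) < e" if n: "n \<ge> N" for n
  proof -
    have R: "represents (\<lambda>m x. S n x - S m x) (\<lambda>x. embed (S n) x - f x)"
      using represents_diff[OF represents_const[OF representsD(1)[OF assms]] assms] unfolding embed_def .
    have mem: "(\<lambda>x. embed (S n) x - f x) \<in> completion" using R unfolding completion_def by blast
    have "(\<lambda>m. sip.ip_norm (\<lambda>x. S n x - S m x)) \<longlonglongrightarrow> comp.ip_norm (\<lambda>x. embed (S n) x - f x)"
      unfolding sip.ip_norm_def comp.ip_norm_def by (intro tendsto_real_sqrt completion_ip_limit R)
    then have "comp.ip_norm (\<lambda>x. embed (S n) x - f x) \<le> e/2"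
      by (rule LIMSEQ_le_const2) (use N n in \<open>auto intro!: exI[of _ N] less_imp_le\<close>)
    then show ?thesis using comp.ip_norm_nonneg[OF mem] e by simp
  qed
  then show "\<exists>no. \<forall>n\<ge>no. norm (comp.ip_norm (\<lambda>x. embed (S n) x - f x) - 0) < e" by blast
qed

lemma ip_norm_embed_diff:
  assumes "c \<in> coefs X" "d \<in> coefs X"
  shows "comp.ip_norm (\<lambda>x. embed c x - embed d x) = sip.ip_norm (\<lambda>x. c x - d x)"
proof -
  have R: "represents (\<lambda>m x. c x - d x) (\<lambda>x. embed c x - embed d x)"
    using represents_diff[OF represents_const[OF assms(1)] represents_const[OF assms(2)]]
    unfolding embed_def .
  from completion_ip_limit[OF R R] have "completion_ip (\<lambda>x. embed c x - embed d x) (\<lambda>x. embed c x - embed d x)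
    = kernel_form K (\<lambda>x. c x - d x) (\<lambda>x. c x - d x)" by (simp add: LIMSEQ_const_iff)
  then show ?thesis by (simp add: comp.ip_norm_def sip.ip_norm_def)
qed

text \<open>
Each \<open>F n\<close> has distance less than \<open>1 / (n + 1)\<close> from a combination of sections; the coefficients of
these combinations form a Cauchy sequence, and the function that they represent is the limit.
\<close>

lemma completion_complete:
  assumes F: "\<And>n. F n \<in> completion" and cau: "comp.ip_Cauchy F"
  shows "\<exists>f\<in>completion. (\<lambda>n. comp.ip_norm (\<lambda>x. F n x - f x)) \<longlonglongrightarrow> 0"
proof -
  have "\<exists>c\<in>coefs X. comp.ip_norm (\<lambda>x. embed c x - F n x) < 1 / real (Suc n)" for n
  proof -
    have "\<forall>\<^sub>F m in sequentially. comp.ip_norm (\<lambda>x. embed (rep (F n) m) x - F n x) < 1 / real (Suc n)"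
      by (rule order_tendstoD(2)[OF represents_tail_limit[OF represents_rep[OF F]]]) simp
    then show ?thesis using representsD(1)[OF represents_rep[OF F]] by (meson eventually_happens' sequentially_bot)
  qed
  then obtain T where T: "\<And>n. T n \<in> coefs X" "\<And>n. comp.ip_norm (\<lambda>x. embed (T n) x - F n x) < 1 / real (Suc n)"
    by metis
  have small: "\<exists>N. \<forall>n\<ge>N. 1 / real (Suc n) < e" if "e > 0" for e :: real
    using LIMSEQ_D[OF LIMSEQ_inverse_real_of_nat that] by (auto simp: divide_inverse)
  have TC: "sip.ip_Cauchy T" unfolding sip.ip_Cauchy_def
  proof (intro allI impI)
    fix e :: real assume "e > 0"
    then have e3: "e/3 > 0" by simp
    obtain N1 where N1: "\<forall>m\<ge>N1. \<forall>n\<ge>N1. comp.ip_norm (\<lambda>x. F m x - F n x) < e/3"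
      using cau e3 unfolding comp.ip_Cauchy_def by blast
    obtain N2 where N2: "\<forall>n\<ge>N2. 1 / real (Suc n) < e/3" using small[OF e3] by blast
    have "sip.ip_norm (\<lambda>x. T m x - T n x) < e" if "m \<ge> max N1 N2" "n \<ge> max N1 N2" for m n
    proof -
      have "sip.ip_norm (\<lambda>x. T m x - T n x) = comp.ip_norm (\<lambda>x. embed (T m) x - embed (T n) x)"
        using T by (simp add: ip_norm_embed_diff)
      also have "\<dots> \<le> comp.ip_norm (\<lambda>x. embed (T m) x - F m x) + comp.ip_norm (\<lambda>x. F m x - embed (T n) x)"
        using T F embed_mem by (intro comp.ip_norm_triangle_diff) auto
      also have "comp.ip_norm (\<lambda>x. F m x - embed (T n) x) \<le> comp.ip_norm (\<lambda>x. F m x - F n x) + comp.ip_norm (\<lambda>x. F n x - embed (T n) x)"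
        using T F embed_mem by (intro comp.ip_norm_triangle_diff) auto
      also have "comp.ip_norm (\<lambda>x. F n x - embed (T n) x) = comp.ip_norm (\<lambda>x. embed (T n) x - F n x)"
        using T F embed_mem by (intro comp.ip_norm_diff_commute) auto
      moreover have "comp.ip_norm (\<lambda>x. F m x - F n x) < e/3" using N1 that by simp
      moreover have "1 / real (Suc n) < e/3" "1 / real (Suc m) < e/3" using N2 that by auto
      ultimately show ?thesis using T(2)[of n] T(2)[of m] by linarith
    qed
    then show "\<exists>N. \<forall>m\<ge>N. \<forall>n\<ge>N. sip.ip_norm (\<lambda>x. T m x - T n x) < e" by blast
  qed
  have conv: "convergent (\<lambda>n. comb (T n) (\<lambda>y. K y x))" if x: "x \<in> X" for x
  proof -
    have "sip.ip_Cauchy (\<lambda>_. unit_coef x)"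
      using sip.ip_zero[OF sip.zero_mem] unfolding sip.ip_Cauchy_def sip.ip_norm_def by simp
    from sip.ip_Cauchy_convergent[OF TC this T(1) unit_coef_mem[OF x]] show ?thesis
      by (simp add: kernel_form_unit)
  qed
  define f where "f = (\<lambda>x. if x \<in> X then lim (\<lambda>n. comb (T n) (\<lambda>y. K y x)) else 0)"
  have R: "represents T f" unfolding represents_def f_def
    using T TC conv by (auto simp: convergent_LIMSEQ_iff)
  then have f: "f \<in> completion" unfolding completion_def by blast
  have "(\<lambda>n. comp.ip_norm (\<lambda>x. F n x - f x)) \<longlonglongrightarrow> 0"
  proof (rule tendsto_sandwich)
    show "\<forall>\<^sub>F n in sequentially. 0 \<le> comp.ip_norm (\<lambda>x. F n x - f x)"
      using comp.ip_norm_nonneg[OF comp.diff_mem[OF F f]] by simp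
    have "comp.ip_norm (\<lambda>x. F n x - f x) \<le> inverse (real (Suc n)) + comp.ip_norm (\<lambda>x. embed (T n) x - f x)" for n
      using comp.ip_norm_triangle_diff[OF F embed_mem[OF T(1)] f, of n n] T(2)[of n]
        comp.ip_norm_diff_commute[OF F embed_mem[OF T(1)], of n n] by (simp add: divide_inverse)
    then show "\<forall>\<^sub>F n in sequentially. comp.ip_norm (\<lambda>x. F n x - f x)
       \<le> inverse (real (Suc n)) + comp.ip_norm (\<lambda>x. embed (T n) x - f x)" by simp
    show "(\<lambda>n. inverse (real (Suc n)) + comp.ip_norm (\<lambda>x. embed (T n) x - f x)) \<longlonglongrightarrow> 0"
      using tendsto_add[OF LIMSEQ_inverse_real_of_nat represents_tail_limit[OF R]] by simp
  qed simp
  then show ?thesis using f by blast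
qed

theorem completion_is_RKHS: "is_RKHS X K completion completion_ip"
  unfolding is_RKHS_def hilbert_function_space_def
proof (intro conjI ballI allI impI)
  fix F :: "nat \<Rightarrow> 'a \<Rightarrow> real"
  assume "(\<forall>n. F n \<in> completion) \<and>
        (\<forall>e>0. \<exists>N. \<forall>m\<ge>N. \<forall>n\<ge>N.
            sqrt (completion_ip (\<lambda>x. F m x - F n x) (\<lambda>x. F m x - F n x)) < e)"
  then show "\<exists>f\<in>completion. (\<lambda>n. sqrt (completion_ip (\<lambda>x. F n x - f x) (\<lambda>x. F n x - f x))) \<longlonglongrightarrow> 0"
    using completion_complete[of F] unfolding comp.ip_Cauchy_def comp.ip_norm_def by blast
qed (rule completion_zero_off completion_definite section_mem completion_eval comp.zero_mem
      comp.add_mem comp.scale_mem comp.ip_sym comp.ip_add comp.ip_scale comp.ip_nonneg; assumption)+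

end

lemma is_RKHS_semi_inner_product: "is_RKHS X K H ip \<Longrightarrow> semi_inner_product H ip"
  unfolding is_RKHS_def hilbert_function_space_def by unfold_locales auto

lemma reproducing_kernel_imp_psd:
  assumes "reproducing_kernel X K"
  shows "psd X K"
proof -
  obtain H ip where R: "is_RKHS X K H ip" using assms by (auto simp: reproducing_kernel_def)
  interpret semi_inner_product H ip by (rule is_RKHS_semi_inner_product[OF R])
  define s where "s x = zero_off X (\<lambda>y. K y x)" for x
  have s: "s x \<in> H" if "x \<in> X" for x using R that unfolding s_def is_RKHS_def by blast
  have ev: "ip f (s x) = f x" if "f \<in> H" "x \<in> X" for f x using R that unfolding s_def is_RKHS_def by blast
  have K: "K x y = ip (s x) (s y)" if "x \<in> X" "y \<in> X" for x y
    using ev[OF s[OF that(2)] that(1)] ip_sym[OF s s] that by (simp add: s_def zero_off_def)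
  show ?thesis unfolding psd_def
  proof (intro conjI ballI allI impI)
    fix x y assume "x \<in> X" "y \<in> X" then show "K x y = K y x" using K ip_sym s by simp
  next
    fix A and c :: "'a \<Rightarrow> real" assume A: "finite A" "A \<subseteq> X"
    then have m: "(\<lambda>y. c x * s x y) \<in> H" if "x \<in> A" for x using that s scale_mem by auto
    have "0 \<le> ip (\<lambda>y. \<Sum>x\<in>A. c x * s x y) (\<lambda>y. \<Sum>x\<in>A. c x * s x y)"
      using m by (intro ip_nonneg sum_mem)
    also have "\<dots> = (\<Sum>x\<in>A. \<Sum>y\<in>A. ip (\<lambda>z. c x * s x z) (\<lambda>z. c y * s y z))"
      using m by (simp add: ip_sum ip_sum_right sum_mem)
    also have "\<dots> = (\<Sum>x\<in>A. \<Sum>y\<in>A. c x * c y * K x y)"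
      using A by (intro sum.cong refl) (auto simp: ip_scale ip_scale_right scale_mem s K subset_iff)
    finally show "0 \<le> (\<Sum>x\<in>A. \<Sum>y\<in>A. c x * c y * K x y)" .
  qed
qed

text \<open>
The completion shows that the choice in the definition of the RKHS has a witness. Any property that
follows from \<open>is_RKHS\<close> therefore holds for the chosen space.
\<close>

theorem Moore_Aronszajn:
  assumes "psd X K"
  shows "is_RKHS X K (rkhs X K) (rkhs_inner X K)"
proof -
  interpret psd_kernel X K by unfold_locales (rule assms)
  have "(\<lambda>(H, ip). is_RKHS X K H ip) (RKHS X K)"
    unfolding RKHS_def by (rule someI[of _ "(completion, completion_ip)"]) (simp add: completion_is_RKHS)
  then show ?thesis unfolding rkhs_def rkhs_inner_def by (simp add: case_prod_beta)
qed

section \<open>Membership in a reproducing kernel Hilbert space\<close>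

context psd_kernel
begin

lemma is_RKHS: "is_RKHS X K (rkhs X K) (rkhs_inner X K)"
  by (rule Moore_Aronszajn[OF psd])

sublocale R: semi_inner_product "rkhs X K" "rkhs_inner X K"
  by (rule is_RKHS_semi_inner_product[OF is_RKHS])

lemma rkhs_zero_off: "f \<in> rkhs X K \<Longrightarrow> x \<notin> X \<Longrightarrow> f x = 0"
  using is_RKHS unfolding is_RKHS_def hilbert_function_space_def by (elim conjE) blast

lemma section_rkhs: "x \<in> X \<Longrightarrow> zero_off X (\<lambda>y. K y x) \<in> rkhs X K"
  using is_RKHS unfolding is_RKHS_def by blast

lemma reproducing: "f \<in> rkhs X K \<Longrightarrow> x \<in> X \<Longrightarrow> rkhs_inner X K f (zero_off X (\<lambda>y. K y x)) = f x"
  using is_RKHS unfolding is_RKHS_def by blast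

lemma rkhs_complete:
  assumes "\<And>n. F n \<in> rkhs X K" "R.ip_Cauchy F"
  shows "\<exists>f\<in>rkhs X K. (\<lambda>n. R.ip_norm (\<lambda>x. F n x - f x)) \<longlonglongrightarrow> 0"
  using is_RKHS assms unfolding is_RKHS_def hilbert_function_space_def R.ip_Cauchy_def R.ip_norm_def by blast

lemma section_inner: "x \<in> X \<Longrightarrow> y \<in> X \<Longrightarrow>
    rkhs_inner X K (zero_off X (\<lambda>z. K z x)) (zero_off X (\<lambda>z. K z y)) = K y x"
  using reproducing[OF section_rkhs] by (simp add: zero_off_def)

lemma eval_bound:
  assumes "f \<in> rkhs X K" "x \<in> X"
  shows "(f x)\<^sup>2 \<le> rkhs_inner X K f f * K x x"
  using R.Cauchy_Schwarz[OF assms(1) section_rkhs[OF assms(2)]]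
  by (simp add: reproducing[OF assms] section_inner assms(2))

text \<open>
The points \<open>p i\<close> may coincide, as they do when functions are pulled back along a map that is not
injective.
\<close>

lemma family_bound:
  assumes f: "f \<in> rkhs X K" and p: "\<And>i. i \<in> I \<Longrightarrow> p i \<in> X"
  shows "(\<Sum>i\<in>I. c i * f (p i))\<^sup>2 \<le> rkhs_inner X K f f * (\<Sum>i\<in>I. \<Sum>j\<in>I. c i * c j * K (p i) (p j))"
proof -
  define s where "s i = zero_off X (\<lambda>z. K z (p i))" for i
  have s: "s i \<in> rkhs X K" if "i \<in> I" for i unfolding s_def using section_rkhs p that by blast
  have m: "(\<lambda>z. c i * s i z) \<in> rkhs X K" if "i \<in> I" for i using s[OF that] by (rule R.scale_mem)
  let ?g = "\<lambda>z. \<Sum>i\<in>I. c i * s i z"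
  have "rkhs_inner X K f ?g = (\<Sum>i\<in>I. c i * f (p i))"
    using m s f p by (simp add: R.ip_sum_right R.ip_scale_right s_def reproducing)
  moreover have "rkhs_inner X K ?g ?g = (\<Sum>i\<in>I. \<Sum>j\<in>I. c i * c j * K (p i) (p j))"
    using m s p by (simp add: R.ip_sum R.ip_sum_right R.sum_mem)
      (simp add: R.ip_scale R.ip_scale_right m s s_def section_inner psd_sym[OF psd] mult.assoc cong: sum.cong)
  ultimately show ?thesis using R.Cauchy_Schwarz[OF f R.sum_mem[of I "\<lambda>i z. c i * s i z", OF m]] by simp
qed

lemma embed_eq_sum: "embed c = (\<lambda>y. \<Sum>x | c x \<noteq> 0. c x * zero_off X (\<lambda>z. K z x) y)"
  if "c \<in> coefs X"
  unfolding embed_def comb_def using that psd_sym[OF psd]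
  by (auto simp: zero_off_def coefs_def subset_iff fun_eq_iff intro!: sum.cong)

lemma embed_rkhs: "c \<in> coefs X \<Longrightarrow> embed c \<in> rkhs X K"
  by (subst embed_eq_sum) (auto intro!: R.sum_mem R.scale_mem section_rkhs simp: coefs_def)

lemma inner_embed:
  assumes c: "c \<in> coefs X" and f: "f \<in> rkhs X K"
  shows "rkhs_inner X K f (embed c) = comb c f"
proof -
  have X: "x \<in> X" if "x \<in> {x. c x \<noteq> 0}" for x using c that by (auto simp: coefs_def)
  have "rkhs_inner X K f (embed c)
      = (\<Sum>x | c x \<noteq> 0. rkhs_inner X K f (\<lambda>y. c x * zero_off X (\<lambda>z. K z x) y))"
    unfolding embed_eq_sum[OF c] by (rule R.ip_sum_right[OF R.scale_mem[OF section_rkhs[OF X]] f])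
  also have "\<dots> = comb c f"
    unfolding comb_def
    by (intro sum.cong refl) (simp only: R.ip_scale_right[OF f section_rkhs[OF X]] reproducing[OF f X])
  finally show ?thesis .
qed

lemma embed_diff:
  assumes "c \<in> coefs X" "d \<in> coefs X"
  shows "embed (\<lambda>x. c x - d x) = (\<lambda>x. embed c x - embed d x)"
  using comb_add[OF assms(1) coefs_scale_mem[OF assms(2), of "-1"]] comb_scale[of "-1" d]
  by (simp add: embed_def fun_eq_iff)

lemma inner_embed_embed:
  assumes "c \<in> coefs X" "d \<in> coefs X"
  shows "rkhs_inner X K (embed c) (embed d) = kernel_form K c d"
proof -
  have "rkhs_inner X K (embed c) (embed d) = comb d (embed c)"
    using inner_embed[OF assms(2) embed_rkhs[OF assms(1)]] .
  also have "\<dots> = comb d (\<lambda>x. comb c (\<lambda>y. K x y))"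
    by (rule comb_cong[OF assms(2)], simp add: embed_def, rule comb_cong[OF assms(1)])
      (rule psd_sym[OF psd])
  also have "\<dots> = kernel_form K d c" by (simp add: kernel_form_def)
  finally show ?thesis using sip.ip_sym[OF assms] by simp
qed

lemma norm_limit_imp_pointwise:
  assumes F: "\<And>n. F n \<in> rkhs X K" and f: "f \<in> rkhs X K"
    and lim: "(\<lambda>n. R.ip_norm (\<lambda>x. F n x - f x)) \<longlonglongrightarrow> 0"
  shows "(\<lambda>n. F n x) \<longlonglongrightarrow> f x"
proof (cases "x \<in> X")
  case True
  have "(\<lambda>n. F n x - f x) \<longlonglongrightarrow> 0"
  proof (rule Lim_null_comparison)
    show "(\<lambda>n. R.ip_norm (\<lambda>x. F n x - f x) * sqrt (K x x)) \<longlonglongrightarrow> 0"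
      using tendsto_mult_right[OF lim, of "sqrt (K x x)"] by simp
    have "\<bar>F n x - f x\<bar> \<le> R.ip_norm (\<lambda>x. F n x - f x) * sqrt (K x x)" for n
      using real_sqrt_le_mono[OF eval_bound[OF R.diff_mem[OF F f] True, of n]]
      by (simp add: R.ip_norm_def real_sqrt_mult)
    then show "\<forall>\<^sub>F n in sequentially. norm (F n x - f x) \<le> R.ip_norm (\<lambda>x. F n x - f x) * sqrt (K x x)" by simp
  qed
  then show ?thesis by (simp add: LIM_zero_iff)
qed (simp add: rkhs_zero_off F f)

text \<open>
The bound says that c \<open>\<mapsto>\<close> \<open>comb c f\<close> is a bounded functional for the form of K, so it is represented by
a Cauchy sequence of coefficients. The corresponding combinations of sections converge in H(K),
and their limit has the values of f because convergence in norm implies pointwise convergence. The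
third conclusion, applied to the elements of H(K), is the density of the combinations.
\<close>

lemma rkhs_criterion:
  assumes off: "\<And>x. x \<notin> X \<Longrightarrow> f x = 0" and "0 \<le> C"
    and bound: "\<And>c. c \<in> coefs X \<Longrightarrow> (comb c f)\<^sup>2 \<le> C * kernel_form K c c"
  shows "f \<in> rkhs X K" "rkhs_inner X K f f \<le> C"
    "\<exists>S. (\<forall>n. S n \<in> coefs X) \<and> (\<lambda>n. R.ip_norm (\<lambda>x. embed (S n) x - f x)) \<longlonglongrightarrow> 0"
proof -
  have "\<exists>S. (\<forall>n. S n \<in> coefs X) \<and> sip.ip_Cauchy S
      \<and> (\<forall>v\<in>coefs X. (\<lambda>n. kernel_form K (S n) v) \<longlonglongrightarrow> comb v f)
      \<and> (\<forall>n. sip.ip_norm (S n) \<le> sqrt C + 1 / sqrt (real (Suc n)))"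
    by (rule sip.Riesz_approximation) (use comb_add[of _ X] comb_scale bound \<open>0 \<le> C\<close> in auto)
  then obtain S where "\<forall>n. S n \<in> coefs X" and "sip.ip_Cauchy S"
    and "\<forall>v\<in>coefs X. (\<lambda>n. kernel_form K (S n) v) \<longlonglongrightarrow> comb v f"
    and "\<forall>n. sip.ip_norm (S n) \<le> sqrt C + 1 / sqrt (real (Suc n))"
    by (elim exE conjE) (rule that)
  then have S: "\<And>n. S n \<in> coefs X" "sip.ip_Cauchy S"
    "\<And>v. v \<in> coefs X \<Longrightarrow> (\<lambda>n. kernel_form K (S n) v) \<longlonglongrightarrow> comb v f"
    "\<And>n. sip.ip_norm (S n) \<le> sqrt C + 1 / sqrt (real (Suc n))" by auto
  have ip_norm_embed: "R.ip_norm (embed c) = sip.ip_norm c" if "c \<in> coefs X" for c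
    using inner_embed_embed[OF that that] by (simp add: R.ip_norm_def sip.ip_norm_def)
  have "R.ip_Cauchy (\<lambda>n. embed (S n))"
    using S(2) ip_norm_embed[OF sip.diff_mem[OF S(1) S(1)]] embed_diff[OF S(1) S(1)]
    unfolding R.ip_Cauchy_def sip.ip_Cauchy_def by simp
  from rkhs_complete[OF embed_rkhs[OF S(1)] this] obtain g where
    g: "g \<in> rkhs X K" and lim: "(\<lambda>n. R.ip_norm (\<lambda>x. embed (S n) x - g x)) \<longlonglongrightarrow> 0" by blast
  have "f = g"
  proof
    fix x show "f x = g x"
    proof (cases "x \<in> X")
      case True
      have "(\<lambda>n. embed (S n) x) \<longlonglongrightarrow> f x"
        using S(3)[OF unit_coef_mem[OF True]] True by (simp add: kernel_form_unit comb_unit embed_def)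
      then show ?thesis using norm_limit_imp_pointwise[OF embed_rkhs[OF S(1)] g lim, of x] LIMSEQ_unique by blast
    qed (use off g rkhs_zero_off in auto)
  qed
  then show "f \<in> rkhs X K" using g by simp
  show "\<exists>S. (\<forall>n. S n \<in> coefs X) \<and> (\<lambda>n. R.ip_norm (\<lambda>x. embed (S n) x - f x)) \<longlonglongrightarrow> 0"
    using S(1) lim \<open>f = g\<close> by blast
  have "R.ip_norm f \<le> sqrt C"
  proof (rule LIMSEQ_le_const)
    have "(\<lambda>n. sqrt (inverse (real (Suc n)))) \<longlonglongrightarrow> sqrt 0"
      by (intro tendsto_real_sqrt LIMSEQ_inverse_real_of_nat)
    then have "(\<lambda>n. 1 / sqrt (real (Suc n))) \<longlonglongrightarrow> 0"
      by (simp add: real_sqrt_inverse inverse_eq_divide real_sqrt_divide)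
    from tendsto_add[OF lim tendsto_add[OF tendsto_const[of "sqrt C"] this]]
    show "(\<lambda>n. R.ip_norm (\<lambda>x. embed (S n) x - f x) + (sqrt C + 1 / sqrt (real (Suc n)))) \<longlonglongrightarrow> sqrt C"
      using \<open>f = g\<close> by simp
    have "R.ip_norm f \<le> R.ip_norm (\<lambda>x. embed (S n) x - f x) + (sqrt C + 1 / sqrt (real (Suc n)))" for n
      using R.ip_norm_le_diff[OF \<open>f \<in> rkhs X K\<close> embed_rkhs[OF S(1)], of n] S(4)[of n] ip_norm_embed[OF S(1), of n]
        R.ip_norm_diff_commute[OF \<open>f \<in> rkhs X K\<close> embed_rkhs[OF S(1)], of n] by linarith
    then show "\<exists>N. \<forall>n\<ge>N. R.ip_norm f \<le> R.ip_norm (\<lambda>x. embed (S n) x - f x) + (sqrt C + 1 / sqrt (real (Suc n)))" by blast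
  qed
  then show "rkhs_inner X K f f \<le> C" by (simp add: R.ip_norm_def)
qed

lemma comb_bound: "f \<in> rkhs X K \<Longrightarrow> c \<in> coefs X \<Longrightarrow> (comb c f)\<^sup>2 \<le> rkhs_inner X K f f * kernel_form K c c"
  using R.Cauchy_Schwarz[OF _ embed_rkhs, of f c] inner_embed[of c f] inner_embed_embed[of c c] by simp

lemma embed_dense:
  assumes "f \<in> rkhs X K"
  obtains S where "\<And>n. S n \<in> coefs X" "(\<lambda>n. R.ip_norm (\<lambda>x. embed (S n) x - f x)) \<longlonglongrightarrow> 0"
  using rkhs_criterion(3)[OF rkhs_zero_off[OF assms] R.ip_nonneg[OF assms] comb_bound[OF assms]] by blast

lemma rkhs_measurable:
  assumes "\<And>x. x \<in> X \<Longrightarrow> zero_off X (\<lambda>y. K y x) \<in> borel_measurable M" "f \<in> rkhs X K"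
  shows "f \<in> borel_measurable M"
proof -
  obtain S where S: "\<And>n. S n \<in> coefs X" "(\<lambda>n. R.ip_norm (\<lambda>x. embed (S n) x - f x)) \<longlonglongrightarrow> 0"
    using embed_dense[OF assms(2)] by blast
  have "embed (S n) \<in> borel_measurable M" for n
    by (subst embed_eq_sum[OF S(1)])
      (use S(1)[of n] assms(1) in \<open>auto intro!: borel_measurable_sum borel_measurable_times simp: coefs_def\<close>)
  then show ?thesis
    by (rule borel_measurable_LIMSEQ_real[rotated])
      (rule norm_limit_imp_pointwise[OF embed_rkhs[OF S(1)] assms(2) S(2)])
qed

end

text \<open>
Membership and norm are decided by quadratic forms, so an inequality between two forms is a bounded
embedding of the spaces.
\<close>

lemma rkhs_pullback:
  assumes K: "psd Y K" and L: "psd X L" and p: "\<And>x. x \<in> X \<Longrightarrow> p x \<in> Y" and "0 \<le> a"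
    and le: "\<And>c. c \<in> coefs X \<Longrightarrow> kernel_form (\<lambda>x y. K (p x) (p y)) c c \<le> a * kernel_form L c c"
    and f: "f \<in> rkhs Y K"
  shows "zero_off X (\<lambda>x. f (p x)) \<in> rkhs X L"
    "rkhs_inner X L (zero_off X (\<lambda>x. f (p x))) (zero_off X (\<lambda>x. f (p x))) \<le> a * rkhs_inner Y K f f"
proof -
  interpret K: psd_kernel Y K by unfold_locales (rule K)
  interpret L: psd_kernel X L by unfold_locales (rule L)
  have nn: "0 \<le> rkhs_inner Y K f f" by (rule K.R.ip_nonneg[OF f])
  have bound: "(comb c (zero_off X (\<lambda>x. f (p x))))\<^sup>2 \<le> a * rkhs_inner Y K f f * kernel_form L c c"
    if c: "c \<in> coefs X" for c
  proof -
    have fin: "finite {x. c x \<noteq> 0}" "{x. c x \<noteq> 0} \<subseteq> X" using c by (auto simp: coefs_def)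
    have "comb c (zero_off X (\<lambda>x. f (p x))) = (\<Sum>x | c x \<noteq> 0. c x * f (p x))"
      unfolding comb_def using fin by (intro sum.cong) (auto simp: zero_off_def)
    then have "(comb c (zero_off X (\<lambda>x. f (p x))))\<^sup>2
        \<le> rkhs_inner Y K f f * kernel_form (\<lambda>x y. K (p x) (p y)) c c"
      using K.family_bound[OF f, of "{x. c x \<noteq> 0}" p c] fin p
        kernel_form_superset[OF fin(1) order_refl fin(1) order_refl, of "\<lambda>x y. K (p x) (p y)"] by auto
    also have "\<dots> \<le> rkhs_inner Y K f f * (a * kernel_form L c c)" by (intro mult_left_mono le c nn)
    finally show ?thesis by (simp add: mult_ac)
  qed
  have off: "\<And>x. x \<notin> X \<Longrightarrow> zero_off X (\<lambda>x. f (p x)) x = 0" by (simp add: zero_off_def)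
  show "zero_off X (\<lambda>x. f (p x)) \<in> rkhs X L"
    by (rule L.rkhs_criterion(1)[OF off mult_nonneg_nonneg[OF \<open>0 \<le> a\<close> nn] bound])
  show "rkhs_inner X L (zero_off X (\<lambda>x. f (p x))) (zero_off X (\<lambda>x. f (p x))) \<le> a * rkhs_inner Y K f f"
    by (rule L.rkhs_criterion(2)[OF off mult_nonneg_nonneg[OF \<open>0 \<le> a\<close> nn] bound])
qed

lemma rkhs_subkernel:
  assumes K: "psd X K" and L: "psd X L"
    and le: "\<And>c. c \<in> coefs X \<Longrightarrow> kernel_form K c c \<le> kernel_form L c c"
    and f: "f \<in> rkhs X K"
  shows "f \<in> rkhs X L" "rkhs_inner X L f f \<le> rkhs_inner X K f f"
proof -
  interpret K: psd_kernel X K by unfold_locales (rule K)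
  have "zero_off X (\<lambda>x. f x) = f" using K.rkhs_zero_off[OF f] by (auto simp: zero_off_def)
  then show "f \<in> rkhs X L" "rkhs_inner X L f f \<le> rkhs_inner X K f f"
    using rkhs_pullback[OF K L, of "\<lambda>x. x" 1 f] le f by simp_all
qed

section \<open>Operations on positive semidefinite kernels\<close>

lemma psd_pullback:
  assumes "psd Y K" "\<And>x. x \<in> X \<Longrightarrow> p x \<in> Y"
  shows "psd X (\<lambda>x y. K (p x) (p y))"
  unfolding psd_def
proof (intro conjI ballI allI impI)
  fix A and c :: "'b \<Rightarrow> real" assume A: "finite A" "A \<subseteq> X"
  define d where "d z = (\<Sum>x | x \<in> A \<and> p x = z. c x)" for z
  have gr: "(\<Sum>x\<in>A. c x * g (p x)) = (\<Sum>z\<in>p ` A. d z * g z)" for g :: "'a \<Rightarrow> real"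
    unfolding d_def sum_distrib_right
    by (subst sum.image_gen[OF A(1), of _ p]) (auto intro!: sum.cong)
  have "(\<Sum>x\<in>A. \<Sum>y\<in>A. c x * c y * K (p x) (p y)) = (\<Sum>x\<in>A. c x * (\<Sum>y\<in>A. c y * K (p x) (p y)))"
    by (simp add: sum_distrib_left mult.assoc)
  also have "\<dots> = (\<Sum>x\<in>A. c x * (\<Sum>z\<in>p ` A. d z * K (p x) z))" by (subst gr) (rule refl)
  also have "\<dots> = (\<Sum>w\<in>p ` A. d w * (\<Sum>z\<in>p ` A. d z * K w z))" by (rule gr)
  also have "\<dots> = (\<Sum>w\<in>p ` A. \<Sum>z\<in>p ` A. d w * d z * K w z)"
    by (simp add: sum_distrib_left mult.assoc)
  also have "\<dots> \<ge> 0" using A assms(2) by (intro psd_finite_form[OF assms(1)]) auto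
  finally show "0 \<le> (\<Sum>x\<in>A. \<Sum>y\<in>A. c x * c y * K (p x) (p y))" .
qed (use psd_sym[OF assms(1)] assms(2) in auto)

lemma psd_const_one: "psd X (\<lambda>_ _. 1)"
  unfolding psd_def
proof (intro conjI ballI allI impI)
  fix A and c :: "'a \<Rightarrow> real"
  have "(\<Sum>x\<in>A. \<Sum>y\<in>A. c x * c y * 1) = (\<Sum>x\<in>A. c x)\<^sup>2"
    by (simp add: power2_eq_square sum_product)
  then show "0 \<le> (\<Sum>x\<in>A. \<Sum>y\<in>A. c x * c y * 1)" by simp
qed simp

lemma psd_add: "psd X K \<Longrightarrow> psd X L \<Longrightarrow> psd X (\<lambda>x y. K x y + L x y)"
  unfolding psd_def by (simp add: distrib_left sum.distrib)

lemma psd_scale: "psd X K \<Longrightarrow> 0 \<le> a \<Longrightarrow> psd X (\<lambda>x y. a * K x y)"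
  unfolding psd_def by (simp add: mult.left_commute[of _ a] flip: sum_distrib_left)

text \<open>
The subtracted form is \<open>s\<^sup>2 / L b b\<close>, where s is the form of c with the unit coefficient at b. By
Cauchy-Schwarz it does not exceed the form of L at c.
\<close>

lemma psd_rank_one_reduction:
  assumes "psd A L" "finite A" "b \<in> A" "L b b > 0"
  shows "psd A (\<lambda>x y. L x y - L x b * L y b / L b b)"
  unfolding psd_def
proof (intro conjI ballI allI impI)
  fix B and c :: "'a \<Rightarrow> real" assume B: "finite B" "B \<subseteq> A"
  define s where "s = (\<Sum>x\<in>B. c x * L x b)"
  define d where "d x = (if x \<in> B then c x else 0)" for x
  have fin: "finite {x. d x \<noteq> 0}" "{x. d x \<noteq> 0} \<subseteq> B" using B by (auto simp: d_def elim: rev_finite_subset)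
  interpret semi_inner_product "coefs A" "kernel_form L" by (rule kernel_form_semi_inner_product[OF assms(1)])
  have d: "d \<in> coefs A" using fin B unfolding coefs_def by auto
  have "kernel_form L d (unit_coef b) = s"
    unfolding kernel_form_unit s_def by (subst comb_superset[OF B(1) fin(2)]) (simp add: d_def)
  moreover have "kernel_form L d d = (\<Sum>x\<in>B. \<Sum>y\<in>B. c x * c y * L x y)"
    by (subst kernel_form_superset[OF B(1) fin(2) B(1) fin(2)]) (simp add: d_def)
  ultimately have "s\<^sup>2 \<le> (\<Sum>x\<in>B. \<Sum>y\<in>B. c x * c y * L x y) * L b b"
    using Cauchy_Schwarz[OF d unit_coef_mem[OF assms(3)]] by (simp add: kernel_form_unit_unit)
  then have "s\<^sup>2 / L b b \<le> (\<Sum>x\<in>B. \<Sum>y\<in>B. c x * c y * L x y)"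
    using assms(4) by (simp add: field_simps)
  moreover have "(\<Sum>x\<in>B. \<Sum>y\<in>B. c x * c y * (L x y - L x b * L y b / L b b))
      = (\<Sum>x\<in>B. \<Sum>y\<in>B. c x * c y * L x y) - (\<Sum>x\<in>B. \<Sum>y\<in>B. (c x * L x b) * (c y * L y b) / L b b)"
    by (simp add: right_diff_distrib sum_subtractf mult_ac)
  moreover have "(\<Sum>x\<in>B. \<Sum>y\<in>B. (c x * L x b) * (c y * L y b) / L b b) = s\<^sup>2 / L b b"
    by (simp add: s_def power2_eq_square sum_product sum_divide_distrib)
  ultimately show "0 \<le> (\<Sum>x\<in>B. \<Sum>y\<in>B. c x * c y * (L x y - L x b * L y b / L b b))" by simp
qed (use psd_sym[OF assms(1)] in \<open>simp add: mult.commute\<close>)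

text \<open>
On a finite set, L becomes 0 when rank-one kernels \<open>v x * v y / L b b\<close> are subtracted for one point b
after the other. The product of K with such a kernel is a form of K again, with coefficients
\<open>c x * v x\<close>.
\<close>

theorem Schur_product:
  assumes K: "psd X K" and L: "psd X L"
  shows "psd X (\<lambda>x y. K x y * L x y)"
  unfolding psd_def
proof (intro conjI ballI allI impI)
  fix A and c :: "'a \<Rightarrow> real" assume A: "finite A" "A \<subseteq> X"
  have "0 \<le> (\<Sum>x\<in>A. \<Sum>y\<in>A. c x * c y * (K x y * L x y))"
    if "finite B" "B \<subseteq> A" "psd A L" "\<And>x y. x \<in> A \<Longrightarrow> y \<in> A \<Longrightarrow> x \<notin> B \<Longrightarrow> L x y = 0" for B L
    using that
  proof (induction B arbitrary: L rule: finite_induct)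
    case empty
    then show ?case by simp
  next
    case (insert b B)
    have b: "b \<in> A" using insert.prems(1) by simp
    show ?case
    proof (cases "L b b > 0")
      case False
      then have "L b b = 0" using psd_diag_nonneg[OF insert.prems(2) b] by simp
      then have "L b y = 0" if "y \<in> A" for y using psd_Cauchy_Schwarz[OF insert.prems(2) b that] by simp
      then have "L x y = 0" if "x \<in> A" "y \<in> A" "x \<notin> B" for x y
        using insert.prems(3)[OF that(1,2)] that by (cases "x = b") auto
      then show ?thesis using insert.prems by (intro insert.IH) auto
    next
      case True
      \<comment> \<open>The Schur complement vanishes also at b, so its support lies in B.\<close>
      define L' where "L' x y = L x y - L x b * L y b / L b b" for x y
      have L': "psd A L'" unfolding L'_def by (rule psd_rank_one_reduction[OF insert.prems(2) A(1) b True])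
      have "L' x y = 0" if "x \<in> A" "y \<in> A" "x \<notin> B" for x y
        using insert.prems(3)[OF that(1,2)] insert.prems(3)[OF that(1) b] psd_sym[OF insert.prems(2) b that(2)]
          that True unfolding L'_def by (cases "x = b") auto
      then have "0 \<le> (\<Sum>x\<in>A. \<Sum>y\<in>A. c x * c y * (K x y * L' x y))"
        using insert.prems L' by (intro insert.IH) auto
      moreover have "0 \<le> (\<Sum>x\<in>A. \<Sum>y\<in>A. (c x * L x b) * (c y * L y b) * K x y) / L b b"
        using True by (intro divide_nonneg_pos psd_finite_form[OF K A])
      moreover have "(\<Sum>x\<in>A. \<Sum>y\<in>A. c x * c y * (K x y * L x y))
        = (\<Sum>x\<in>A. \<Sum>y\<in>A. c x * c y * (K x y * L' x y))
          + (\<Sum>x\<in>A. \<Sum>y\<in>A. (c x * L x b) * (c y * L y b) * K x y) / L b b"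
        unfolding sum_divide_distrib sum.distrib[symmetric] L'_def
        by (intro sum.cong refl) (simp add: algebra_simps)
      ultimately show ?thesis by simp
    qed
  qed
  moreover have "psd A L" using L A(2) unfolding psd_def by (meson order_trans subsetD)
  ultimately show "0 \<le> (\<Sum>x\<in>A. \<Sum>y\<in>A. c x * c y * (K x y * L x y))"
    using A by blast
qed (use psd_sym[OF K] psd_sym[OF L] in auto)

lemma psd_prod:
  assumes "\<And>j. j \<in> u \<Longrightarrow> psd X (K j)"
  shows "psd X (\<lambda>x y. \<Prod>j\<in>u. K j x y)"
  using assms by (induction u rule: infinite_finite_induct) (auto intro: psd_const_one Schur_product)

lemma has_sum_finite_sum:
  fixes f :: "'a \<Rightarrow> 'b \<Rightarrow> real"
  assumes "\<And>i. i \<in> I \<Longrightarrow> (f i has_sum s i) F"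
  shows "((\<lambda>u. \<Sum>i\<in>I. f i u) has_sum (\<Sum>i\<in>I. s i)) F"
  using assms by (induction I rule: infinite_finite_induct) (auto intro!: has_sum_add)

lemma psd_infsum:
  fixes X :: "'a set"
  assumes psd: "\<And>u. u \<in> F \<Longrightarrow> psd X (T u)"
    and sum: "\<And>x y. x \<in> X \<Longrightarrow> y \<in> X \<Longrightarrow> (\<lambda>u. T u x y) summable_on F"
  shows "psd X (\<lambda>x y. \<Sum>\<^sub>\<infinity>u\<in>F. T u x y)"
  unfolding psd_def
proof (intro conjI ballI allI impI)
  fix x y assume "x \<in> X" "y \<in> X"
  then show "(\<Sum>\<^sub>\<infinity>u\<in>F. T u x y) = (\<Sum>\<^sub>\<infinity>u\<in>F. T u y x)"
    using psd_sym[OF psd] by (intro infsum_cong) auto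
next
  fix A and c :: "'a \<Rightarrow> real" assume A: "finite A" "A \<subseteq> X"
  have "((\<lambda>u. \<Sum>x\<in>A. \<Sum>y\<in>A. c x * c y * T u x y) has_sum
      (\<Sum>x\<in>A. \<Sum>y\<in>A. c x * c y * (\<Sum>\<^sub>\<infinity>u\<in>F. T u x y))) F"
    using A sum by (intro has_sum_finite_sum has_sum_cmult_right has_sum_infsum) auto
  then show "0 \<le> (\<Sum>x\<in>A. \<Sum>y\<in>A. c x * c y * (\<Sum>\<^sub>\<infinity>u\<in>F. T u x y))"
    by (rule has_sum_nonneg) (use psd_finite_form[OF psd A] in blast)
qed

text \<open>
If the form of k at all c of mass 1 were at least \<open>\<epsilon>\<close>, the membership criterion would put the
constant 1 into H(k). As a functional, c fixes the constants and has norm less than \<open>sqrt \<epsilon>\<close> on H(k).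
\<close>

lemma constants_nearly_annihilated:
  assumes "psd X k" "X \<noteq> {}" "rkhs X (\<lambda>_ _. 1) \<inter> rkhs X k = {\<lambda>_. 0}" "\<epsilon> > 0"
  obtains c where "c \<in> coefs X" "comb c (\<lambda>_. 1) = 1" "kernel_form k c c < \<epsilon>"
proof -
  interpret k: psd_kernel X k by unfold_locales (rule assms(1))
  interpret one: psd_kernel X "\<lambda>_ _. 1" by unfold_locales (rule psd_const_one)
  let ?f = "zero_off X (\<lambda>_. 1)"
  obtain x where x: "x \<in> X" using assms(2) by blast
  have "?f \<in> rkhs X (\<lambda>_ _. 1)" using one.section_rkhs[OF x] by simp
  moreover have "?f x \<noteq> 0" using x by (simp add: zero_off_def)
  ultimately have "?f \<notin> rkhs X k" using assms(3) by (metis IntI singletonD)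
  then obtain c where c: "c \<in> coefs X" "\<not> (comb c ?f)\<^sup>2 \<le> 1 / \<epsilon> * kernel_form k c c"
    using k.rkhs_criterion(1)[of ?f "1 / \<epsilon>"] assms(4) by (force simp: zero_off_def)
  have one: "comb c ?f = comb c (\<lambda>_. 1)" by (rule comb_cong[OF c(1)]) (simp add: zero_off_def)
  define a where "a = comb c (\<lambda>_. 1)"
  have lt: "kernel_form k c c < \<epsilon> * a\<^sup>2" using c(2) assms(4) unfolding one a_def by (simp add: field_simps)
  then have "a \<noteq> 0" using k.sip.ip_nonneg[OF c(1)] by auto
  \<comment> \<open>Normalise the mass to 1.\<close>
  define d where "d = (\<lambda>x. (1 / a) * c x)"
  have d: "d \<in> coefs X" unfolding d_def by (rule coefs_scale_mem[OF c(1)])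
  have "kernel_form k d d = (1 / a) * ((1 / a) * kernel_form k c c)"
    unfolding d_def by (simp only: k.sip.ip_scale[OF c(1) coefs_scale_mem[OF c(1)]] k.sip.ip_scale_right[OF c(1) c(1)])
  also have "\<dots> < \<epsilon>" using lt \<open>a \<noteq> 0\<close> by (simp add: pos_divide_less_eq flip: power2_eq_square)
  finally show ?thesis using that[OF d] comb_scale[of "1 / a" c "\<lambda>_. 1"] \<open>a \<noteq> 0\<close>
    by (simp add: d_def a_def)
qed

section \<open>Weighted sums of tensor product kernels\<close>

locale weighted_kernel =
  fixes M :: "'a measure" and k :: "'a \<Rightarrow> 'a \<Rightarrow> real" and \<gamma> :: "nat \<Rightarrow> real"
  assumes psd_k: "psd (space M) k"
    and gamma_pos: "\<And>j. j \<ge> 1 \<Longrightarrow> 0 < \<gamma> j"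
    and summable_gamma: "summable (\<lambda>j. \<gamma> (Suc j))"
begin

abbreviation "X \<equiv> domX M k \<gamma>"

text \<open>
A subfamily of the summands of \<open>K\<^sub>\<gamma>\<close> gives a kernel whose RKHS is contained in \<open>H\<^sub>\<gamma>\<close>, with a norm that
is at least that of \<open>H\<^sub>\<gamma>\<close>. All subspaces needed below arise in this way.
\<close>

definition part_kernel :: "nat set set \<Rightarrow> (nat \<Rightarrow> 'a) \<Rightarrow> (nat \<Rightarrow> 'a) \<Rightarrow> real" where
  "part_kernel F x y = (\<Sum>\<^sub>\<infinity>u\<in>F. prod_weight \<gamma> u * tensor_kernel k u x y)"

text \<open>
The partial sum of the diagonal of \<open>K\<^sub>\<gamma>\<close> over the subsets of \<open>{1..n}\<close>, in factorised form. A sequence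
of points of D belongs to the domain X if and only if these products are bounded in n.
\<close>

definition diag_prod :: "nat \<Rightarrow> (nat \<Rightarrow> 'a) \<Rightarrow> real" where
  "diag_prod n x = (\<Prod>j\<in>{1..n}. 1 + \<gamma> j * k (x j) (x j))"

lemma K_gamma_eq_part: "K_gamma k \<gamma> = part_kernel findex"
  by (simp add: K_gamma_def part_kernel_def fun_eq_iff)

lemma findexD: "u \<in> findex \<Longrightarrow> finite u" "u \<in> findex \<Longrightarrow> j \<in> u \<Longrightarrow> 1 \<le> j"
  by (auto simp: findex_def)

lemma weight_pos: "u \<in> findex \<Longrightarrow> 0 < prod_weight \<gamma> u"
  unfolding prod_weight_def by (intro prod_pos ballI gamma_pos findexD(2))

lemma term_eq_prod: "prod_weight \<gamma> u * tensor_kernel k u x y = (\<Prod>j\<in>u. \<gamma> j * k (x j) (y j))"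
  by (simp add: prod_weight_def tensor_kernel_def prod.distrib)

lemma term_diag_nonneg:
  assumes "u \<in> findex" "x \<in> {1..} \<rightarrow>\<^sub>E space M"
  shows "0 \<le> prod_weight \<gamma> u * tensor_kernel k u x x"
  unfolding term_eq_prod
proof (intro prod_nonneg ballI mult_nonneg_nonneg)
  fix j assume "j \<in> u"
  then have j: "1 \<le> j" by (rule findexD(2)[OF assms(1)])
  then show "0 \<le> \<gamma> j" by (rule less_imp_le[OF gamma_pos])
  show "0 \<le> k (x j) (x j)" using j assms(2) by (intro psd_diag_nonneg[OF psd_k]) auto
qed

lemma diag_prod_eq_sum: "diag_prod n x = (\<Sum>u\<in>Pow {1..n}. prod_weight \<gamma> u * tensor_kernel k u x x)"
  unfolding diag_prod_def term_eq_prod using prod_add[of "{1..n}" "\<lambda>j. \<gamma> j * k (x j) (x j)" "\<lambda>_. 1"]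
  by (simp add: add.commute)

lemma Pow_findex: "Pow {1..n} \<subseteq> findex" "finite (Pow {1..n::nat})"
  by (auto simp: findex_def intro: finite_subset)

lemma finite_findex_bounded:
  assumes "finite F" "F \<subseteq> findex"
  obtains n where "F \<subseteq> Pow {1..n}"
proof -
  have fin: "finite (\<Union>F)" using assms by (auto simp: findex_def)
  have "F \<subseteq> Pow {1..Max (insert 0 (\<Union>F))}"
  proof (intro subsetI PowI)
    fix u j assume uj: "u \<in> F" "j \<in> u"
    then have "j \<le> Max (insert 0 (\<Union>F))" using fin by (intro Max_ge) auto
    moreover have "1 \<le> j" using findexD(2)[of u j] assms(2) uj by auto
    ultimately show "j \<in> {1..Max (insert 0 (\<Union>F))}" by simp
  qed
  then show ?thesis using that by blast
qed

lemma finite_partial_sum_le: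
  assumes "x \<in> {1..} \<rightarrow>\<^sub>E space M" "finite F" "F \<subseteq> findex" "\<And>n. diag_prod n x \<le> C"
  shows "(\<Sum>u\<in>F. prod_weight \<gamma> u * tensor_kernel k u x x) \<le> C"
proof -
  obtain n where n: "F \<subseteq> Pow {1..n}" using finite_findex_bounded assms by metis
  have "(\<Sum>u\<in>F. prod_weight \<gamma> u * tensor_kernel k u x x) \<le> diag_prod n x"
    unfolding diag_prod_eq_sum using n Pow_findex assms(1)
    by (intro sum_mono2) (auto intro!: term_diag_nonneg)
  then show ?thesis using assms(4)[of n] by simp
qed

lemma domX_I:
  assumes "x \<in> {1..} \<rightarrow>\<^sub>E space M" "\<And>n. diag_prod n x \<le> C"
  shows "x \<in> X" "K_gamma k \<gamma> x x \<le> C"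
proof -
  have s: "(\<lambda>u. prod_weight \<gamma> u * tensor_kernel k u x x) summable_on findex"
  proof (rule nonneg_bdd_above_summable_on)
    show "bdd_above (sum (\<lambda>u. prod_weight \<gamma> u * tensor_kernel k u x x) ` {F. F \<subseteq> findex \<and> finite F})"
      using finite_partial_sum_le[OF assms(1) _ _ assms(2)] by (intro bdd_aboveI[of _ C]) auto
  qed (rule term_diag_nonneg[OF _ assms(1)])
  then show "x \<in> X" using assms(1) by (simp add: domX_def)
  show "K_gamma k \<gamma> x x \<le> C" unfolding K_gamma_def
    using s finite_partial_sum_le[OF assms(1) _ _ assms(2)] by (rule infsum_le_finite_sums)
qed

lemma domX_D:
  assumes "x \<in> X"
  shows "x \<in> {1..} \<rightarrow>\<^sub>E space M" "j \<ge> 1 \<Longrightarrow> x j \<in> space M"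
    "(\<lambda>u. prod_weight \<gamma> u * tensor_kernel k u x x) summable_on findex"
    "diag_prod n x \<le> K_gamma k \<gamma> x x"
proof -
  show P: "x \<in> {1..} \<rightarrow>\<^sub>E space M" and s: "(\<lambda>u. prod_weight \<gamma> u * tensor_kernel k u x x) summable_on findex"
    using assms by (auto simp: domX_def)
  then show "j \<ge> 1 \<Longrightarrow> x j \<in> space M" by auto
  show "diag_prod n x \<le> K_gamma k \<gamma> x x"
    unfolding diag_prod_eq_sum K_gamma_def
    using s Pow_findex term_diag_nonneg[OF _ P] by (intro finite_sum_le_infsum) auto
qed

lemma diag_factor_nonneg: "j \<ge> 1 \<Longrightarrow> p \<in> space M \<Longrightarrow> 0 \<le> \<gamma> j * k p p"
  using gamma_pos[of j] psd_diag_nonneg[OF psd_k] by simp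

lemma diag_prod_nonneg: "x \<in> {1..} \<rightarrow>\<^sub>E space M \<Longrightarrow> 0 \<le> diag_prod n x"
  unfolding diag_prod_def by (intro prod_nonneg add_nonneg_nonneg diag_factor_nonneg ballI) auto

text \<open>
All factors of the diagonal product are at least 1, so a change of the coordinate j to p multiplies
it at most by \<open>1 + \<gamma> j * k p p\<close>.
\<close>

lemma fun_upd_domX:
  assumes "x \<in> X" "p \<in> space M" "j \<ge> 1"
  shows "x(j := p) \<in> X"
proof (rule domX_I(1))
  note x = domX_D(1)[OF assms(1)]
  show P: "x(j := p) \<in> {1..} \<rightarrow>\<^sub>E space M" using x assms by (auto simp: PiE_iff extensional_def)
  fix n
  have "diag_prod n (x(j := p)) \<le> (1 + \<gamma> j * k p p) * diag_prod n x"
  proof (cases "j \<in> {1..n}")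
    case True
    let ?R = "\<Prod>i\<in>{1..n} - {j}. 1 + \<gamma> i * k (x i) (x i)"
    have R: "0 \<le> ?R" using x by (intro prod_nonneg ballI add_nonneg_nonneg diag_factor_nonneg) auto
    have "diag_prod n (x(j := p)) = (1 + \<gamma> j * k p p) * ?R"
      unfolding diag_prod_def by (subst prod.remove[OF _ True]) (auto intro!: prod.cong)
    moreover have "diag_prod n x = (1 + \<gamma> j * k (x j) (x j)) * ?R"
      unfolding diag_prod_def by (subst prod.remove[OF _ True]) auto
    moreover have "1 * ?R \<le> (1 + \<gamma> j * k (x j) (x j)) * ?R"
      using R diag_factor_nonneg[of j "x j"] assms(3) x by (intro mult_right_mono) auto
    ultimately show ?thesis using diag_factor_nonneg[of j p] assms by (simp add: mult_left_mono)
  next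
    case False
    then have "diag_prod n (x(j := p)) = diag_prod n x" unfolding diag_prod_def by (intro prod.cong) auto
    then show ?thesis
      using diag_prod_nonneg[OF x, of n] mult_right_mono[of 1 "1 + \<gamma> j * k p p" "diag_prod n x"]
        diag_factor_nonneg[of j p] assms by simp
  qed
  also have "\<dots> \<le> (1 + \<gamma> j * k p p) * K_gamma k \<gamma> x x"
    using domX_D(4)[OF assms(1)] diag_factor_nonneg[of j p] assms by (intro mult_left_mono) auto
  finally show "diag_prod n (x(j := p)) \<le> (1 + \<gamma> j * k p p) * K_gamma k \<gamma> x x" .
qed

lemma sum_gamma_le: "(\<Sum>j\<in>{1..n}. \<gamma> j) \<le> (\<Sum>j. \<gamma> (Suc j))"
proof -
  have "(\<Sum>j\<in>{1..n}. \<gamma> j) = (\<Sum>j<n. \<gamma> (Suc j))"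
    by (rule sum.reindex_bij_witness[of _ Suc "\<lambda>j. j - 1"]) auto
  also have "\<dots> \<le> (\<Sum>j. \<gamma> (Suc j))"
    using summable_gamma gamma_pos by (intro sum_le_suminf) (auto intro: less_imp_le)
  finally show ?thesis .
qed

lemma prod_weights_le_exp:
  assumes "0 \<le> a"
  shows "(\<Prod>j\<in>{1..n}. 1 + \<gamma> j * a) \<le> exp (a * (\<Sum>j. \<gamma> (Suc j)))"
proof -
  have "(\<Prod>j\<in>{1..n}. 1 + \<gamma> j * a) \<le> (\<Prod>j\<in>{1..n}. exp (\<gamma> j * a))"
    using assms gamma_pos
    by (intro prod_mono conjI add_nonneg_nonneg mult_nonneg_nonneg) (auto intro: less_imp_le)
  also have "\<dots> = exp (a * (\<Sum>j\<in>{1..n}. \<gamma> j))"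
    by (simp add: exp_sum sum_distrib_left mult.commute)
  also have "\<dots> \<le> exp (a * (\<Sum>j. \<gamma> (Suc j)))" using sum_gamma_le assms by (simp add: mult_left_mono)
  finally show ?thesis .
qed

definition const_point :: "'a \<Rightarrow> nat \<Rightarrow> 'a" where
  "const_point z = (\<lambda>j\<in>{1..}. z)"

lemma const_point_apply: "j \<ge> 1 \<Longrightarrow> const_point z j = z"
  by (simp add: const_point_def)

lemma const_point_domX:
  assumes "z \<in> space M" shows "const_point z \<in> X"
proof (rule domX_I(1))
  show "const_point z \<in> {1..} \<rightarrow>\<^sub>E space M" using assms by (simp add: const_point_def)
  fix n
  have "diag_prod n (const_point z) = (\<Prod>j\<in>{1..n}. 1 + \<gamma> j * k z z)"
    unfolding diag_prod_def by (intro prod.cong) (auto simp: const_point_apply)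
  also have "\<dots> \<le> exp (k z z * (\<Sum>j. \<gamma> (Suc j)))"
    by (rule prod_weights_le_exp[OF psd_diag_nonneg[OF psd_k assms]])
  finally show "diag_prod n (const_point z) \<le> exp (k z z * (\<Sum>j. \<gamma> (Suc j)))" .
qed

lemma psd_tensor:
  assumes "u \<in> findex" shows "psd X (tensor_kernel k u)"
  unfolding tensor_kernel_def
  by (intro psd_prod psd_pullback[OF psd_k]) (use assms in \<open>auto intro: domX_D(2) findexD\<close>)

lemma psd_term: "u \<in> findex \<Longrightarrow> psd X (\<lambda>x y. prod_weight \<gamma> u * tensor_kernel k u x y)"
  by (intro psd_scale psd_tensor less_imp_le weight_pos)

text \<open>
By Cauchy-Schwarz the terms off the diagonal are dominated by those on the diagonal.
\<close>

lemma term_summable: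
  assumes "x \<in> X" "y \<in> X" "F \<subseteq> findex"
  shows "(\<lambda>u. prod_weight \<gamma> u * tensor_kernel k u x y) summable_on F"
proof -
  let ?t = "\<lambda>u x y. prod_weight \<gamma> u * tensor_kernel k u x y"
  have "(\<lambda>u. norm (?t u x y)) summable_on findex"
  proof (rule summable_on_comparison_test)
    show "(\<lambda>u. (?t u x x + ?t u y y)) summable_on findex"
      by (intro summable_on_add domX_D(3) assms)
    fix u assume u: "u \<in> findex"
    have nn: "0 \<le> ?t u x x" "0 \<le> ?t u y y" using psd_diag_nonneg[OF psd_term[OF u]] assms by auto
    have "(?t u x y)\<^sup>2 \<le> ?t u x x * ?t u y y"
      using psd_Cauchy_Schwarz[OF psd_term[OF u] assms(1,2)] .
    also have "\<dots> \<le> (?t u x x + ?t u y y)\<^sup>2"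
      unfolding power2_sum using mult_nonneg_nonneg[OF nn] zero_le_power2[of "?t u x x"]
        zero_le_power2[of "?t u y y"] by linarith
    finally show "norm (?t u x y) \<le> ?t u x x + ?t u y y"
      using nn abs_le_square_iff[of "?t u x y" "?t u x x + ?t u y y"] by simp
  qed simp
  then have "(\<lambda>u. ?t u x y) summable_on findex" by (rule abs_summable_summable)
  then show ?thesis using assms(3) by (rule summable_on_subset)
qed

lemma psd_part: "F \<subseteq> findex \<Longrightarrow> psd X (part_kernel F)"
  unfolding part_kernel_def by (rule psd_infsum) (auto intro: psd_term term_summable)

lemma part_kernel_split:
  assumes "x \<in> X" "y \<in> X" "F \<subseteq> findex" "G \<subseteq> F"
  shows "part_kernel F x y = part_kernel G x y + part_kernel (F - G) x y"
proof -
  have "part_kernel (G \<union> (F - G)) x y = part_kernel G x y + part_kernel (F - G) x y"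
    unfolding part_kernel_def by (rule infsum_Un_disjoint) (use assms in \<open>auto intro!: term_summable\<close>)
  moreover have "G \<union> (F - G) = F" using assms by auto
  ultimately show ?thesis by simp
qed

lemma part_kernel_form_mono:
  assumes "F \<subseteq> findex" "G \<subseteq> F" "c \<in> coefs X"
  shows "kernel_form (part_kernel G) c c \<le> kernel_form (part_kernel F) c c"
proof -
  have "kernel_form (part_kernel F) c c = kernel_form (\<lambda>x y. part_kernel G x y + part_kernel (F - G) x y) c c"
    using assms by (intro kernel_form_cong) (auto intro: part_kernel_split)
  moreover have "0 \<le> kernel_form (part_kernel (F - G)) c c"
    using assms by (intro semi_inner_product.ip_nonneg[OF kernel_form_semi_inner_product[OF psd_part]]) auto
  ultimately show ?thesis by (simp add: kernel_form_sum)
qed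

lemma rkhs_part_mono:
  assumes "F \<subseteq> findex" "G \<subseteq> F" "f \<in> rkhs X (part_kernel G)"
  shows "f \<in> rkhs X (part_kernel F)"
    "rkhs_inner X (part_kernel F) f f \<le> rkhs_inner X (part_kernel G) f f"
proof -
  have G: "psd X (part_kernel G)" and F: "psd X (part_kernel F)" using assms by (auto intro: psd_part)
  show "f \<in> rkhs X (part_kernel F)"
    "rkhs_inner X (part_kernel F) f f \<le> rkhs_inner X (part_kernel G) f f"
    using rkhs_subkernel[OF G F part_kernel_form_mono[OF assms(1,2)] assms(3)] by auto
qed

lemma psd_K_gamma: "psd X (K_gamma k \<gamma>)"
  unfolding K_gamma_eq_part by (rule psd_part) simp

sublocale Hg: psd_kernel X "K_gamma k \<gamma>"
  by unfold_locales (rule psd_K_gamma)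

abbreviation "ipg \<equiv> rkhs_inner X (K_gamma k \<gamma>)"

abbreviation part_section :: "nat set set \<Rightarrow> (nat \<Rightarrow> 'a) \<Rightarrow> (nat \<Rightarrow> 'a) \<Rightarrow> real" where
  "part_section F y \<equiv> zero_off X (\<lambda>x. part_kernel F x y)"

lemma part_section_mem:
  assumes "F \<subseteq> findex" "y \<in> X"
  shows "part_section F y \<in> rkhs X (K_gamma k \<gamma>)" "part_section F y \<in> rkhs X (part_kernel F)"
    "ipg (part_section F y) (part_section F y) \<le> part_kernel F y y"
proof -
  interpret F: psd_kernel X "part_kernel F" by unfold_locales (rule psd_part[OF assms(1)])
  show m: "part_section F y \<in> rkhs X (part_kernel F)" by (rule F.section_rkhs[OF assms(2)])
  show "part_section F y \<in> rkhs X (K_gamma k \<gamma>)"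
    unfolding K_gamma_eq_part by (rule rkhs_part_mono(1)[OF order_refl assms(1) m])
  show "ipg (part_section F y) (part_section F y) \<le> part_kernel F y y"
    using rkhs_part_mono(2)[OF order_refl assms(1) m] F.section_inner[OF assms(2,2)]
    unfolding K_gamma_eq_part by simp
qed

lemma part_kernel_with_coordinate:
  assumes "j \<ge> 1"
  shows "part_kernel {u \<in> findex. j \<in> u} x y = \<gamma> j * k (x j) (y j) * part_kernel {u \<in> findex. j \<notin> u} x y"
proof -
  have bij: "bij_betw (insert j) {u \<in> findex. j \<notin> u} {u \<in> findex. j \<in> u}"
    by (rule bij_betw_byWitness[of _ "\<lambda>u. u - {j}"]) (use assms in \<open>auto simp: findex_def\<close>)
  have "part_kernel {u \<in> findex. j \<in> u} x y
      = (\<Sum>\<^sub>\<infinity>u\<in>{u \<in> findex. j \<notin> u}. prod_weight \<gamma> (insert j u) * tensor_kernel k (insert j u) x y)"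
    unfolding part_kernel_def by (rule infsum_reindex_bij_betw[OF bij, symmetric])
  also have "\<dots> = (\<Sum>\<^sub>\<infinity>u\<in>{u \<in> findex. j \<notin> u}. (\<gamma> j * k (x j) (y j)) * (prod_weight \<gamma> u * tensor_kernel k u x y))"
    by (rule infsum_cong) (auto simp: term_eq_prod findexD)
  also have "\<dots> = \<gamma> j * k (x j) (y j) * part_kernel {u \<in> findex. j \<notin> u} x y"
    unfolding part_kernel_def by (rule infsum_cmult_right')
  finally show ?thesis .
qed

lemma part_kernel_without_coordinate:
  "part_kernel {u \<in> findex. j \<notin> u} (x(j := p)) (y(j := q)) = part_kernel {u \<in> findex. j \<notin> u} x y"
  unfolding part_kernel_def term_eq_prod by (intro infsum_cong prod.cong refl) auto

lemma part_kernel_without_coordinate':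
  "part_kernel {u \<in> findex. j \<notin> u} x (y(j := q)) = part_kernel {u \<in> findex. j \<notin> u} x y"
  using part_kernel_without_coordinate[of j x "x j" y q] by simp

lemma part_section_split:
  assumes "j \<ge> 1" "y \<in> X"
  shows "zero_off X (\<lambda>x. K_gamma k \<gamma> x y) =
    (\<lambda>x. part_section {u \<in> findex. j \<notin> u} y x + part_section {u \<in> findex. j \<in> u} y x)"
proof
  fix x
  have "findex - {u \<in> findex. j \<notin> u} = {u \<in> findex. j \<in> u}" by auto
  then show "zero_off X (\<lambda>x. K_gamma k \<gamma> x y) x
     = part_section {u \<in> findex. j \<notin> u} y x + part_section {u \<in> findex. j \<in> u} y x"
    using part_kernel_split[of x y findex "{u \<in> findex. j \<notin> u}"] assms
    by (auto simp: zero_off_def K_gamma_eq_part)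
qed

end

section \<open>Orthogonality of kernel parts\<close>

locale weighted_kernel_trivial_constants = weighted_kernel +
  assumes space_ne: "space M \<noteq> {}"
    and constants: "rkhs (space M) (\<lambda>_ _. 1) \<inter> rkhs (space M) k = {\<lambda>_. 0}"
begin

text \<open>
The section of \<open>K\<^sub>\<gamma>\<close> at z is the sum of a part without j, which ignores \<open>z j\<close>, and a part with j. As
\<open>l z\<close> ignores \<open>z j\<close> as well, the inner product \<open>\<delta>\<close> of l with the part with j is the same at all points
\<open>y(j := p)\<close>. So \<open>\<delta>\<close> is also the inner product of l with the average g of these parts over p with
respect to coefficients of mass 1. The norm of g is governed by the form of k at these
coefficients, which can be made arbitrarily small.
\<close>

lemma orthogonal_to_section_with_coordinate:
  assumes j: "j \<ge> 1" and l: "l \<in> rkhs X (K_gamma k \<gamma>)"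
    and inv: "\<And>y p. y \<in> X \<Longrightarrow> p \<in> space M \<Longrightarrow> l (y(j := p)) = l y" and y: "y \<in> X"
  shows "ipg l (part_section {u \<in> findex. j \<in> u} y) = 0"
proof -
  let ?F = "{u \<in> findex. j \<in> u}" and ?G = "{u \<in> findex. j \<notin> u}"
  have FG: "?F \<subseteq> findex" "?G \<subseteq> findex" by auto
  interpret F: psd_kernel X "part_kernel ?F" by unfold_locales (rule psd_part[OF FG(1)])
  define \<delta> where "\<delta> = l y - ipg l (part_section ?G y)"
  have split: "ipg l (zero_off X (\<lambda>x. K_gamma k \<gamma> x z)) = ipg l (part_section ?G z) + ipg l (part_section ?F z)"
    if "z \<in> X" for z
    unfolding part_section_split[OF j that]
    by (rule Hg.R.ip_add_right[OF part_section_mem(1)[OF FG(2) that] part_section_mem(1)[OF FG(1) that] l])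
  have F_eq: "ipg l (part_section ?F (y(j := p))) = \<delta>" if "p \<in> space M" for p
  proof -
    have z: "y(j := p) \<in> X" by (rule fun_upd_domX[OF y that j])
    have "part_section ?G (y(j := p)) = part_section ?G y"
      by (simp add: part_kernel_without_coordinate')
    then show ?thesis
      using split[OF z] Hg.reproducing[OF l z] inv[OF y that] unfolding \<delta>_def by simp
  qed
  have "ipg l (part_section ?F y) = \<delta>"
    using F_eq[OF domX_D(2)[OF y j]] by simp
  moreover have "\<delta>\<^sup>2 \<le> ipg l l * (\<gamma> j * part_kernel ?G y y) * \<epsilon>" if "\<epsilon> > 0" for \<epsilon>
  proof -
    obtain c where c: "c \<in> coefs (space M)" "comb c (\<lambda>_. 1) = 1" "kernel_form k c c < \<epsilon>"
      using constants_nearly_annihilated[OF psd_k space_ne constants \<open>\<epsilon> > 0\<close>] by blast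
    let ?I = "{p. c p \<noteq> 0}"
    have I: "finite ?I" "?I \<subseteq> space M" using c(1) by (auto simp: coefs_def)
    have z: "y(j := p) \<in> X" if "p \<in> ?I" for p using fun_upd_domX[OF y _ j] that I by auto
    have sm: "part_section ?F (y(j := p)) \<in> rkhs X (part_kernel ?F)" if "p \<in> ?I" for p
      using part_section_mem(2)[OF FG(1) z[OF that]] .
    have smg: "part_section ?F (y(j := p)) \<in> rkhs X (K_gamma k \<gamma>)" if "p \<in> ?I" for p
      using part_section_mem(1)[OF FG(1) z[OF that]] .
    define g where "g = (\<lambda>x. \<Sum>p\<in>?I. c p * part_section ?F (y(j := p)) x)"
    have gF: "g \<in> rkhs X (part_kernel ?F)"
      unfolding g_def by (intro F.R.sum_mem F.R.scale_mem sm)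
    have "rkhs_inner X (part_kernel ?F) g g
        = (\<Sum>p\<in>?I. \<Sum>q\<in>?I. c p * c q * part_kernel ?F (y(j := p)) (y(j := q)))"
    proof -
      have "rkhs_inner X (part_kernel ?F) g g = (\<Sum>p\<in>?I. \<Sum>q\<in>?I. rkhs_inner X (part_kernel ?F)
          (\<lambda>x. c p * part_section ?F (y(j := p)) x) (\<lambda>x. c q * part_section ?F (y(j := q)) x))"
        unfolding g_def by (rule F.R.ip_sum_sum[OF F.R.scale_mem[OF sm]])
      also have "\<dots> = (\<Sum>p\<in>?I. \<Sum>q\<in>?I. c p * c q * part_kernel ?F (y(j := p)) (y(j := q)))"
        using sm F.section_inner[OF z z] psd_sym[OF psd_part[OF FG(1)] z z]
        by (intro sum.cong refl) (simp add: F.R.ip_scale F.R.ip_scale_right F.R.scale_mem)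
      finally show ?thesis .
    qed
    also have "\<dots> = (\<Sum>p\<in>?I. \<Sum>q\<in>?I. (\<gamma> j * part_kernel ?G y y) * (c p * c q * k p q))"
      by (intro sum.cong refl) (simp add: part_kernel_with_coordinate[OF j] part_kernel_without_coordinate)
    also have "\<dots> = \<gamma> j * part_kernel ?G y y * kernel_form k c c"
      by (subst kernel_form_superset[OF I(1) order_refl I(1) order_refl]) (simp add: sum_distrib_left)
    finally have gn: "rkhs_inner X (part_kernel ?F) g g = \<gamma> j * part_kernel ?G y y * kernel_form k c c" .
    have gg: "g \<in> rkhs X (K_gamma k \<gamma>)" "ipg g g \<le> rkhs_inner X (part_kernel ?F) g g"
      unfolding K_gamma_eq_part using rkhs_part_mono[OF order_refl FG(1) gF] by auto
    have "ipg l g = (\<Sum>p\<in>?I. ipg l (\<lambda>x. c p * part_section ?F (y(j := p)) x))"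
      unfolding g_def by (rule Hg.R.ip_sum_right[OF Hg.R.scale_mem[OF smg] l])
    also have "\<dots> = (\<Sum>p\<in>?I. c p * \<delta>)"
      using I by (intro sum.cong refl) (auto simp: Hg.R.ip_scale_right[OF l smg] F_eq)
    also have "\<dots> = \<delta>" using c(2) by (simp add: comb_def flip: sum_distrib_right)
    finally have "\<delta>\<^sup>2 \<le> ipg l l * ipg g g" using Hg.R.Cauchy_Schwarz[OF l gg(1)] by simp
    also have "\<dots> \<le> ipg l l * (\<gamma> j * part_kernel ?G y y * kernel_form k c c)"
      using gg(2) gn by (intro mult_left_mono Hg.R.ip_nonneg l) simp
    also have "\<dots> \<le> ipg l l * (\<gamma> j * part_kernel ?G y y * \<epsilon>)"
      using c(3) psd_diag_nonneg[OF psd_part[OF FG(2)] y] gamma_pos[OF j]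
      by (intro mult_left_mono Hg.R.ip_nonneg l mult_nonneg_nonneg) auto
    finally show ?thesis by (simp add: mult_ac)
  qed
  then have "\<delta>\<^sup>2 \<le> 0"
  proof -
    assume *: "\<And>\<epsilon>. 0 < \<epsilon> \<Longrightarrow> \<delta>\<^sup>2 \<le> ipg l l * (\<gamma> j * part_kernel ?G y y) * \<epsilon>"
    define B where "B = ipg l l * (\<gamma> j * part_kernel ?G y y)"
    have "0 \<le> B" unfolding B_def
      using psd_diag_nonneg[OF psd_part[OF FG(2)] y] gamma_pos[OF j] Hg.R.ip_nonneg[OF l] by simp
    show ?thesis
    proof (rule field_le_epsilon)
      fix e :: real assume "e > 0"
      have "\<delta>\<^sup>2 \<le> B * (e / (B + 1))"
        using *[of "e / (B + 1)", folded B_def] \<open>0 \<le> B\<close> \<open>e > 0\<close> by simp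
      also have "\<dots> \<le> e" using \<open>0 \<le> B\<close> \<open>e > 0\<close> by (simp add: field_simps)
      finally show "\<delta>\<^sup>2 \<le> 0 + e" by simp
    qed
  qed
  ultimately show ?thesis by simp
qed

text \<open>
The preceding lemma treats the kernel sections. Their combinations are dense in the space of the
part with j, whose norm dominates that of \<open>H\<^sub>\<gamma>\<close>.
\<close>

lemma orthogonal_to_coordinate:
  assumes j: "j \<ge> 1" and l: "l \<in> rkhs X (K_gamma k \<gamma>)"
    and inv: "\<And>y p. y \<in> X \<Longrightarrow> p \<in> space M \<Longrightarrow> l (y(j := p)) = l y"
    and f: "f \<in> rkhs X (part_kernel {u \<in> findex. j \<in> u})"
  shows "ipg l f = 0"
proof -
  let ?F = "{u \<in> findex. j \<in> u}"
  have F: "?F \<subseteq> findex" by auto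
  interpret F: psd_kernel X "part_kernel ?F" by unfold_locales (rule psd_part[OF F])
  obtain S where S: "\<And>n. S n \<in> coefs X" "(\<lambda>n. F.R.ip_norm (\<lambda>x. F.embed (S n) x - f x)) \<longlonglongrightarrow> 0"
    using F.embed_dense[OF f] by blast
  have sub: "g \<in> rkhs X (K_gamma k \<gamma>)" "Hg.R.ip_norm g \<le> F.R.ip_norm g" if "g \<in> rkhs X (part_kernel ?F)" for g
    unfolding Hg.R.ip_norm_def F.R.ip_norm_def
    using rkhs_part_mono[OF order_refl F that, folded K_gamma_eq_part] by simp_all
  have zero: "ipg l (F.embed c) = 0" if c: "c \<in> coefs X" for c
  proof -
    have m: "part_section ?F x \<in> rkhs X (K_gamma k \<gamma>)" if "x \<in> {x. c x \<noteq> 0}" for x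
      using part_section_mem(1)[OF F, of x] c that by (auto simp: coefs_def)
    have "ipg l (F.embed c) = (\<Sum>x | c x \<noteq> 0. ipg l (\<lambda>y. c x * part_section ?F x y))"
      unfolding F.embed_eq_sum[OF c] by (rule Hg.R.ip_sum_right[OF Hg.R.scale_mem[OF m] l])
    also have "\<dots> = 0"
      using c by (intro sum.neutral ballI)
        (auto simp: Hg.R.ip_scale_right[OF l m] orthogonal_to_section_with_coordinate[OF j l inv] coefs_def)
    finally show ?thesis .
  qed
  have fg: "f \<in> rkhs X (K_gamma k \<gamma>)" by (rule sub(1)[OF f])
  have "\<bar>ipg l f\<bar> \<le> Hg.R.ip_norm l * F.R.ip_norm (\<lambda>x. F.embed (S n) x - f x)" for n
  proof -
    have e: "F.embed (S n) \<in> rkhs X (part_kernel ?F)" by (rule F.embed_rkhs[OF S(1)])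
    have d: "(\<lambda>x. F.embed (S n) x - f x) \<in> rkhs X (part_kernel ?F)" by (rule F.R.diff_mem[OF e f])
    have "ipg l (\<lambda>x. F.embed (S n) x - f x) = - ipg l f"
      using Hg.R.ip_diff_right[OF sub(1)[OF e] fg l] zero[OF S(1)] by simp
    then have "\<bar>ipg l f\<bar> \<le> Hg.R.ip_norm l * Hg.R.ip_norm (\<lambda>x. F.embed (S n) x - f x)"
      using Hg.R.abs_ip_le[OF l sub(1)[OF d]] by simp
    also have "\<dots> \<le> Hg.R.ip_norm l * F.R.ip_norm (\<lambda>x. F.embed (S n) x - f x)"
      by (intro mult_left_mono sub(2) d Hg.R.ip_norm_nonneg l)
    finally show ?thesis .
  qed
  moreover have "(\<lambda>n. Hg.R.ip_norm l * F.R.ip_norm (\<lambda>x. F.embed (S n) x - f x)) \<longlonglongrightarrow> 0"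
    using tendsto_mult_left[OF S(2), of "Hg.R.ip_norm l"] by simp
  ultimately have "\<bar>ipg l f\<bar> \<le> 0" by (intro LIMSEQ_le_const) auto
  then show ?thesis by simp
qed

end

context weighted_kernel
begin

text \<open>
An element of \<open>H\<^sub>v\<close> takes its value at y as inner product with a kernel section that depends on y only
through the coordinates in v.
\<close>

lemma subset_sum_invariant:
  assumes "u \<in> findex" "l \<in> subset_sum M k \<gamma> u" "j \<notin> u" "j \<ge> 1" "y \<in> X" "p \<in> space M"
  shows "l (y(j := p)) = l y"
proof -
  obtain h where h: "l = (\<lambda>x. \<Sum>v\<in>Pow u. h v x)" "\<And>v. v \<in> Pow u \<Longrightarrow> h v \<in> rkhs X (tensor_kernel k v)"
    using assms(2) unfolding subset_sum_def H_u_def by blast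
  have "h v (y(j := p)) = h v y" if v: "v \<in> Pow u" for v
  proof -
    have vf: "v \<in> findex" using v assms(1) unfolding findex_def by (auto intro: finite_subset)
    interpret V: psd_kernel X "tensor_kernel k v" by unfold_locales (rule psd_tensor[OF vf])
    have "tensor_kernel k v x (y(j := p)) = tensor_kernel k v x y" for x
      unfolding tensor_kernel_def using v assms(3) by (intro prod.cong) auto
    then show ?thesis
      using V.reproducing[OF h(2)[OF v] fun_upd_domX[OF assms(5,6,4)]] V.reproducing[OF h(2)[OF v] assms(5)]
      by simp
  qed
  then show ?thesis using h(1) by simp
qed

text \<open>
A representing set of least cardinality is minimal with respect to inclusion, so the choice in the
definition of the active set has a witness.
\<close>

lemma active_set_represented:
  assumes "u \<in> findex" "represented_in M k \<gamma> L u"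
  shows "active_set M k \<gamma> L \<in> findex" "represented_in M k \<gamma> L (active_set M k \<gamma> L)"
proof -
  have ex: "\<exists>u. u \<in> findex \<and> represented_in M k \<gamma> L u"
    using assms by blast
  define P where "P = (\<lambda>u. u \<in> findex \<and> represented_in M k \<gamma> L u)"
  define w where "w = (ARG_MIN card u. P u)"
  have w: "P w" "\<And>v. P v \<Longrightarrow> card w \<le> card v"
    unfolding w_def using ex arg_min_nat_lemma[of P _ card] by (auto simp: P_def)
  have "v = w" if "P v" "v \<subseteq> w" for v
    using w(2)[OF that(1)] that(2) w(1) card_seteq[of w v] findexD(1)[of w] by (auto simp: P_def)
  then have "\<exists>u. u \<in> findex \<and> represented_in M k \<gamma> L u
      \<and> (\<forall>v\<in>findex. represented_in M k \<gamma> L v \<and> v \<subseteq> u \<longrightarrow> v = u)"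
    using w(1) unfolding P_def by blast
  from someI_ex[OF this]
  show "active_set M k \<gamma> L \<in> findex" "represented_in M k \<gamma> L (active_set M k \<gamma> L)"
    unfolding active_set_def by auto
qed

end

section \<open>Integration over the sequence space\<close>

lemma sum_list_member_le:
  fixes f :: "'b \<Rightarrow> real"
  assumes "\<And>x. 0 \<le> f x" "x \<in> set xs"
  shows "f x \<le> sum_list (map f xs)"
  using assms(2)
proof (induction xs)
  case (Cons y ys)
  have "0 \<le> sum_list (map f ys)" using assms(1) by (intro sum_list_nonneg) auto
  then show ?case using Cons assms(1)[of y] by fastforce
qed simp

lemma square_integrable_mult:
  assumes "square_integrable N f" "square_integrable N g"
  shows "integrable N (\<lambda>x. f x * g x)"
proof (rule Bochner_Integration.integrable_bound)
  show "integrable N (\<lambda>x. (f x)\<^sup>2 + (g x)\<^sup>2)" using assms by (simp add: square_integrable_def)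
  show "(\<lambda>x. f x * g x) \<in> borel_measurable N"
    using assms unfolding square_integrable_def by (intro borel_measurable_times) auto
  have "\<bar>a * b\<bar> \<le> \<bar>a\<^sup>2 + b\<^sup>2\<bar>" for a b :: real
  proof -
    have "2 * \<bar>a * b\<bar> \<le> a\<^sup>2 + b\<^sup>2" using sum_squares_bound[of "\<bar>a\<bar>" "\<bar>b\<bar>"] by (simp add: abs_mult)
    then show ?thesis by linarith
  qed
  then show "AE x in N. norm (f x * g x) \<le> norm ((f x)\<^sup>2 + (g x)\<^sup>2)" by simp
qed

lemma square_integrable_semi_inner_product:
  fixes N :: "'b measure"
  shows "semi_inner_product {f. square_integrable N f} (L2_inner N)"
proof
  fix f g :: "'b \<Rightarrow> real" assume fg: "f \<in> {f. square_integrable N f}" "g \<in> {f. square_integrable N f}"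
  have "integrable N (\<lambda>x. (f x)\<^sup>2 + 2 * (f x * g x) + (g x)\<^sup>2)"
    using fg square_integrable_mult[of N f g]
    by (intro Bochner_Integration.integrable_add integrable_mult_right) (auto simp: square_integrable_def)
  moreover have "(\<lambda>x. f x + g x) \<in> borel_measurable N"
    using fg unfolding square_integrable_def by (intro borel_measurable_add) auto
  ultimately show "(\<lambda>x. f x + g x) \<in> {f. square_integrable N f}"
    by (simp add: square_integrable_def power2_sum algebra_simps)
  show "L2_inner N f g = L2_inner N g f" by (simp add: L2_inner_def mult.commute)
  fix h assume h: "h \<in> {f. square_integrable N f}"
  show "L2_inner N (\<lambda>x. f x + g x) h = L2_inner N f h + L2_inner N g h"
    using fg h by (simp add: L2_inner_def distrib_right square_integrable_mult)
next
  fix f g :: "'b \<Rightarrow> real" and c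
  show "L2_inner N (\<lambda>x. c * f x) g = c * L2_inner N f g" by (simp add: L2_inner_def mult.assoc)
qed (auto simp: square_integrable_def L2_inner_def power_mult_distrib)

locale weighted_measure = weighted_kernel_trivial_constants M k \<gamma> + prob_space M
  for M :: "'a measure" and k \<gamma> +
  assumes diag_integrable: "integrable M (\<lambda>x. k x x)"
    and section_square_integrable: "\<And>x. x \<in> space M \<Longrightarrow> square_integrable M (\<lambda>y. k y x)"
begin

abbreviation "PM \<equiv> Pi\<^sub>M {1..} (\<lambda>_ :: nat. M)"
abbreviation "Q \<equiv> seq_measure M k \<gamma>"

definition trace :: real where "trace = (\<integral>x. k x x \<partial>M)"

text \<open>
An upper bound for the integral of the diagonal of \<open>K\<^sub>\<gamma>\<close>, which is the infinite
product of the \<open>1 + \<gamma> j * trace\<close>.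
\<close>

definition diag_integral_bound :: real where "diag_integral_bound = exp (trace * (\<Sum>j. \<gamma> (Suc j)))"

sublocale P: product_prob_space "\<lambda>_ :: nat. M" "{1..}"
  by unfold_locales

lemma trace_nonneg: "0 \<le> trace"
  unfolding trace_def by (intro integral_nonneg_AE AE_I2 psd_diag_nonneg[OF psd_k])

lemma diag_factor_measurable: "(\<lambda>p. 1 + a * k p p) \<in> borel_measurable M"
  using borel_measurable_integrable[OF diag_integrable] by measurable

lemma diag_prod_measurable: "diag_prod n \<in> borel_measurable PM"
  unfolding diag_prod_def
  by (intro borel_measurable_prod measurable_compose[OF _ diag_factor_measurable]
      measurable_component_singleton) auto

text \<open>
The factors depend on different coordinates, so the integral of the product is the product of the
integrals.
\<close>

lemma nn_integral_diag_prod: "(\<integral>\<^sup>+x. ennreal (diag_prod n x) \<partial>PM) \<le> ennreal diag_integral_bound"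
proof -
  let ?J = "{1..n}"
  have fac: "0 \<le> 1 + \<gamma> j * k p p" if "j \<in> ?J" "p \<in> space M" for j p
    using diag_factor_nonneg[of j p] that by simp
  let ?F = "\<lambda>x. \<Prod>j\<in>?J. ennreal (1 + \<gamma> j * k (x j) (x j))"
  have restr: "(\<lambda>x. restrict x ?J) \<in> PM \<rightarrow>\<^sub>M Pi\<^sub>M ?J (\<lambda>_. M)" by (rule measurable_restrict_subset) auto
  have fac_meas: "(\<lambda>p. ennreal (1 + \<gamma> j * k p p)) \<in> borel_measurable M" for j
    by (rule measurable_compose[OF diag_factor_measurable measurable_ennreal])
  have F_meas: "?F \<in> borel_measurable (Pi\<^sub>M ?J (\<lambda>_. M))"
    by (intro borel_measurable_prod_ennreal measurable_compose[OF _ fac_meas] measurable_component_singleton)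
  have one: "(\<integral>\<^sup>+p. ennreal (1 + \<gamma> j * k p p) \<partial>M) = ennreal (1 + \<gamma> j * trace)" if "j \<in> ?J" for j
  proof -
    have "(\<integral>\<^sup>+p. ennreal (1 + \<gamma> j * k p p) \<partial>M) = ennreal (\<integral>p. 1 + \<gamma> j * k p p \<partial>M)"
      using diag_integrable fac[OF that] by (intro nn_integral_eq_integral) auto
    then show ?thesis using diag_integrable by (simp add: trace_def prob_space)
  qed
  have "(\<integral>\<^sup>+x. ennreal (diag_prod n x) \<partial>PM)
      = (\<integral>\<^sup>+x. (\<Prod>j\<in>?J. ennreal (1 + \<gamma> j * k (restrict x ?J j) (restrict x ?J j))) \<partial>PM)"
    unfolding diag_prod_def using fac
    by (intro nn_integral_cong) (subst prod_ennreal, auto simp: space_PiM PiE_iff)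
  also have "\<dots> = (\<integral>\<^sup>+x. ?F x \<partial>distr PM (Pi\<^sub>M ?J (\<lambda>_. M)) (\<lambda>x. restrict x ?J))"
    by (subst nn_integral_distr[OF restr]) (use F_meas in simp_all)
  also have "\<dots> = (\<integral>\<^sup>+x. (\<Prod>j\<in>?J. ennreal (1 + \<gamma> j * k (x j) (x j))) \<partial>Pi\<^sub>M ?J (\<lambda>_. M))"
    by (subst P.distr_PiM_restrict_finite) auto
  also have "\<dots> = (\<Prod>j\<in>?J. \<integral>\<^sup>+p. ennreal (1 + \<gamma> j * k p p) \<partial>M)"
    by (rule P.product_nn_integral_prod)
      (auto intro: fac_meas)
  also have "\<dots> = (\<Prod>j\<in>?J. ennreal (1 + \<gamma> j * trace))"
    by (intro prod.cong refl one)
  also have "\<dots> = ennreal (\<Prod>j\<in>?J. 1 + \<gamma> j * trace)"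
    using trace_nonneg less_imp_le[OF gamma_pos] by (intro prod_ennreal) auto
  also have "\<dots> \<le> ennreal diag_integral_bound"
    unfolding diag_integral_bound_def by (intro ennreal_leI prod_weights_le_exp trace_nonneg)
  finally show ?thesis .
qed

lemma diag_prod_mono:
  assumes "x \<in> {1..} \<rightarrow>\<^sub>E space M" "m \<le> n"
  shows "diag_prod m x \<le> diag_prod n x"
  unfolding diag_prod_eq_sum using assms(1) Pow_findex assms(2)
  by (intro sum_mono2) (auto intro!: term_diag_nonneg)

text \<open>
On sequences of points of D the products increase with n and this is their limit. The limes inferior
is defined and measurable on the whole type, and Fatou's lemma bounds its integral.
\<close>

definition liminf_diag :: "(nat \<Rightarrow> 'a) \<Rightarrow> ennreal" where
  "liminf_diag x = liminf (\<lambda>n. ennreal (diag_prod n x))"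

lemma diag_prod_le_liminf:
  assumes "x \<in> {1..} \<rightarrow>\<^sub>E space M"
  shows "ennreal (diag_prod n x) \<le> liminf_diag x"
  unfolding liminf_diag_def
  by (intro Liminf_bounded eventually_sequentiallyI[of n] ennreal_leI diag_prod_mono assms)

lemma liminf_diag_measurable: "liminf_diag \<in> borel_measurable PM"
  unfolding liminf_diag_def using diag_prod_measurable by measurable

lemma nn_integral_liminf_diag: "(\<integral>\<^sup>+x. liminf_diag x \<partial>PM) \<le> ennreal diag_integral_bound"
proof -
  have "(\<integral>\<^sup>+x. liminf_diag x \<partial>PM) \<le> liminf (\<lambda>n. \<integral>\<^sup>+x. ennreal (diag_prod n x) \<partial>PM)"
    unfolding liminf_diag_def
    by (rule nn_integral_liminf) (rule measurable_compose[OF diag_prod_measurable measurable_ennreal])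
  also have "\<dots> \<le> ennreal diag_integral_bound"
    by (intro Liminf_le always_eventually allI nn_integral_diag_prod) simp
  finally show ?thesis .
qed

lemma domX_if_liminf_finite:
  assumes "x \<in> {1..} \<rightarrow>\<^sub>E space M" "liminf_diag x < \<infinity>"
  shows "x \<in> X" "ennreal (K_gamma k \<gamma> x x) \<le> liminf_diag x"
proof -
  have eq: "liminf_diag x = ennreal (enn2real (liminf_diag x))" using assms(2) by simp
  have "diag_prod n x \<le> enn2real (liminf_diag x)" for n
  proof -
    have "ennreal (diag_prod n x) \<le> ennreal (enn2real (liminf_diag x))"
      by (subst eq[symmetric]) (rule diag_prod_le_liminf[OF assms(1)])
    then show ?thesis by (simp only: ennreal_le_iff[OF enn2real_nonneg])
  qed
  note I = domX_I[OF assms(1) this]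
  show "x \<in> X" by (rule I(1))
  show "ennreal (K_gamma k \<gamma> x x) \<le> liminf_diag x"
    by (subst eq) (rule ennreal_leI[OF I(2)])
qed

lemma liminf_finite_if_domX:
  assumes "x \<in> X" shows "liminf_diag x < \<infinity>"
proof -
  have "liminf_diag x \<le> ennreal (K_gamma k \<gamma> x x)"
    unfolding liminf_diag_def by (intro Liminf_le) (auto intro!: ennreal_leI domX_D(4)[OF assms] always_eventually)
  then show ?thesis using ennreal_less_top le_less_trans by (metis infinity_ennreal_def)
qed

lemma domX_eq: "X = {x \<in> space PM. liminf_diag x < \<infinity>}"
  using domX_if_liminf_finite(1) liminf_finite_if_domX domX_D(1) by (auto simp: space_PiM)

lemma domX_sets: "X \<in> sets PM"
  unfolding domX_eq using liminf_diag_measurable by measurable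

lemma AE_domX: "AE x in PM. x \<in> X"
proof -
  have "AE x in PM. liminf_diag x \<noteq> \<infinity>"
    using nn_integral_liminf_diag by (intro nn_integral_PInf_AE liminf_diag_measurable) (auto simp: top_unique)
  with AE_space show ?thesis
    by eventually_elim (auto intro!: domX_if_liminf_finite(1) simp: space_PiM top.not_eq_extremum)
qed

lemma domX_subset_space: "X \<inter> space PM = X" "X \<inter> space PM \<in> sets PM"
proof -
  show "X \<inter> space PM = X" by (rule Int_absorb2[OF sets.sets_into_space[OF domX_sets]])
  then show "X \<inter> space PM \<in> sets PM" using domX_sets by simp
qed

lemma space_Q: "space Q = X"
  unfolding seq_measure_def by (simp only: space_restrict_space domX_subset_space(1))

lemma prob_space_Q: "prob_space Q"
  unfolding seq_measure_def
  by (intro prob_space_restrict_space domX_sets P.emeasure_eq_1_AE AE_domX)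

lemma Q_measurable: "f \<in> borel_measurable PM \<Longrightarrow> f \<in> borel_measurable Q"
  unfolding seq_measure_def by (rule measurable_restrict_space1)

lemma Q_integral:
  fixes f :: "(nat \<Rightarrow> 'a) \<Rightarrow> real"
  assumes "f \<in> borel_measurable PM"
  shows "integrable Q f \<longleftrightarrow> integrable PM f" "(\<integral>x. f x \<partial>Q) = (\<integral>x. f x \<partial>PM)"
proof -
  have ae: "AE x in PM. indicat_real X x *\<^sub>R f x = f x" using AE_domX by eventually_elim simp
  have m: "(\<lambda>x. indicat_real X x *\<^sub>R f x) \<in> borel_measurable PM"
    using assms domX_sets by measurable
  show "integrable Q f \<longleftrightarrow> integrable PM f"
    unfolding seq_measure_def integrable_restrict_space[OF domX_subset_space(2)]
    by (rule integrable_cong_AE[OF m assms ae])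
  show "(\<integral>x. f x \<partial>Q) = (\<integral>x. f x \<partial>PM)"
    unfolding seq_measure_def integral_restrict_space[OF domX_subset_space(2)]
    by (rule integral_cong_AE[OF m assms ae])
qed

lemma Q_coordinate:
  fixes g :: "'a \<Rightarrow> real"
  assumes "j \<ge> 1" "g \<in> borel_measurable M"
  shows "(\<lambda>x. g (x j)) \<in> borel_measurable Q" "integrable Q (\<lambda>x. g (x j)) \<longleftrightarrow> integrable M g"
    "(\<integral>x. g (x j) \<partial>Q) = (\<integral>p. g p \<partial>M)"
proof -
  have c: "(\<lambda>x. x j) \<in> PM \<rightarrow>\<^sub>M M" using assms(1) by (intro measurable_component_singleton) auto
  have m: "(\<lambda>x. g (x j)) \<in> borel_measurable PM" by (rule measurable_compose[OF c assms(2)])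
  have d: "distr PM M (\<lambda>x. x j) = M" using P.PiM_component[of j] assms(1) by simp
  show "(\<lambda>x. g (x j)) \<in> borel_measurable Q" by (rule Q_measurable[OF m])
  show "integrable Q (\<lambda>x. g (x j)) \<longleftrightarrow> integrable M g"
    unfolding Q_integral(1)[OF m] using integrable_distr_eq[OF c assms(2)] d by simp
  show "(\<integral>x. g (x j) \<partial>Q) = (\<integral>p. g p \<partial>M)"
    unfolding Q_integral(2)[OF m] using integral_distr[OF c assms(2)] d by simp
qed

text \<open>
The square of \<open>f x\<close> is at most the squared norm of f times \<open>K\<^sub>\<gamma>\<close> at (x, x).
\<close>

lemma nn_integral_square_le:
  assumes "f \<in> rkhs X (K_gamma k \<gamma>)"
  shows "(\<integral>\<^sup>+x. ennreal ((f x)\<^sup>2) \<partial>Q) \<le> ennreal (ipg f f) * ennreal diag_integral_bound"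
proof -
  have "(\<integral>\<^sup>+x. ennreal ((f x)\<^sup>2) \<partial>Q) \<le> (\<integral>\<^sup>+x. ennreal (ipg f f) * liminf_diag x \<partial>Q)"
  proof (rule nn_integral_mono)
    fix x assume "x \<in> space Q"
    then have x: "x \<in> X" by (simp add: space_Q)
    have "ennreal ((f x)\<^sup>2) \<le> ennreal (ipg f f * K_gamma k \<gamma> x x)"
      by (intro ennreal_leI Hg.eval_bound assms x)
    also have "\<dots> = ennreal (ipg f f) * ennreal (K_gamma k \<gamma> x x)"
      by (intro ennreal_mult Hg.R.ip_nonneg assms psd_diag_nonneg[OF psd_K_gamma x])
    also have "\<dots> \<le> ennreal (ipg f f) * liminf_diag x"
      by (intro mult_left_mono domX_if_liminf_finite(2) domX_D(1) x liminf_finite_if_domX) simp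
    finally show "ennreal ((f x)\<^sup>2) \<le> ennreal (ipg f f) * liminf_diag x" .
  qed
  also have "\<dots> = (\<integral>\<^sup>+x. ennreal (ipg f f) * liminf_diag x * indicator X x \<partial>PM)"
    unfolding seq_measure_def by (rule nn_integral_restrict_space[OF domX_subset_space(2)])
  also have "\<dots> \<le> (\<integral>\<^sup>+x. ennreal (ipg f f) * liminf_diag x \<partial>PM)"
    by (intro nn_integral_mono) (auto simp: indicator_def)
  also have "\<dots> = ennreal (ipg f f) * (\<integral>\<^sup>+x. liminf_diag x \<partial>PM)"
    by (rule nn_integral_cmult[OF liminf_diag_measurable])
  also have "\<dots> \<le> ennreal (ipg f f) * ennreal diag_integral_bound"
    by (intro mult_left_mono nn_integral_liminf_diag) simp
  finally show ?thesis .
qed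

lemma rkhs_square_integrable:
  assumes "f \<in> rkhs X (K_gamma k \<gamma>)" "f \<in> borel_measurable Q"
  shows "square_integrable Q f"
  unfolding square_integrable_def
proof
  show "integrable Q (\<lambda>x. (f x)\<^sup>2)"
  proof (rule integrableI_bounded)
    have "(\<integral>\<^sup>+x. ennreal (norm ((f x)\<^sup>2)) \<partial>Q) \<le> ennreal (ipg f f) * ennreal diag_integral_bound"
      using nn_integral_square_le[OF assms(1)] by simp
    also have "\<dots> < \<infinity>" by (simp add: ennreal_mult_less_top)
    finally show "(\<integral>\<^sup>+x. ennreal (norm ((f x)\<^sup>2)) \<partial>Q) < \<infinity>" .
  qed (use assms(2) in measurable)
qed (rule assms(2))

text \<open>
The minimal errors are obtained from extended reals by a conversion that sends infinity to 0. The
finite error of the zero algorithm, which competes for every n, rules this case out.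
\<close>

lemma wc_error_zero_algorithm: "wc_error M k \<gamma> [] \<le> ereal (sqrt diag_integral_bound)"
  unfolding wc_error_def
proof (rule SUP_least)
  fix f assume "f \<in> rkhs_ball X (K_gamma k \<gamma>)"
  then have f: "f \<in> rkhs X (K_gamma k \<gamma>)" "ipg f f \<le> 1" by (auto simp: rkhs_ball_def rkhs_norm_def)
  have nn: "0 \<le> diag_integral_bound" by (simp add: diag_integral_bound_def)
  have "(\<integral>x. (f x)\<^sup>2 \<partial>Q) \<le> diag_integral_bound"
  proof (cases "integrable Q (\<lambda>x. (f x)\<^sup>2)")
    case True
    have "ennreal (\<integral>x. (f x)\<^sup>2 \<partial>Q) = (\<integral>\<^sup>+x. ennreal ((f x)\<^sup>2) \<partial>Q)"
      using True by (intro nn_integral_eq_integral[symmetric]) auto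
    also have "\<dots> \<le> ennreal (ipg f f) * ennreal diag_integral_bound" by (rule nn_integral_square_le[OF f(1)])
    also have "\<dots> = ennreal (ipg f f * diag_integral_bound)"
      using Hg.R.ip_nonneg[OF f(1)] nn by (simp add: ennreal_mult)
    also have "\<dots> \<le> ennreal diag_integral_bound" using f(2) nn by (intro ennreal_leI) (simp add: mult_left_le_one_le Hg.R.ip_nonneg[OF f(1)])
    finally show ?thesis using nn by (simp add: ennreal_le_iff)
  qed (use nn in \<open>simp add: not_integrable_integral_eq\<close>)
  then show "ereal (L2_norm Q (\<lambda>x. f x - apply_alg [] f x)) \<le> ereal (sqrt diag_integral_bound)"
    by (simp add: L2_norm_def L2_inner_def apply_alg_def power2_eq_square)
qed

section \<open>Fooling functions\<close>

text \<open>
The algorithm returns 0 at the multiple of h in the unit ball, since its functionals are linear on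
\<open>H\<^sub>\<gamma>\<close>; there its error is the L2 norm of this multiple.
\<close>

lemma wc_error_ge:
  assumes h: "h \<in> rkhs X (K_gamma k \<gamma>)" "ipg h h \<le> B" "B > 0"
    and A: "admissible M k \<gamma> A" and zero: "\<And>L g. (L, g) \<in> set A \<Longrightarrow> L h = 0"
  shows "ereal (L2_norm Q h / sqrt B) \<le> wc_error M k \<gamma> A"
proof -
  define f where "f = (\<lambda>x. (1 / sqrt B) * h x)"
  have f: "f \<in> rkhs X (K_gamma k \<gamma>)" unfolding f_def by (rule Hg.R.scale_mem[OF h(1)])
  have "ipg f f = (1 / sqrt B) * ((1 / sqrt B) * ipg h h)"
    unfolding f_def by (simp only: Hg.R.ip_scale[OF h(1) Hg.R.scale_mem[OF h(1)]] Hg.R.ip_scale_right[OF h(1) h(1)])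
  then have "ipg f f \<le> 1" using h(2,3) by simp
  then have ball: "f \<in> rkhs_ball X (K_gamma k \<gamma>)" using f by (simp add: rkhs_ball_def rkhs_norm_def)
  have "L f = 0" if Lg: "(L, g) \<in> set A" for L g
  proof -
    obtain u where "represented_in M k \<gamma> L u" using A Lg unfolding admissible_def by blast
    then obtain l where l: "l \<in> rkhs X (K_gamma k \<gamma>)" "\<And>f. f \<in> rkhs X (K_gamma k \<gamma>) \<Longrightarrow> L f = ipg f l"
      unfolding represented_in_def H_gamma_def by blast
    then show ?thesis using l(2)[OF f] l(2)[OF h(1)] zero[OF Lg] Hg.R.ip_scale[OF h(1) l(1), of "1 / sqrt B"]
      by (simp add: f_def)
  qed
  then have "map (\<lambda>(L, g). L f * g x) A = map (\<lambda>_. 0) A" for x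
    by (intro map_cong) auto
  then have "apply_alg A f x = 0" for x by (simp only: apply_alg_def) simp
  then have "L2_norm Q (\<lambda>x. f x - apply_alg A f x) = L2_norm Q f" by simp
  also have "\<dots> = L2_norm Q h / sqrt B"
  proof -
    have "L2_inner Q f f = (1 / B) * L2_inner Q h h"
      unfolding L2_inner_def f_def using h(3) by (simp add: field_simps flip: integral_mult_right_zero)
    then show ?thesis by (simp add: L2_norm_def real_sqrt_divide)
  qed
  finally show ?thesis unfolding wc_error_def
    by (intro SUP_upper2[OF ball]) simp
qed

lemma min_error_ge:
  assumes "\<And>A. admissible M k \<gamma> A \<Longrightarrow> nested_cost c M k \<gamma> A \<le> real n \<Longrightarrow> ereal b \<le> wc_error M k \<gamma> A"
  shows "b \<le> min_error c M k \<gamma> n"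
proof -
  let ?S = "{A. admissible M k \<gamma> A \<and> nested_cost c M k \<gamma> A \<le> real n}"
  let ?I = "INF A\<in>?S. wc_error M k \<gamma> A"
  have "ereal b \<le> ?I" using assms by (intro INF_greatest) auto
  moreover have "?I \<le> ereal (sqrt diag_integral_bound)"
    using wc_error_zero_algorithm by (intro INF_lower2[of "[]"]) (auto simp: admissible_def nested_cost_def)
  ultimately show ?thesis unfolding min_error_def by (cases ?I) auto
qed

definition tail_function :: "nat set \<Rightarrow> 'a \<Rightarrow> (nat \<Rightarrow> 'a) \<Rightarrow> real" where
  "tail_function J z = zero_off X (\<lambda>x. \<Sum>j\<in>J. \<gamma> j * k (x j) z)"

lemma singleton_part_kernel:
  assumes "finite J" "J \<subseteq> {1..}"
  shows "part_kernel ((\<lambda>j. {j}) ` J) x y = (\<Sum>j\<in>J. \<gamma> j * k (x j) (y j))"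
  using assms unfolding part_kernel_def term_eq_prod by (simp add: sum.reindex)

text \<open>
A sum of univariate sections is one section of the kernel with singleton index sets, so the diagonal
of that kernel gives its norm.
\<close>

lemma tail_function_eq_section:
  assumes "finite J" "J \<subseteq> {1..}"
  shows "tail_function J z = part_section ((\<lambda>j. {j}) ` J) (const_point z)"
  unfolding tail_function_def singleton_part_kernel[OF assms]
  using assms(2) by (intro arg_cong[of _ _ "zero_off X"] ext sum.cong) (auto simp: const_point_apply subset_iff)

lemma tail_function_norm:
  assumes "finite J" "J \<subseteq> {1..}" "z \<in> space M"
  shows "tail_function J z \<in> rkhs X (K_gamma k \<gamma>)"
    "ipg (tail_function J z) (tail_function J z) \<le> k z z * (\<Sum>j\<in>J. \<gamma> j)"
proof -
  have F: "(\<lambda>j. {j}) ` J \<subseteq> findex" using assms(2) by (auto simp: findex_def)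
  note S = part_section_mem[OF F const_point_domX[OF assms(3)]]
  show "tail_function J z \<in> rkhs X (K_gamma k \<gamma>)" unfolding tail_function_eq_section[OF assms(1,2)] by (rule S(1))
  have "part_kernel ((\<lambda>j. {j}) ` J) (const_point z) (const_point z) = k z z * (\<Sum>j\<in>J. \<gamma> j)"
    unfolding singleton_part_kernel[OF assms(1,2)] sum_distrib_left
    using assms(2) by (intro sum.cong refl) (auto simp: const_point_apply subset_iff)
  then show "ipg (tail_function J z) (tail_function J z) \<le> k z z * (\<Sum>j\<in>J. \<gamma> j)"
    unfolding tail_function_eq_section[OF assms(1,2)] using S(3) by simp
qed

text \<open>
The summand with index j lies in the RKHS of the part with j, and the representer of L does not
depend on the coordinate j.
\<close>

lemma tail_function_annihilated:
  assumes J: "finite J" "J \<subseteq> {1..}" and z: "z \<in> space M" and u: "u \<in> findex" "J \<inter> u = {}"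
    and L: "represented_in M k \<gamma> L u"
  shows "L (tail_function J z) = 0"
proof -
  obtain l where l: "l \<in> rkhs X (K_gamma k \<gamma>)" "l \<in> subset_sum M k \<gamma> u"
    "\<And>f. f \<in> rkhs X (K_gamma k \<gamma>) \<Longrightarrow> L f = ipg f l"
    using L unfolding represented_in_def H_gamma_def by blast
  have j: "j \<ge> 1" "finite {j}" "{j} \<subseteq> {1..}" "j \<notin> u" if "j \<in> J" for j using that J u by auto
  have mem: "tail_function {j} z \<in> rkhs X (K_gamma k \<gamma>)" if "j \<in> J" for j
    by (rule tail_function_norm(1)[OF j(2,3)[OF that] z])
  have orth: "ipg l (tail_function {j} z) = 0" if jJ: "j \<in> J" for j
  proof (rule orthogonal_to_coordinate[OF j(1)[OF jJ] l(1)])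
    show "l (y(j := p)) = l y" if "y \<in> X" "p \<in> space M" for y p
      by (rule subset_sum_invariant[OF u(1) l(2) j(4,1)[OF jJ] that])
    have s: "{{j}} \<subseteq> {u \<in> findex. j \<in> u}" "{{j}} \<subseteq> findex" using j(1)[OF jJ] by (auto simp: findex_def)
    have "part_section {{j}} (const_point z) \<in> rkhs X (part_kernel {u \<in> findex. j \<in> u})"
      by (rule rkhs_part_mono(1)[OF _ s(1) part_section_mem(2)[OF s(2) const_point_domX[OF z]]]) auto
    then show "tail_function {j} z \<in> rkhs X (part_kernel {u \<in> findex. j \<in> u})"
      unfolding tail_function_eq_section[OF j(2,3)[OF jJ]] by simp
  qed
  have "tail_function J z = (\<lambda>x. \<Sum>j\<in>J. tail_function {j} z x)"
    by (auto simp: tail_function_def zero_off_def)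
  then have "ipg l (tail_function J z) = (\<Sum>j\<in>J. ipg l (tail_function {j} z))"
    using Hg.R.ip_sum_right[of J "\<lambda>j. tail_function {j} z" l] mem l(1) by simp
  also have "\<dots> = 0" using orth by simp
  finally show ?thesis
    using l(3)[OF tail_function_norm(1)[OF J z]] Hg.R.ip_sym[OF l(1) tail_function_norm(1)[OF J z]] by simp
qed

text \<open>
On a probability space the L2 norm is at least the absolute value of the mean, and means are
additive.
\<close>

lemma tail_function_L2_norm:
  assumes J: "finite J" "J \<subseteq> {1..}" and z: "z \<in> space M"
  shows "(\<Sum>j\<in>J. \<gamma> j) * \<bar>\<integral>y. k y z \<partial>M\<bar> \<le> L2_norm Q (tail_function J z)"
proof -
  interpret Q: prob_space Q by (rule prob_space_Q)
  let ?f = "tail_function J z"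
  note sec = section_square_integrable[OF z, unfolded square_integrable_def]
  have km: "(\<lambda>y. k y z) \<in> borel_measurable M" by (rule conjunct1[OF sec])
  have ki: "integrable M (\<lambda>y. k y z)"
    by (rule square_integrable_imp_integrable[OF km conjunct2[OF sec]])
  have on: "?f x = (\<Sum>j\<in>J. \<gamma> j * k (x j) z)" if "x \<in> space Q" for x
    using that by (simp add: tail_function_def zero_off_def space_Q)
  have j: "j \<ge> 1" if "j \<in> J" for j using J that by auto
  have m: "?f \<in> borel_measurable Q"
    using Q_coordinate(1)[OF j km]
    by (subst measurable_cong[OF on]) (auto intro!: borel_measurable_sum borel_measurable_times)
  have i: "integrable Q (\<lambda>x. \<gamma> j * k (x j) z)" if "j \<in> J" for j
    using Q_coordinate(2)[OF j[OF that] km] ki by simp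
  have int: "integrable Q ?f"
    by (subst Bochner_Integration.integrable_cong[OF refl on]) (auto intro!: Bochner_Integration.integrable_sum i)
  have "(\<integral>x. ?f x \<partial>Q) = (\<integral>x. (\<Sum>j\<in>J. \<gamma> j * k (x j) z) \<partial>Q)"
    by (rule Bochner_Integration.integral_cong[OF refl on])
  also have "\<dots> = (\<Sum>j\<in>J. \<gamma> j * (\<integral>y. k y z \<partial>M))"
    using i Q_coordinate(3)[OF j km] by (simp add: Bochner_Integration.integral_sum)
  also have "\<dots> = (\<Sum>j\<in>J. \<gamma> j) * (\<integral>y. k y z \<partial>M)" by (simp add: sum_distrib_right)
  finally have mean: "(\<integral>x. ?f x \<partial>Q) = (\<Sum>j\<in>J. \<gamma> j) * (\<integral>y. k y z \<partial>M)" .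
  have sq: "integrable Q (\<lambda>x. (?f x)\<^sup>2)"
    using rkhs_square_integrable[OF tail_function_norm(1)[OF J z] m] by (simp add: square_integrable_def)
  have "(\<integral>x. ?f x \<partial>Q)\<^sup>2 \<le> (\<integral>x. (?f x)\<^sup>2 \<partial>Q)"
    using Q.variance_eq[OF int sq] Q.variance_positive[of ?f] by simp
  then have "\<bar>\<integral>x. ?f x \<partial>Q\<bar> \<le> L2_norm Q ?f"
    unfolding L2_norm_def L2_inner_def using real_sqrt_le_mono by (fastforce simp: power2_eq_square)
  moreover have "0 \<le> (\<Sum>j\<in>J. \<gamma> j)" using gamma_pos j by (intro sum_nonneg less_imp_le) auto
  ultimately show ?thesis by (simp add: mean abs_mult)
qed

lemma diag_pos_if_mean_nonzero:
  assumes "z \<in> space M" "(\<integral>y. k y z \<partial>M) \<noteq> 0"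
  shows "0 < k z z"
proof (rule ccontr)
  assume "\<not> 0 < k z z"
  then have "k z z = 0" using psd_diag_nonneg[OF psd_k assms(1)] by simp
  then have "k y z = 0" if "y \<in> space M" for y using psd_Cauchy_Schwarz[OF psd_k that assms(1)] by simp
  then have "(\<integral>y. k y z \<partial>M) = (\<integral>y. 0 \<partial>M)" by (intro Bochner_Integration.integral_cong) auto
  then show False using assms(2) by simp
qed

text \<open>
The tail function of J fools every algorithm of cost at most n, since by the assumption on J no
affordable functional sees a coordinate in J.
\<close>

theorem min_error_ge_tail:
  assumes z: "z \<in> space M" "(\<integral>y. k y z \<partial>M) \<noteq> 0"
    and J: "finite J" "J \<subseteq> {1..}" "J \<noteq> {}" and c: "\<And>i. 0 \<le> c i"
    and inactive: "\<And>u. u \<in> findex \<Longrightarrow> c (max_index u) \<le> real n \<Longrightarrow> J \<inter> u = {}"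
  shows "\<bar>\<integral>y. k y z \<partial>M\<bar> / sqrt (k z z) * sqrt (\<Sum>j\<in>J. \<gamma> j) \<le> min_error c M k \<gamma> n"
proof (rule min_error_ge)
  fix A assume A: "admissible M k \<gamma> A" "nested_cost c M k \<gamma> A \<le> real n"
  have pos: "0 < (\<Sum>j\<in>J. \<gamma> j)" using J gamma_pos by (intro sum_pos) auto
  have kz: "0 < k z z" by (rule diag_pos_if_mean_nonzero[OF z])
  have zero: "L (tail_function J z) = 0" if Lg: "(L, g) \<in> set A" for L g
  proof -
    obtain u where "u \<in> findex" "represented_in M k \<gamma> L u" using A(1) Lg unfolding admissible_def by blast
    note act = active_set_represented[OF this]
    have "c (max_index (active_set M k \<gamma> L)) \<le> nested_cost c M k \<gamma> A"
      unfolding nested_cost_def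
      using sum_list_member_le[of "\<lambda>(L, g). c (max_index (active_set M k \<gamma> L))" "(L, g)" A] Lg c
      by (simp add: case_prod_beta)
    then show ?thesis using A(2) inactive[OF act(1)] tail_function_annihilated[OF J(1,2) z(1) act(1) _ act(2)] by simp
  qed
  have "\<bar>\<integral>y. k y z \<partial>M\<bar> / sqrt (k z z) * sqrt (\<Sum>j\<in>J. \<gamma> j)
      = (\<Sum>j\<in>J. \<gamma> j) * \<bar>\<integral>y. k y z \<partial>M\<bar> / sqrt (k z z * (\<Sum>j\<in>J. \<gamma> j))"
    using pos kz by (simp add: real_sqrt_mult field_simps)
  also have "\<dots> \<le> L2_norm Q (tail_function J z) / sqrt (k z z * (\<Sum>j\<in>J. \<gamma> j))"
    using tail_function_L2_norm[OF J(1,2) z(1)] pos kz by (intro divide_right_mono) auto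
  finally have le: "\<bar>\<integral>y. k y z \<partial>M\<bar> / sqrt (k z z) * sqrt (\<Sum>j\<in>J. \<gamma> j)
      \<le> L2_norm Q (tail_function J z) / sqrt (k z z * (\<Sum>j\<in>J. \<gamma> j))" .
  have "ereal (L2_norm Q (tail_function J z) / sqrt (k z z * (\<Sum>j\<in>J. \<gamma> j))) \<le> wc_error M k \<gamma> A"
    using pos kz by (intro wc_error_ge[OF tail_function_norm[OF J(1,2) z(1)] _ A(1)] zero) auto
  then show "ereal (\<bar>\<integral>y. k y z \<partial>M\<bar> / sqrt (k z z) * sqrt (\<Sum>j\<in>J. \<gamma> j)) \<le> wc_error M k \<gamma> A"
    using le by (meson ereal_less_eq(3) order_trans)
qed

end

section \<open>The eigenvalue bound\<close>

text \<open>
Gaussian elimination: an equation with a non-zero coefficient at p is used to eliminate the unknown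
with index p from the others.
\<close>

lemma underdetermined_system:
  fixes b :: "'i \<Rightarrow> 'j \<Rightarrow> real"
  assumes "finite I" "finite J" "card I < card J"
  shows "\<exists>a. (\<exists>j\<in>J. a j \<noteq> 0) \<and> (\<forall>i\<in>I. (\<Sum>j\<in>J. b i j * a j) = 0)"
  using assms
proof (induction I arbitrary: J b rule: finite_induct)
  case empty
  then have "J \<noteq> {}" by auto
  then show ?case by (intro exI[of _ "\<lambda>_. 1"]) auto
next
  case (insert i I)
  show ?case
  proof (cases "\<forall>j\<in>J. b i j = 0")
    case True
    have "card I < card J" using insert by simp
    from insert.IH[OF insert.prems(1) this] obtain a where
      "\<exists>j\<in>J. a j \<noteq> 0" "\<forall>i\<in>I. (\<Sum>j\<in>J. b i j * a j) = 0" by blast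
    then show ?thesis using True by (intro exI[of _ a]) auto
  next
    case False
    then obtain p where p: "p \<in> J" "b i p \<noteq> 0" by blast
    let ?J = "J - {p}"
    define b' where "b' i' j = b i' j - b i' p * b i j / b i p" for i' j
    have "card I < card ?J" using insert p by simp
    from insert.IH[of ?J b', OF _ this] insert.prems obtain a where
      a: "\<exists>j\<in>?J. a j \<noteq> 0" "\<forall>i\<in>I. (\<Sum>j\<in>?J. b' i j * a j) = 0" by auto
    define s where "s = (\<Sum>j\<in>?J. b i j * a j)"
    \<comment> \<open>The value at p is determined by the eliminated equation i.\<close>
    define a' where "a' = a(p := - s / b i p)"
    have split: "(\<Sum>j\<in>J. b i' j * a' j) = b i' p * (- s / b i p) + (\<Sum>j\<in>?J. b i' j * a j)" for i'
      by (subst sum.remove[OF insert.prems(1) p(1)]) (auto simp: a'_def intro!: sum.cong)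
    have "(\<Sum>j\<in>J. b i' j * a' j) = 0" if "i' \<in> I" for i'
    proof -
      have "0 = (\<Sum>j\<in>?J. b' i' j * a j)" using a(2) that by simp
      also have "\<dots> = (\<Sum>j\<in>?J. b i' j * a j) - b i' p / b i p * s"
        unfolding b'_def s_def left_diff_distrib sum_subtractf sum_distrib_left
        by (simp add: mult_ac)
      finally show ?thesis unfolding split by simp
    qed
    moreover have "(\<Sum>j\<in>J. b i j * a' j) = 0" unfolding split using p(2) by (simp add: s_def)
    moreover have "\<exists>j\<in>J. a' j \<noteq> 0" using a(1) by (auto simp: a'_def)
    ultimately show ?thesis by (intro exI[of _ a']) auto
  qed
qed

lemma psd_one_plus: "psd X k \<Longrightarrow> psd X (one_plus k)"
  unfolding one_plus_def by (rule psd_add[OF psd_const_one])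

context weighted_measure
begin

sublocale U: psd_kernel "space M" "one_plus k"
  by unfold_locales (rule psd_one_plus[OF psd_k])

abbreviation "ipu \<equiv> rkhs_inner (space M) (one_plus k)"

lemma one_plus_square_integrable:
  assumes f: "f \<in> rkhs (space M) (one_plus k)"
  shows "square_integrable M f" "L2_inner M f f \<le> ipu f f * (1 + trace)"
proof -
  have m: "f \<in> borel_measurable M"
  proof (rule U.rkhs_measurable[OF _ f])
    fix x assume x: "x \<in> space M"
    have "(\<lambda>y. 1 + k y x) \<in> borel_measurable M"
      using section_square_integrable[OF x] unfolding square_integrable_def by (intro borel_measurable_add) auto
    then show "zero_off (space M) (\<lambda>y. one_plus k y x) \<in> borel_measurable M"
      by (subst measurable_cong[of _ _ "\<lambda>y. 1 + k y x"]) (auto simp: zero_off_def one_plus_def)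
  qed
  have le: "(f x)\<^sup>2 \<le> ipu f f * (1 + k x x)" if "x \<in> space M" for x
    using U.eval_bound[OF f that] by (simp add: one_plus_def)
  have i: "integrable M (\<lambda>x. ipu f f * (1 + k x x))" using diag_integrable by simp
  have sq: "integrable M (\<lambda>x. (f x)\<^sup>2)"
  proof (rule Bochner_Integration.integrable_bound[OF i])
    show "AE x in M. norm ((f x)\<^sup>2) \<le> norm (ipu f f * (1 + k x x))"
      using le by (intro AE_I2) (auto intro: order_trans[OF _ abs_ge_self])
  qed (use m in measurable)
  show "square_integrable M f" using m sq by (simp add: square_integrable_def)
  have "(\<integral>x. (f x)\<^sup>2 \<partial>M) \<le> (\<integral>x. ipu f f * (1 + k x x) \<partial>M)"
    by (rule integral_mono[OF sq i le])
  then show "L2_inner M f f \<le> ipu f f * (1 + trace)"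
    using diag_integrable by (simp add: L2_inner_def power2_eq_square trace_def prob_space)
qed

text \<open>
The adjoint is given by a definite description. The element exists by the Riesz representation of
f \<open>\<mapsto>\<close> \<open>L2_inner M f h\<close> in H(1 + k), and it is unique because its values are inner products with kernel
sections.
\<close>

lemma embedding_adjoint_represents:
  assumes h: "square_integrable M h"
  shows "embedding_adjoint M k h \<in> rkhs (space M) (one_plus k)"
    "f \<in> rkhs (space M) (one_plus k) \<Longrightarrow> ipu f (embedding_adjoint M k h) = L2_inner M f h"
proof -
  interpret L2: semi_inner_product "{f. square_integrable M f}" "L2_inner M"
    by (rule square_integrable_semi_inner_product)
  let ?H = "rkhs (space M) (one_plus k)"
  let ?C = "(1 + trace) * L2_inner M h h"
  have mem: "g \<in> {f. square_integrable M f}" if "g \<in> ?H" for g using one_plus_square_integrable(1)[OF that] by simp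
  have h': "h \<in> {f. square_integrable M f}" using h by simp
  have bound: "(L2_inner M g h)\<^sup>2 \<le> ?C * ipu g g" if g: "g \<in> ?H" for g
  proof -
    have "(L2_inner M g h)\<^sup>2 \<le> L2_inner M g g * L2_inner M h h"
      by (rule L2.Cauchy_Schwarz[OF mem[OF g] h'])
    also have "\<dots> \<le> ipu g g * (1 + trace) * L2_inner M h h"
      by (intro mult_right_mono one_plus_square_integrable(2)[OF g] L2.ip_nonneg[OF h'])
    finally show ?thesis by (simp add: mult_ac)
  qed
  have "\<exists>S. (\<forall>n. S n \<in> ?H) \<and> U.R.ip_Cauchy S \<and> (\<forall>v\<in>?H. (\<lambda>n. ipu (S n) v) \<longlonglongrightarrow> L2_inner M v h)
      \<and> (\<forall>n. U.R.ip_norm (S n) \<le> sqrt ?C + 1 / sqrt (real (Suc n)))"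
  proof (rule U.R.Riesz_approximation)
    show "L2_inner M (\<lambda>x. f x + g x) h = L2_inner M f h + L2_inner M g h" if "f \<in> ?H" "g \<in> ?H" for f g
      by (rule L2.ip_add[OF mem mem h']) (use that in auto)
    show "L2_inner M (\<lambda>x. c * f x) h = c * L2_inner M f h" if "f \<in> ?H" for c f
      by (rule L2.ip_scale[OF mem h']) (use that in auto)
    show "0 \<le> ?C" using trace_nonneg L2.ip_nonneg[OF h'] by simp
  qed (rule bound)
  then obtain S where S: "\<forall>n. S n \<in> ?H" "U.R.ip_Cauchy S"
    "\<forall>v\<in>?H. (\<lambda>n. ipu (S n) v) \<longlonglongrightarrow> L2_inner M v h" by (elim exE conjE) (rule that)
  then obtain w where w: "w \<in> ?H" "(\<lambda>n. U.R.ip_norm (\<lambda>x. S n x - w x)) \<longlonglongrightarrow> 0"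
    using U.rkhs_complete[of S] by blast
  have rep: "ipu v w = L2_inner M v h" if v: "v \<in> ?H" for v
  proof -
    have "(\<lambda>n. ipu (S n) v - ipu w v) \<longlonglongrightarrow> 0"
    proof (rule Lim_null_comparison)
      have "\<bar>ipu (S n) v - ipu w v\<bar> \<le> U.R.ip_norm (\<lambda>x. S n x - w x) * U.R.ip_norm v" for n
        using U.R.abs_ip_le[OF U.R.diff_mem[of "S n" w] v] U.R.ip_diff[of "S n" w v] S(1) w(1) v by simp
      then show "\<forall>\<^sub>F n in sequentially. norm (ipu (S n) v - ipu w v) \<le> U.R.ip_norm (\<lambda>x. S n x - w x) * U.R.ip_norm v"
        by simp
      show "(\<lambda>n. U.R.ip_norm (\<lambda>x. S n x - w x) * U.R.ip_norm v) \<longlonglongrightarrow> 0"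
        using tendsto_mult_right[OF w(2), of "U.R.ip_norm v"] by simp
    qed
    then have "(\<lambda>n. ipu (S n) v) \<longlonglongrightarrow> ipu w v" by (simp add: LIM_zero_iff)
    moreover have "(\<lambda>n. ipu (S n) v) \<longlonglongrightarrow> L2_inner M v h" using S(3) v by blast
    ultimately show ?thesis using LIMSEQ_unique U.R.ip_sym[OF w(1) v] by metis
  qed
  have "embedding_adjoint M k h \<in> ?H \<and> (\<forall>f\<in>?H. ipu f (embedding_adjoint M k h) = L2_inner M f h)"
    unfolding embedding_adjoint_def
  proof (rule theI[where a = w])
    show "w \<in> ?H \<and> (\<forall>f\<in>?H. ipu f w = L2_inner M f h)" using w(1) rep by blast
    fix w' assume w': "w' \<in> ?H \<and> (\<forall>f\<in>?H. ipu f w' = L2_inner M f h)"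
    show "w' = w"
    proof
      fix x show "w' x = w x"
      proof (cases "x \<in> space M")
        case True
        let ?s = "zero_off (space M) (\<lambda>y. one_plus k y x)"
        have s: "?s \<in> ?H" by (rule U.section_rkhs[OF True])
        have "ipu ?s w' = ipu ?s w" using w' rep[OF s] s by simp
        then show ?thesis
          using U.reproducing[OF _ True] U.R.ip_sym[OF s] w' w(1) by metis
      next
        case False
        then show ?thesis using U.rkhs_zero_off w' w(1) by metis
      qed
    qed
  qed
  then show "embedding_adjoint M k h \<in> ?H"
    "f \<in> ?H \<Longrightarrow> ipu f (embedding_adjoint M k h) = L2_inner M f h" by auto
qed

text \<open>
The kernel \<open>1 + \<gamma> 1 * k\<close> in the first coordinate is the part of \<open>K\<^sub>\<gamma>\<close> with the index sets \<open>{}\<close> and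
\<open>{1}\<close>, and its form dominates that of \<open>\<gamma> 1 * (1 + k)\<close> because \<open>\<gamma> 1 \<le> 1\<close>.
\<close>

lemma first_coordinate_rkhs:
  assumes "\<gamma> 1 \<le> 1" and g: "g \<in> rkhs (space M) (one_plus k)"
  shows "zero_off X (\<lambda>x. g (x 1)) \<in> rkhs X (K_gamma k \<gamma>)"
    "ipg (zero_off X (\<lambda>x. g (x 1))) (zero_off X (\<lambda>x. g (x 1))) \<le> 1 / \<gamma> 1 * ipu g g"
proof -
  have g1: "0 < \<gamma> 1" by (rule gamma_pos) simp
  have p: "x 1 \<in> space M" if "x \<in> X" for x by (rule domX_D(2)[OF that]) simp
  let ?k1 = "\<lambda>x y. k (x 1) (y 1)"
  have le: "kernel_form (\<lambda>x y. one_plus k (x 1) (y 1)) c c \<le> 1 / \<gamma> 1 * kernel_form (K_gamma k \<gamma>) c c"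
    if c: "c \<in> coefs X" for c
  proof -
    let ?A = "kernel_form (\<lambda>_ _. 1) c c" and ?B = "kernel_form ?k1 c c"
    have A: "0 \<le> ?A"
      by (rule semi_inner_product.ip_nonneg[OF kernel_form_semi_inner_product[OF psd_const_one] c])
    have "part_kernel {{}, {1}} x y = 1 + \<gamma> 1 * ?k1 x y" for x y
      unfolding part_kernel_def term_eq_prod by simp
    then have "kernel_form (\<lambda>x y. 1 + \<gamma> 1 * ?k1 x y) c c = kernel_form (part_kernel {{}, {1}}) c c"
      by (intro kernel_form_cong[OF c c]) simp
    also have "\<dots> \<le> kernel_form (K_gamma k \<gamma>) c c"
      unfolding K_gamma_eq_part by (rule part_kernel_form_mono[OF order_refl _ c]) (auto simp: findex_def)
    finally have "?A + \<gamma> 1 * ?B \<le> kernel_form (K_gamma k \<gamma>) c c"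
      by (simp add: kernel_form_sum) (simp add: kernel_form_def comb_scale_fun)
    moreover have "kernel_form (\<lambda>x y. one_plus k (x 1) (y 1)) c c = ?A + ?B"
      unfolding one_plus_def by (rule kernel_form_sum)
    moreover have "\<gamma> 1 * ?A \<le> ?A" using A assms(1) g1 by (simp add: mult_left_le_one_le)
    ultimately have "\<gamma> 1 * kernel_form (\<lambda>x y. one_plus k (x 1) (y 1)) c c \<le> kernel_form (K_gamma k \<gamma>) c c"
      by (simp add: distrib_left)
    then show ?thesis using g1 by (simp add: field_simps)
  qed
  have a: "0 \<le> 1 / \<gamma> 1" using g1 by simp
  show "zero_off X (\<lambda>x. g (x 1)) \<in> rkhs X (K_gamma k \<gamma>)"
    "ipg (zero_off X (\<lambda>x. g (x 1))) (zero_off X (\<lambda>x. g (x 1))) \<le> 1 / \<gamma> 1 * ipu g g"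
    by (rule rkhs_pullback[where p = "\<lambda>x. x 1", OF U.psd psd_K_gamma _ a _ g]; fact p le)+
qed

text \<open>
Orthonormality in H(1 + k) and the eigenvalue equation make the eigenfunctions orthogonal in L2 with
squared norms \<open>lam j\<close>. So every g in the span of the first n + 1 of them has squared L2 norm at least \<open>lam (n + 1)\<close> times its
squared norm in H(1 + k). Any n linear functionals vanish together at some non-zero g
in this span.
\<close>

theorem min_error_ge_eigenvalue:
  assumes e: "complete_orthonormal_system (space M) (one_plus k) e"
    and W: "\<And>j. j \<ge> 1 \<Longrightarrow> W_op M k (e j) = (\<lambda>x. lam j * e j x)"
    and lam: "\<And>j. j \<ge> 1 \<Longrightarrow> 0 < lam j \<and> lam (Suc j) \<le> lam j"
    and c: "\<And>i. 1 \<le> c i" and g1: "\<gamma> 1 \<le> 1"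
  shows "sqrt (\<gamma> 1 * lam (Suc n)) \<le> min_error c M k \<gamma> n"
proof (rule min_error_ge)
  fix A assume A: "admissible M k \<gamma> A" "nested_cost c M k \<gamma> A \<le> real n"
  interpret L2: semi_inner_product "{f. square_integrable M f}" "L2_inner M"
    by (rule square_integrable_semi_inner_product)
  let ?J = "{1..Suc n}"
  have pos: "0 < \<gamma> 1" by (rule gamma_pos) simp
  have em: "e j \<in> rkhs (space M) (one_plus k)" if "j \<in> ?J" for j
    using e that by (simp add: complete_orthonormal_system_def)
  have orth: "ipu (e i) (e j) = (if i = j then 1 else 0)" if "i \<in> ?J" "j \<in> ?J" for i j
    using e that by (simp add: complete_orthonormal_system_def)
  have el: "e j \<in> {f. square_integrable M f}" if "j \<in> ?J" for j
    using one_plus_square_integrable(1)[OF em[OF that]] by simp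
  have L2e: "L2_inner M (e i) (e j) = (if i = j then lam j else 0)" if "i \<in> ?J" "j \<in> ?J" for i j
  proof -
    have "L2_inner M (e i) (e j) = ipu (e i) (W_op M k (e j))"
      unfolding W_op_def using embedding_adjoint_represents(2)[OF _ em[OF that(1)]] el[OF that(2)] by simp
    also have "\<dots> = lam j * ipu (e i) (e j)"
      using W[of j] U.R.ip_scale_right[OF em[OF that(1)] em[OF that(2)]] that by simp
    finally show ?thesis using orth[OF that] by simp
  qed
  have lam_mono: "lam (Suc n) \<le> lam j" if "j \<in> ?J" for j
  proof -
    have "1 \<le> j" "j \<le> Suc n" using that by auto
    from this(2,1) show ?thesis
      by (induction rule: inc_induct) (use lam in \<open>auto intro: order_trans\<close>)
  qed
  have "real (length A) \<le> nested_cost c M k \<gamma> A"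
    unfolding nested_cost_def
  proof (induction A)
    case (Cons Lg A)
    then show ?case using c[of "max_index (active_set M k \<gamma> (fst Lg))"] by (simp add: case_prod_beta)
  qed simp
  then have len: "card {..<length A} < card ?J" using A(2) by simp
  define F where "F j = zero_off X (\<lambda>x. e j (x 1))" for j
  have Fm: "F j \<in> rkhs X (K_gamma k \<gamma>)" if "j \<in> ?J" for j
    unfolding F_def by (rule first_coordinate_rkhs(1)[OF g1 em[OF that]])
  obtain a where a: "\<exists>j\<in>?J. a j \<noteq> 0" "\<forall>i\<in>{..<length A}. (\<Sum>j\<in>?J. fst (A ! i) (F j) * a j) = 0"
    using underdetermined_system[OF _ _ len, of "\<lambda>i j. fst (A ! i) (F j)"] by auto
  define g where "g = (\<lambda>p. \<Sum>j\<in>?J. a j * e j p)"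
  define h where "h = zero_off X (\<lambda>x. g (x 1))"
  define q where "q = (\<Sum>j\<in>?J. (a j)\<^sup>2)"
  obtain j0 where j0: "j0 \<in> ?J" "a j0 \<noteq> 0" using a(1) by blast
  have q: "0 < q" unfolding q_def using j0 by (intro sum_pos2[of _ j0]) auto
  have gm: "g \<in> rkhs (space M) (one_plus k)"
    unfolding g_def by (intro U.R.sum_mem U.R.scale_mem em)
  have "ipu g g = (\<Sum>i\<in>?J. \<Sum>j\<in>?J. ipu (\<lambda>p. a i * e i p) (\<lambda>p. a j * e j p))"
    unfolding g_def by (rule U.R.ip_sum_sum[OF U.R.scale_mem[OF em]])
  also have "\<dots> = (\<Sum>i\<in>?J. \<Sum>j\<in>?J. if i = j then (a i)\<^sup>2 else 0)"
    by (intro sum.cong refl)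
      (simp add: U.R.ip_scale U.R.ip_scale_right U.R.scale_mem em orth power2_eq_square)
  also have "\<dots> = q" unfolding q_def by (simp add: sum.delta)
  finally have gq: "ipu g g = q" .
  have "L2_inner M g g = (\<Sum>i\<in>?J. \<Sum>j\<in>?J. L2_inner M (\<lambda>p. a i * e i p) (\<lambda>p. a j * e j p))"
    unfolding g_def by (rule L2.ip_sum_sum[OF L2.scale_mem[OF el]])
  also have "\<dots> = (\<Sum>i\<in>?J. \<Sum>j\<in>?J. if i = j then lam i * (a i)\<^sup>2 else 0)"
  proof (intro sum.cong refl)
    fix i j assume ij: "i \<in> ?J" "j \<in> ?J"
    show "L2_inner M (\<lambda>p. a i * e i p) (\<lambda>p. a j * e j p) = (if i = j then lam i * (a i)\<^sup>2 else 0)"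
      unfolding L2.ip_scale[OF el[OF ij(1)] L2.scale_mem[OF el[OF ij(2)]]]
        L2.ip_scale_right[OF el[OF ij(1)] el[OF ij(2)]] L2e[OF ij]
      by (simp add: power2_eq_square)
  qed
  also have "\<dots> = (\<Sum>j\<in>?J. lam j * (a j)\<^sup>2)" by (simp add: sum.delta)
  also have "\<dots> \<ge> lam (Suc n) * q"
    unfolding q_def sum_distrib_left by (intro sum_mono mult_right_mono lam_mono) auto
  finally have gL2: "lam (Suc n) * q \<le> L2_inner M g g" .
  note hm = first_coordinate_rkhs[OF g1 gm, folded h_def, unfolded gq]
  have h_sum: "h = (\<lambda>x. \<Sum>j\<in>?J. a j * F j x)"
    unfolding h_def g_def F_def by (auto simp: zero_off_def)
  have zero: "L h = 0" if Lg: "(L, r) \<in> set A" for L r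
  proof -
    obtain u where "represented_in M k \<gamma> L u" using A(1) Lg unfolding admissible_def by blast
    then obtain l where l: "l \<in> rkhs X (K_gamma k \<gamma>)" "\<And>f. f \<in> rkhs X (K_gamma k \<gamma>) \<Longrightarrow> L f = ipg f l"
      unfolding represented_in_def H_gamma_def by blast
    obtain i where i: "i < length A" "A ! i = (L, r)" using Lg by (auto simp: in_set_conv_nth)
    have "L h = ipg h l" by (rule l(2)[OF hm(1)])
    also have "\<dots> = (\<Sum>j\<in>?J. ipg (\<lambda>x. a j * F j x) l)"
      unfolding h_sum by (rule Hg.R.ip_sum[OF Hg.R.scale_mem[OF Fm] l(1)])
    also have "\<dots> = (\<Sum>j\<in>?J. L (F j) * a j)"
      by (intro sum.cong refl) (simp add: Hg.R.ip_scale[OF Fm l(1)] l(2)[OF Fm])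
    also have "\<dots> = (\<Sum>j\<in>?J. fst (A ! i) (F j) * a j)" by (simp only: i(2) fst_conv)
    also have "\<dots> = 0" using a(2) i(1) by blast
    finally show ?thesis .
  qed
  have gb: "(\<lambda>p. (g p)\<^sup>2) \<in> borel_measurable M"
    using one_plus_square_integrable(1)[OF gm] unfolding square_integrable_def by (intro borel_measurable_power) auto
  have "L2_inner Q h h = (\<integral>x. (g (x 1))\<^sup>2 \<partial>Q)"
    unfolding L2_inner_def h_def
    by (rule Bochner_Integration.integral_cong) (auto simp: space_Q zero_off_def power2_eq_square)
  also have "\<dots> = L2_inner M g g"
    using Q_coordinate(3)[OF _ gb, of 1] by (simp add: L2_inner_def power2_eq_square)
  finally have "sqrt (lam (Suc n) * q) \<le> L2_norm Q h"
    unfolding L2_norm_def using gL2 by simp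
  then have "sqrt (lam (Suc n) * q) / sqrt (1 / \<gamma> 1 * q) \<le> L2_norm Q h / sqrt (1 / \<gamma> 1 * q)"
    using pos q by (intro divide_right_mono) auto
  moreover have "sqrt (lam (Suc n) * q) / sqrt (1 / \<gamma> 1 * q) = sqrt (\<gamma> 1 * lam (Suc n))"
    using pos q by (simp add: real_sqrt_mult real_sqrt_divide mult.commute)
  moreover have "ereal (L2_norm Q h / sqrt (1 / \<gamma> 1 * q)) \<le> wc_error M k \<gamma> A"
    using pos q by (intro wc_error_ge[OF hm _ A(1)] zero) auto
  ultimately show "ereal (sqrt (\<gamma> 1 * lam (Suc n))) \<le> wc_error M k \<gamma> A"
    by (metis ereal_less_eq(3) order_trans)
qed

end

section \<open>Decay rates\<close>

lemma decay_low_leI: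
  assumes "0 \<le> B" "\<And>a. a > 0 \<Longrightarrow> summable (\<lambda>j. x (Suc j) powr (1 / a)) \<Longrightarrow> ereal a \<le> B"
  shows "decay_low x \<le> B"
  unfolding decay_low_def using assms by (intro Sup_least) auto

lemma le_decay_low: "a > 0 \<Longrightarrow> summable (\<lambda>j. x (Suc j) powr (1 / a)) \<Longrightarrow> ereal a \<le> decay_low x"
  unfolding decay_low_def by (intro Sup_upper) auto

lemma summable_imp_rate_less:
  assumes x: "\<And>n. n \<ge> 1 \<Longrightarrow> E * real n powr (- b) \<le> x n" and "E > 0" "a > 0"
    and s: "summable (\<lambda>j. x (Suc j) powr (1 / a))"
  shows "a < b"
proof -
  have "summable (\<lambda>j. E powr (1 / a) * real (Suc j) powr (- b / a))"
  proof (rule summable_comparison_test'[OF s])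
    fix j
    have "E powr (1 / a) * real (Suc j) powr (- b / a) = (E * real (Suc j) powr (- b)) powr (1 / a)"
      using \<open>E > 0\<close> by (simp add: powr_mult powr_powr)
    also have "\<dots> \<le> x (Suc j) powr (1 / a)"
      using x[of "Suc j"] \<open>E > 0\<close> \<open>a > 0\<close> by (intro powr_mono2) auto
    finally show "norm (E powr (1 / a) * real (Suc j) powr (- b / a)) \<le> x (Suc j) powr (1 / a)" by simp
  qed
  then have "summable (\<lambda>j. real (Suc j) powr (- b / a))"
    using \<open>E > 0\<close> by (subst (asm) summable_cmult_iff) auto
  then have "summable (\<lambda>n. real n powr (- b / a))" by (subst (asm) summable_Suc_iff)
  then have "- b / a < -1" by (simp add: summable_real_powr_iff)
  then show ?thesis using \<open>a > 0\<close> by (simp add: field_simps)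
qed

text \<open>
Some \<open>a > 1\<close> makes \<open>x j powr (1 / a)\<close> summable, and this dominates \<open>x j\<close> since \<open>x j \<le> 1\<close>.
\<close>

lemma decay_low_gt_one_summable:
  assumes "1 < decay_low x" "\<And>j. j \<ge> 1 \<Longrightarrow> 0 < x j \<and> x j \<le> 1"
  shows "summable (\<lambda>j. x (Suc j))"
proof -
  obtain a where a: "1 < a" "summable (\<lambda>j. x (Suc j) powr (1 / a))"
    using assms(1) unfolding decay_low_def less_Sup_iff by (auto simp: one_ereal_def)
  show ?thesis
  proof (rule summable_comparison_test'[OF a(2)])
    fix j
    have "x (Suc j) powr 1 \<le> x (Suc j) powr (1 / a)"
      using a(1) assms(2)[of "Suc j"] by (intro powr_mono') auto
    then show "norm (x (Suc j)) \<le> x (Suc j) powr (1 / a)" using assms(2)[of "Suc j"] by simp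
  qed
qed

lemma dyadic_block_lower_bound:
  assumes low: "\<And>i. i \<ge> 1 \<Longrightarrow> d * real i powr (- \<alpha>) \<le> \<gamma> i" and "d > 0" "\<alpha> \<ge> 1"
    and m: "1 \<le> m" "real m \<le> C"
  shows "d * 2 powr (- \<alpha>) * C powr (1 - \<alpha>) \<le> (\<Sum>j\<in>{m+1..2*m}. \<gamma> j)"
proof -
  have "d * 2 powr (- \<alpha>) * C powr (1 - \<alpha>) \<le> d * 2 powr (- \<alpha>) * real m powr (1 - \<alpha>)"
    using m \<open>d > 0\<close> \<open>\<alpha> \<ge> 1\<close> by (intro mult_left_mono powr_mono2') auto
  also have "\<dots> = real (card {m+1..2*m}) * (d * real (2 * m) powr (- \<alpha>))"
    using m by (simp add: powr_mult powr_diff powr_minus field_simps)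
  also have "\<dots> = (\<Sum>j\<in>{m+1..2*m}. d * real (2 * m) powr (- \<alpha>))" by simp
  also have "\<dots> \<le> (\<Sum>j\<in>{m+1..2*m}. \<gamma> j)"
  proof (rule sum_mono)
    fix j assume j: "j \<in> {m+1..2*m}"
    have "d * real (2 * m) powr (- \<alpha>) \<le> d * real j powr (- \<alpha>)"
      using j \<open>d > 0\<close> \<open>\<alpha> \<ge> 1\<close> by (intro mult_left_mono powr_mono2') auto
    also have "\<dots> \<le> \<gamma> j" using j by (intro low) auto
    finally show "d * real (2 * m) powr (- \<alpha>) \<le> \<gamma> j" .
  qed
  finally show ?thesis .
qed

context weighted_measure
begin

text \<open>
With cost n, only coordinates up to \<open>t = (n / b) powr (1 / s)\<close> can be active. The block of m
coordinates after m, the least integer that is at least t, has a sum of weights of order at least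
\<open>m powr (1 - \<alpha>)\<close>, and the error is at least of the order of its square root.
\<close>

theorem min_error_ge_cost_rate:
  assumes z: "z \<in> space M" "(\<integral>y. k y z \<partial>M) \<noteq> 0"
    and low: "\<And>i. i \<ge> 1 \<Longrightarrow> d * real i powr (- \<alpha>) \<le> \<gamma> i" and d: "d > 0" and \<alpha>: "\<alpha> \<ge> 1"
    and c: "\<And>i. 1 \<le> c i" and cost: "\<And>i. i \<ge> 1 \<Longrightarrow> b * real i powr s \<le> c i" and b: "b > 0" and s: "s > 0"
  shows "\<exists>E>0. \<forall>n\<ge>1. E * real n powr (- ((\<alpha> - 1) / (2 * s))) \<le> min_error c M k \<gamma> n"
proof -
  define I where "I = \<bar>\<integral>y. k y z \<partial>M\<bar> / sqrt (k z z)"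
  \<comment> \<open>The summand 1 absorbs the rounding of t to the integer m.\<close>
  define C where "C = (1 / b) powr (1 / s) + 1"
  define E where "E = I * sqrt (d * 2 powr (- \<alpha>) * C powr (1 - \<alpha>))"
  have kz: "0 < k z z" by (rule diag_pos_if_mean_nonzero[OF z])
  have I: "0 < I" using kz z(2) by (simp add: I_def)
  have C: "0 < C" unfolding C_def by (simp add: add_nonneg_pos)
  have "0 < E" unfolding E_def using I d C by simp
  moreover have "E * real n powr (- ((\<alpha> - 1) / (2 * s))) \<le> min_error c M k \<gamma> n" if n: "n \<ge> 1" for n
  proof -
    define t where "t = (real n / b) powr (1 / s)"
    define m where "m = nat \<lceil>t\<rceil>"
    have t: "0 < t" unfolding t_def using n b by simp
    have m: "1 \<le> m" "t \<le> real m" "real m \<le> t + 1" using t by (auto simp: m_def) linarith+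
    have "t = (1 / b) powr (1 / s) * real n powr (1 / s)"
      unfolding t_def using b by (simp add: powr_mult powr_divide)
    moreover have "1 \<le> real n powr (1 / s)" using n s by (intro ge_one_powr_ge_zero) auto
    ultimately have mC: "real m \<le> C * real n powr (1 / s)" using m(3) by (simp add: C_def distrib_right)
    have inactive: "{m+1..2*m} \<inter> u = {}" if u: "u \<in> findex" "c (max_index u) \<le> real n" for u
    proof (rule ccontr)
      assume "\<not> ?thesis"
      then obtain j where j: "j \<in> u" "m + 1 \<le> j" by auto
      then have "u \<noteq> {}" "finite u" using u by (auto simp: findex_def)
      then have jM: "j \<le> max_index u" using j by (simp add: max_index_def)
      have "b * real j powr s \<le> b * real (max_index u) powr s"
        using b s jM by (intro mult_left_mono powr_mono2) auto
      also have "\<dots> \<le> c (max_index u)" using jM j by (intro cost) auto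
      finally have "real j powr s \<le> real n / b" using u(2) b by (simp add: field_simps)
      then have "(real j powr s) powr (1 / s) \<le> t" unfolding t_def using s by (intro powr_mono2) auto
      then have "real j \<le> t" using s j by (simp add: powr_powr)
      then show False using m(2) j(2) by linarith
    qed
    have "d * 2 powr (- \<alpha>) * (C * real n powr (1 / s)) powr (1 - \<alpha>) \<le> (\<Sum>j\<in>{m+1..2*m}. \<gamma> j)"
      by (rule dyadic_block_lower_bound[OF low d \<alpha> m(1) mC])
    then have sq: "sqrt (d * 2 powr (- \<alpha>) * (C * real n powr (1 / s)) powr (1 - \<alpha>)) \<le> sqrt (\<Sum>j\<in>{m+1..2*m}. \<gamma> j)"
      by (rule real_sqrt_le_mono)
    have "(1 / s) * (1 - \<alpha>) * (1 / 2) = - ((\<alpha> - 1) / (2 * s))" using s by (simp add: field_simps)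
    then have "sqrt ((real n powr (1 / s)) powr (1 - \<alpha>)) = real n powr (- ((\<alpha> - 1) / (2 * s)))"
      by (simp only: powr_powr powr_half_sqrt[OF powr_ge_zero, symmetric])
    then have "E * real n powr (- ((\<alpha> - 1) / (2 * s)))
        = I * sqrt (d * 2 powr (- \<alpha>) * (C * real n powr (1 / s)) powr (1 - \<alpha>))"
      unfolding E_def using C by (simp add: powr_mult real_sqrt_mult)
    also have "\<dots> \<le> I * sqrt (\<Sum>j\<in>{m+1..2*m}. \<gamma> j)" using sq I by (intro mult_left_mono) auto
    also have "\<dots> \<le> min_error c M k \<gamma> n"
      unfolding I_def using m(1) c order_trans[OF zero_le_one c]
      by (intro min_error_ge_tail[OF z] inactive) auto
    finally show ?thesis .
  qed
  ultimately show ?thesis by blast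
qed

lemma conv_rate_le_eigenvalue_decay:
  assumes g1: "\<gamma> 1 > 0" and lam: "\<And>j. j \<ge> 1 \<Longrightarrow> 0 < lam j"
    and low: "\<And>n. sqrt (\<gamma> 1 * lam (Suc n)) \<le> min_error c M k \<gamma> n"
  shows "conv_rate c M k \<gamma> \<le> decay_low lam / 2"
  unfolding conv_rate_def
proof (rule decay_low_leI)
  have "0 \<le> decay_low lam" unfolding decay_low_def by (rule Sup_upper) simp
  then show "0 \<le> decay_low lam / 2" by simp
  fix a :: real assume a: "a > 0" "summable (\<lambda>j. min_error c M k \<gamma> (Suc j) powr (1 / a))"
  have "summable (\<lambda>j. \<gamma> 1 powr (1 / (2 * a)) * lam (Suc (Suc j)) powr (1 / (2 * a)))"
  proof (rule summable_comparison_test'[OF a(2)])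
    fix j
    have "\<gamma> 1 powr (1 / (2 * a)) * lam (Suc (Suc j)) powr (1 / (2 * a)) = sqrt (\<gamma> 1 * lam (Suc (Suc j))) powr (1 / a)"
      using g1 lam[of "Suc (Suc j)"] by (simp add: powr_half_sqrt[symmetric] powr_powr powr_mult)
    also have "\<dots> \<le> min_error c M k \<gamma> (Suc j) powr (1 / a)"
      using low[of "Suc j"] a(1) g1 lam[of "Suc (Suc j)"] by (intro powr_mono2) auto
    finally show "norm (\<gamma> 1 powr (1 / (2 * a)) * lam (Suc (Suc j)) powr (1 / (2 * a)))
       \<le> min_error c M k \<gamma> (Suc j) powr (1 / a)" by simp
  qed
  then have "summable (\<lambda>j. lam (Suc (Suc j)) powr (1 / (2 * a)))"
    using g1 by (subst (asm) summable_cmult_iff) auto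
  then have "summable (\<lambda>j. lam (Suc j) powr (1 / (2 * a)))" by (subst (asm) summable_Suc_iff)
  then have "ereal (2 * a) \<le> decay_low lam" using a(1) by (intro le_decay_low) auto
  then show "ereal a \<le> decay_low lam / 2"
    using ereal_divide_right_mono[of "ereal (2 * a)" "decay_low lam" 2] by simp
qed

lemma conv_rate_le_cost_rate:
  assumes z: "z \<in> space M" "(\<integral>y. k y z \<partial>M) \<noteq> 0"
    and up: "1 < decay_up \<gamma>" "decay_up \<gamma> < \<infinity>"
    and c: "\<And>i. 1 \<le> c i" and cost: "\<And>i. i \<ge> 1 \<Longrightarrow> b * real i powr s \<le> c i" and b: "b > 0" and s: "s > 0"
  shows "conv_rate c M k \<gamma> \<le> (decay_up \<gamma> - 1) / ereal (2 * s)"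
proof -
  obtain r where r: "decay_up \<gamma> = ereal r" "1 < r" using up by (cases "decay_up \<gamma>") (auto simp: one_ereal_def)
  have eq: "(decay_up \<gamma> - 1) / ereal (2 * s) = ereal ((r - 1) / (2 * s))"
    using s by (simp add: r one_ereal_def)
  show ?thesis unfolding conv_rate_def eq
  proof (rule decay_low_leI)
    show "0 \<le> ereal ((r - 1) / (2 * s))" using r(2) s by simp
    fix a :: real assume a: "a > 0" "summable (\<lambda>j. min_error c M k \<gamma> (Suc j) powr (1 / a))"
    have "ereal (2 * s * a + 1) \<le> decay_up \<gamma>"
      unfolding decay_up_def
    proof (rule Inf_greatest, clarify)
      fix \<alpha> :: real assume \<alpha>: "\<alpha> \<ge> 0" "0 < (INF n\<in>{1..}. \<gamma> n * real n powr \<alpha>)"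
      define d where "d = (INF n\<in>{1..}. \<gamma> n * real n powr \<alpha>)"
      have "decay_up \<gamma> \<le> ereal \<alpha>" unfolding decay_up_def using \<alpha> by (intro Inf_lower) auto
      then have \<alpha>1: "\<alpha> \<ge> 1" using r by simp
      have low: "d * real i powr (- \<alpha>) \<le> \<gamma> i" if i: "i \<ge> 1" for i
      proof -
        have "bdd_below ((\<lambda>n. \<gamma> n * real n powr \<alpha>) ` {1..})"
          using gamma_pos by (intro bdd_belowI2[of _ 0] mult_nonneg_nonneg less_imp_le) auto
        then have "d \<le> \<gamma> i * real i powr \<alpha>" unfolding d_def using i by (intro cINF_lower) auto
        then show ?thesis using i by (simp add: powr_minus field_simps)
      qed
      obtain E where "E > 0" "\<And>n. n \<ge> 1 \<Longrightarrow> E * real n powr (- ((\<alpha> - 1) / (2 * s))) \<le> min_error c M k \<gamma> n"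
        using min_error_ge_cost_rate[OF z low _ \<alpha>1 c cost b s] \<alpha>(2) unfolding d_def by blast
      then have "a < (\<alpha> - 1) / (2 * s)" using summable_imp_rate_less a by blast
      then show "ereal (2 * s * a + 1) \<le> ereal \<alpha>" using s by (simp add: field_simps)
    qed
    then show "ereal a \<le> ereal ((r - 1) / (2 * s))" using s by (simp add: r field_simps)
  qed
qed

end

theorem proposition1:
  fixes M :: "'a measure"
    and k :: "'a \<Rightarrow> 'a \<Rightarrow> real"
    and \<gamma> lam :: "nat \<Rightarrow> real"
    and e :: "nat \<Rightarrow> 'a \<Rightarrow> real"
    and cost :: "nat \<Rightarrow> real"
    and s :: real
  assumes "prob_space M"
    and "reproducing_kernel (space M) k"
    and "rkhs (space M) (\<lambda>_ _. 1) \<inter> rkhs (space M) k = {\<lambda>_. 0}"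
    and "\<forall>f\<in>rkhs (space M) k. f \<in> borel_measurable M"
    and "integrable M (\<lambda>x. k x x)"
    and "\<forall>x\<in>space M. square_integrable M (\<lambda>y. k y x)"
    and "\<not> anova_kernel M k"
    and "\<gamma> 1 \<le> 1"
    and "\<forall>j\<ge>1. 0 < \<gamma> j \<and> \<gamma> (Suc j) \<le> \<gamma> j"
    and "\<gamma> \<longlonglongrightarrow> 0"
    and "\<exists>u. bij_betw u UNIV findex \<and>
           (\<lambda>j :: nat. prod_weight \<gamma> (u j) * embedding_norm M k ^ (2 * card (u j))) \<longlonglongrightarrow> 0"
    and "\<forall>j\<ge>1. 0 < lam j \<and> lam (Suc j) \<le> lam j"
    and "lam \<longlonglongrightarrow> 0"
    and "complete_orthonormal_system (space M) (one_plus k) e"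
    and "\<forall>j\<ge>1. W_op M k (e j) = (\<lambda>x. lam j * e j x)"
    and "mono cost"
    and "\<forall>n. 1 \<le> cost n"
    and "s > 0"
    and "\<exists>c>0. \<forall>n\<ge>1. cost n \<ge> c * real n powr s"
    and "1 < decay_low \<gamma>"
    and "decay_low \<gamma> \<le> decay_up \<gamma>"
    and "decay_up \<gamma> < \<infinity>"
    and "1 < decay_low lam"
  shows "conv_rate cost M k \<gamma> \<le> min (decay_low lam / 2) ((decay_up \<gamma> - 1) / ereal (2 * s))"
proof -
  interpret prob_space M by (rule assms(1))
  have pos: "0 < \<gamma> j" if "j \<ge> 1" for j using assms(9) that by blast
  have "\<gamma> j \<le> 1" if "j \<ge> 1" for j
    using that by (induction rule: dec_induct) (use assms(8,9) in \<open>auto intro: order_trans\<close>)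
  then have sum: "summable (\<lambda>j. \<gamma> (Suc j))"
    using pos by (intro decay_low_gt_one_summable assms(20)) auto
  interpret weighted_measure M k \<gamma>
    by unfold_locales (use pos sum assms(3,5,6) not_empty reproducing_kernel_imp_psd[OF assms(2)] in auto)
  obtain z where z: "z \<in> space M" "(\<integral>y. k y z \<partial>M) \<noteq> 0"
    using assms(7) by (auto simp: anova_kernel_def)
  obtain b where b: "b > 0" "\<And>n. n \<ge> 1 \<Longrightarrow> b * real n powr s \<le> cost n" using assms(19) by auto
  have "sqrt (\<gamma> 1 * lam (Suc n)) \<le> min_error cost M k \<gamma> n" for n
    using assms(12,15,17) by (intro min_error_ge_eigenvalue[OF assms(14) _ _ _ assms(8)]) auto
  then have "conv_rate cost M k \<gamma> \<le> decay_low lam / 2"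
    using assms(12) pos[of 1] by (intro conv_rate_le_eigenvalue_decay) auto
  moreover have "conv_rate cost M k \<gamma> \<le> (decay_up \<gamma> - 1) / ereal (2 * s)"
    using less_le_trans[OF assms(20,21)] assms(17)
    by (intro conv_rate_le_cost_rate[OF z _ assms(22) _ b(2,1) assms(18)]) auto
  ultimately show ?thesis by simp
qed

end
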